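(* There is an algorithm which, given a pathograph $\mathfrak{H}$ with no rungs and a finite set $\mathcal{F}$ of pathographs, decides whether there exists an $\mathcal{F}$-free realization of $\mathfrak{H}$.
   Context: All graphs are finite and simple. A pathograph is a tuple $\mathfrak{G}=(V,U,E,S,R,\pi)$ where $V$ (vertices) and $U$ (urpaths) are finite disjoint sets, $E\subseteq\binom{V}{2}$ (edges), $S\subseteq V\times U$ (spokes), $R\subseteq\binom{U}{2}$ (rungs), and $\pi:U\to\binom{V}{2}$ assigns to each urpath its two distinct endpoints, with $\pi(U)\cap E=\emptyset$. A graph is regarded as a pathograph with no urpaths, spokes or rungs. A realization of $\mathfrak{G}$ is a graph obtained as follows: start from the graph $(V,E)$; for each urpath $u$ with endpoints $a,b$ add new vertices $x_u^{(1)},\dots,x_u^{(m_u)}$ ($m_u\ge 1$, the internal vertices of $u$) and the edges of the path $a x_u^{(1)}\cdots x_u^{(m_u)} b$; the only further edges added are: for each spoke $(v,u)\in S$, a nonempty set of edges between $v$ and internal vertices of $u$; and for each rung $\{u,u'\}\in R$, a nonempty set of edges between internal vertices of $u$ and internal vertices of $u'$. A graph $G$ contains a pathograph $\mathfrak{F}$ if some induced subgraph of $G$ is isomorphic to a realization of $\mathfrak{F}$; for a set $\mathcal{F}$ of pathographs, $G$ is $\mathcal{F}$-free if it contains no member of $\mathcal{F}$. *)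

theory Defs
  imports Main "HOL-Library.Nat_Bijection"
begin

text \<open>A finite simple graph on vertex type 'b is a pair (W, D) of a vertex set and
a set of 2-element edges.\<close>

type_synonym 'b graph = "'b set \<times> 'b set set"

definition two_subset :: "'a set \<Rightarrow> 'a set \<Rightarrow> bool" where
  "two_subset A e \<longleftrightarrow> e \<subseteq> A \<and> card e = 2"

record 'a pathograph =
  pV :: "'a set"
  pU :: "'a set"
  pE :: "'a set set"
  pS :: "('a \<times> 'a) set"
  pR :: "'a set set"
  pPi :: "'a \<Rightarrow> 'a set"

definition wf_pathograph :: "('a, 'z) pathograph_scheme \<Rightarrow> bool" where
  "wf_pathograph H \<longleftrightarrow>
     finite (pV H) \<and> finite (pU H) \<and> pV H \<inter> pU H = {} \<and>
     (\<forall>e\<in>pE H. two_subset (pV H) e) \<and>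
     pS H \<subseteq> pV H \<times> pU H \<and>
     (\<forall>r\<in>pR H. two_subset (pU H) r) \<and>
     (\<forall>u\<in>pU H. two_subset (pV H) (pPi H u)) \<and>
     pPi H ` pU H \<inter> pE H = {}"

definition path_edges :: "'b list \<Rightarrow> 'b set set" where
  "path_edges xs = {{xs ! i, xs ! Suc i} | i. Suc i < length xs}"

text \<open>G is (isomorphic to) a realization of H: f embeds the vertices of H, and
Q u is the full path (endpoints included) realizing urpath u; its internal
vertices are set (tl (butlast (Q u))).  X is the set of extra edges coming
from spokes and rungs.\<close>

definition is_realization :: "('a, 'z) pathograph_scheme \<Rightarrow> 'b graph \<Rightarrow> bool" where
  "is_realization H G \<longleftrightarrow>
    (\<exists>f Q X.
      let V = pV H; U = pU H; W = fst G; D = snd G;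
          I = (\<lambda>u. set (tl (butlast (Q u))))
      in inj_on f V \<and>
         (\<forall>u\<in>U. length (Q u) \<ge> 3 \<and> distinct (Q u) \<and>
                 {hd (Q u), last (Q u)} = f ` pPi H u) \<and>
         (\<forall>u\<in>U. I u \<inter> f ` V = {}) \<and>
         (\<forall>u\<in>U. \<forall>u'\<in>U. u \<noteq> u' \<longrightarrow> I u \<inter> I u' = {}) \<and>
         W = f ` V \<union> (\<Union>u\<in>U. I u) \<and>
         X \<subseteq> {{f v, x} | v u x. (v, u) \<in> pS H \<and> x \<in> I u}
             \<union> {{x, y} | x y u u'. {u, u'} \<in> pR H \<and> u \<noteq> u' \<and> x \<in> I u \<and> y \<in> I u'} \<and>
         (\<forall>(v, u)\<in>pS H. \<exists>x\<in>I u. {f v, x} \<in> X) \<and>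
         (\<forall>u\<in>U. \<forall>u'\<in>U. {u, u'} \<in> pR H \<and> u \<noteq> u' \<longrightarrow> (\<exists>x\<in>I u. \<exists>y\<in>I u'. {x, y} \<in> X)) \<and>
         D = ((\<lambda>e. f ` e) ` pE H) \<union> (\<Union>u\<in>U. path_edges (Q u)) \<union> X)"

definition induced_subgraph :: "'b graph \<Rightarrow> 'b set \<Rightarrow> 'b graph" where
  "induced_subgraph G A = (A, {e \<in> snd G. e \<subseteq> A})"

definition contains :: "'b graph \<Rightarrow> ('a, 'z) pathograph_scheme \<Rightarrow> bool" where
  "contains G F \<longleftrightarrow> (\<exists>A\<subseteq>fst G. is_realization F (induced_subgraph G A))"

definition is_free :: "('a, 'z) pathograph_scheme set \<Rightarrow> 'b graph \<Rightarrow> bool" where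
  "is_free Fs G \<longleftrightarrow> (\<forall>F\<in>Fs. \<not> contains G F)"

datatype recf = Zero | Succ | Proj nat | Comp recf "recf list"
  | PrimRec recf recf | Minimize recf

lemma list_all2_mono_pred [mono]:
  "(\<And>x y. P x y \<longrightarrow> Q x y) \<Longrightarrow> list_all2 P xs ys \<longrightarrow> list_all2 Q xs ys"
  by (auto elim: list_all2_mono)

inductive eval :: "recf \<Rightarrow> nat list \<Rightarrow> nat \<Rightarrow> bool" where
  ev_zero: "eval Zero xs 0"
| ev_succ: "eval Succ (x # xs) (Suc x)"
| ev_proj: "i < length xs \<Longrightarrow> eval (Proj i) xs (xs ! i)"
| ev_comp: "list_all2 (\<lambda>g y. eval g xs y) gs ys \<Longrightarrow> eval f ys z \<Longrightarrow> eval (Comp f gs) xs z"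
| ev_pr0: "eval f xs z \<Longrightarrow> eval (PrimRec f g) (0 # xs) z"
| ev_prS: "eval (PrimRec f g) (n # xs) r \<Longrightarrow> eval g (n # r # xs) z
             \<Longrightarrow> eval (PrimRec f g) (Suc n # xs) z"
| ev_mn: "eval f (n # xs) 0 \<Longrightarrow> (\<forall>m<n. \<exists>y. eval f (m # xs) y \<and> y > 0)
             \<Longrightarrow> eval (Minimize f) xs n"

definition encode_pg :: "nat pathograph \<Rightarrow> nat" where
  "encode_pg H = list_encode
     [set_encode (pV H), set_encode (pU H),
      set_encode (set_encode ` pE H),
      set_encode (prod_encode ` pS H),
      set_encode (set_encode ` pR H),
      set_encode ((\<lambda>u. prod_encode (u, set_encode (pPi H u))) ` pU H)]"

definition encode_input :: "nat pathograph \<Rightarrow> nat pathograph set \<Rightarrow> nat" where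
  "encode_input H Fs = prod_encode (encode_pg H, set_encode (encode_pg ` Fs))"

end

theory Submission
  imports Defs
begin

text \<open>
A realization of a pathograph without rungs is given by one word per urpath: the letter of an internal
vertex is the set of branch vertices adjacent to it. A copy of a pathograph F in such a graph
is governed by boundedly many special positions, namely the images of the vertices of F and the
positions at which a path of the copy meets a branch vertex or an image of a vertex of F. The gaps
between special positions are either avoided by the copy or traversed by a single path, so only
their nonemptiness and the union of their letters matter. Hence whether F occurs depends only on the types
of the factorizations of the words into boundedly many factors, where the type of a factor records
whether its length is 0, 1 or larger and the union of its letters. The set of these types is
compatible with concatenation and takes boundedly many values, so by the pigeonhole principle on
prefixes every word can be replaced by one of bounded length. If there is an F-free realization at
all, there is thus one of size bounded by an explicit computable function, and a bounded search decides.
\<close>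

section \<open>Recursive functions and decidable predicates\<close>

text \<open>The obstacle is that the paths of a copy of \<open>F\<close> may be arbitrarily long, so
  no bounded part of the realization carries the copy. What is bounded is the number of special
  vertices: each branch vertex or image of a vertex of \<open>F\<close> has at most two neighbours
  on each path, which gives |V(F)| + 2 |U(F)| (|V(H)| + |V(F)|) of them. With \<open>m\<close>
  special positions in a word, \<open>m\<close> one-letter factors and \<open>m + 1\<close> gaps
  suffice, so \<open>2 * m + 1\<close> factors per word are considered. Copies are moved from the
  short words to the given ones: a copy in the short realization would produce one in the given
  realization, so freeness is inherited. The moved copy must again be induced, so nonadjacency has
  to be preserved as well; equality of types is symmetric and therefore lets adjacencies be traced
  in both directions. Without rungs there are no edges between different words, so each word is
  shortened on its own. The short words must still realize \<open>H\<close>; the first and the last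
  letter survive because a letter is determined by the type of the one-letter factor containing
  it.\<close>

definition rec_fun :: "nat \<Rightarrow> (nat list \<Rightarrow> nat) \<Rightarrow> bool" where
  "rec_fun k f \<longleftrightarrow> (\<exists>p. \<forall>e. length e = k \<longrightarrow> eval p e (f e))"

definition dec_pred :: "nat \<Rightarrow> (nat list \<Rightarrow> bool) \<Rightarrow> bool" where
  "dec_pred k P \<longleftrightarrow> rec_fun k (\<lambda>e. of_bool (P e))"

lemma rec_fun_cong:
  assumes "rec_fun k f" "\<And>e. length e = k \<Longrightarrow> f e = g e"
  shows "rec_fun k g"
  using assms unfolding rec_fun_def by metis

lemma dec_pred_cong:
  assumes "dec_pred k P" "\<And>e. length e = k \<Longrightarrow> P e \<longleftrightarrow> Q e"
  shows "dec_pred k Q"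
  using assms(1) unfolding dec_pred_def by (rule rec_fun_cong) (simp add: assms(2))

lemma rec_fun_comp:
  assumes "rec_fun (length gs) h" "\<forall>g\<in>set gs. rec_fun k g"
  shows "rec_fun k (\<lambda>e. h (map (\<lambda>g. g e) gs))"
proof -
  obtain p where p: "\<And>e. length e = length gs \<Longrightarrow> eval p e (h e)"
    using assms(1) unfolding rec_fun_def by blast
  obtain c where c: "\<And>g e. g \<in> set gs \<Longrightarrow> length e = k \<Longrightarrow> eval (c g) e (g e)"
    using assms(2) unfolding rec_fun_def by metis
  have "eval (Comp p (map c gs)) e (h (map (\<lambda>g. g e) gs))" if "length e = k" for e
    by (rule ev_comp[where ys = "map (\<lambda>g. g e) gs"])
      (auto simp: list_all2_conv_all_nth c that intro!: p)
  then show ?thesis unfolding rec_fun_def by blast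
qed

lemma rec_fun_nth: "i < k \<Longrightarrow> rec_fun k (\<lambda>e. e ! i)"
  unfolding rec_fun_def using ev_proj by blast

text \<open>Weakening. Argument lists act as de Bruijn environments: a quantifier or a minimization
  puts its variable at the head, so older variables are reached through \<open>tl\<close>.\<close>

lemma rec_fun_tl:
  assumes "rec_fun k f"
  shows "rec_fun (Suc k) (\<lambda>e. f (tl e))"
proof -
  let ?gs = "map (\<lambda>i e. e ! Suc i) [0..<k]"
  have "rec_fun (Suc k) (\<lambda>e. f (map (\<lambda>g. g e) ?gs))"
    by (rule rec_fun_comp) (use assms in \<open>auto intro: rec_fun_nth\<close>)
  then show ?thesis
  proof (rule rec_fun_cong)
    fix e :: "nat list" assume "length e = Suc k"
    then have "map (\<lambda>g. g e) ?gs = tl e"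
      by (intro nth_equalityI) (auto simp: nth_tl)
    then show "f (map (\<lambda>g. g e) ?gs) = f (tl e)" by simp
  qed
qed

lemma rec_fun_hd: "rec_fun (Suc k) hd"
  by (rule rec_fun_cong[OF rec_fun_nth[of 0]]) (auto simp: hd_conv_nth[symmetric] neq_Nil_conv length_Suc_conv)

lemmas rec_fun_hd1 = rec_fun_tl[OF rec_fun_hd]
lemmas rec_fun_hd2 = rec_fun_tl[OF rec_fun_hd1]
lemmas rec_fun_hd3 = rec_fun_tl[OF rec_fun_hd2]
lemmas rec_fun_hd4 = rec_fun_tl[OF rec_fun_hd3]
lemmas rec_fun_hd5 = rec_fun_tl[OF rec_fun_hd4]
lemmas rec_fun_hd6 = rec_fun_tl[OF rec_fun_hd5]
lemmas rec_fun_hd7 = rec_fun_tl[OF rec_fun_hd6]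
lemmas rec_fun_hd8 = rec_fun_tl[OF rec_fun_hd7]
lemmas rec_fun_hd9 = rec_fun_tl[OF rec_fun_hd8]
lemmas rec_fun_hd10 = rec_fun_tl[OF rec_fun_hd9]
lemmas rec_fun_hd11 = rec_fun_tl[OF rec_fun_hd10]
lemmas rec_fun_hd12 = rec_fun_tl[OF rec_fun_hd11]
lemmas rec_vars = rec_fun_hd rec_fun_hd1 rec_fun_hd2 rec_fun_hd3 rec_fun_hd4 rec_fun_hd5 rec_fun_hd6
  rec_fun_hd7 rec_fun_hd8 rec_fun_hd9 rec_fun_hd10 rec_fun_hd11 rec_fun_hd12

text \<open>Substitution: once an operation is recursive on bare variables, it is recursive on
  arbitrary recursive arguments. Primitive recursions thus need to be set up for variables
  only.\<close>

lemma rec_fun_comp1: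
  assumes "rec_fun (Suc 0) (\<lambda>e. h (hd e))" "rec_fun k a"
  shows "rec_fun k (\<lambda>e. h (a e))"
  using rec_fun_comp[of "[a]" "\<lambda>e. h (hd e)" k] assms by simp

lemma rec_fun_comp2:
  assumes "rec_fun (Suc (Suc 0)) (\<lambda>e. h (hd e) (hd (tl e)))" "rec_fun k a" "rec_fun k b"
  shows "rec_fun k (\<lambda>e. h (a e) (b e))"
  using rec_fun_comp[of "[a, b]" "\<lambda>e. h (hd e) (hd (tl e))" k] assms by simp

lemma rec_fun_Suc: assumes "rec_fun k a" shows "rec_fun k (\<lambda>e. Suc (a e))"
proof (rule rec_fun_comp1[OF _ assms])
  show "rec_fun (Suc 0) (\<lambda>e. Suc (hd e))"
    unfolding rec_fun_def by (rule exI[of _ Succ]) (auto simp: length_Suc_conv intro: ev_succ)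
qed

lemma rec_fun_zero: "rec_fun k (\<lambda>e. 0)"
  unfolding rec_fun_def using ev_zero by blast

lemma rec_fun_const: "rec_fun k (\<lambda>e. n)"
  by (induction n) (auto intro: rec_fun_zero rec_fun_Suc)

lemma rec_fun_primrec:
  assumes "rec_fun k a" "rec_fun (Suc (Suc k)) (\<lambda>e. g (hd e) (hd (tl e)) (tl (tl e)))"
  shows "rec_fun (Suc k) (\<lambda>e. rec_nat (a (tl e)) (\<lambda>n r. g n r (tl e)) (hd e))"
proof -
  obtain p where p: "\<And>e. length e = k \<Longrightarrow> eval p e (a e)"
    using assms(1) unfolding rec_fun_def by blast
  obtain q where q: "\<And>e. length e = Suc (Suc k) \<Longrightarrow> eval q e (g (hd e) (hd (tl e)) (tl (tl e)))"
    using assms(2) unfolding rec_fun_def by blast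
  have "eval (PrimRec p q) (n # e) (rec_nat (a e) (\<lambda>n r. g n r e) n)" if "length e = k" for n e
  proof (induction n)
    case 0
    then show ?case using p[OF that] by (auto intro: ev_pr0)
  next
    case (Suc n)
    then show ?case
      using q[of "n # rec_nat (a e) (\<lambda>n r. g n r e) n # e"] that by (auto intro: ev_prS)
  qed
  then show ?thesis
    unfolding rec_fun_def by (intro exI[of _ "PrimRec p q"]) (auto simp: length_Suc_conv)
qed

section \<open>Arithmetic, comparisons and bounded quantifiers\<close>

lemma rec_fun_add:
  assumes "rec_fun k a" "rec_fun k b" shows "rec_fun k (\<lambda>e. a e + b e)"
proof (rule rec_fun_comp2[OF _ assms, of "\<lambda>x y. x + y"])
  have eq: "rec_nat y (\<lambda>n r. Suc r) x = x + y" for x y :: nat by (induction x) auto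
  show "rec_fun (Suc (Suc 0)) (\<lambda>e. hd e + hd (tl e))"
    using rec_fun_primrec[of "Suc 0" hd "\<lambda>n r e. Suc r"]
    by (simp add: eq rec_vars rec_fun_Suc)
qed

lemma rec_fun_mult:
  assumes "rec_fun k a" "rec_fun k b" shows "rec_fun k (\<lambda>e. a e * b e)"
proof (rule rec_fun_comp2[OF _ assms, of "\<lambda>x y. x * y"])
  have eq: "rec_nat 0 (\<lambda>n r. r + y) x = x * y" for x y :: nat by (induction x) auto
  show "rec_fun (Suc (Suc 0)) (\<lambda>e. hd e * hd (tl e))"
    using rec_fun_primrec[of "Suc 0" "\<lambda>e. 0" "\<lambda>n r e. r + hd e"]
    by (simp add: eq rec_vars rec_fun_zero rec_fun_add)
qed

lemma rec_fun_power:
  assumes "rec_fun k a" "rec_fun k b" shows "rec_fun k (\<lambda>e. a e ^ b e)"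
\<comment> \<open>The arguments are exchanged because \<open>rec_fun_primrec\<close> recurses on the
  head and the recursion here is on the exponent.\<close>
proof (rule rec_fun_comp2[OF _ assms(2,1), of "\<lambda>x y. y ^ x"])
  have eq: "rec_nat (Suc 0) (\<lambda>n r. r * y) x = y ^ x" for x y :: nat by (induction x) auto
  show "rec_fun (Suc (Suc 0)) (\<lambda>e. hd (tl e) ^ hd e)"
    using rec_fun_primrec[of "Suc 0" "\<lambda>e. Suc 0" "\<lambda>n r e. r * hd e"]
    by (simp add: eq rec_vars rec_fun_const rec_fun_mult)
qed

lemma rec_fun_diff:
  assumes "rec_fun k a" "rec_fun k b" shows "rec_fun k (\<lambda>e. a e - b e)"
proof (rule rec_fun_comp2[OF _ assms(2,1), of "\<lambda>x y. y - x"])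
  have eq1: "rec_nat 0 (\<lambda>n r. n) x = x - Suc 0" for x :: nat by (induction x) auto
  have pred: "rec_fun (Suc 0) (\<lambda>e. hd e - Suc 0)"
    using rec_fun_primrec[of 0 "\<lambda>e. 0" "\<lambda>n r e. n"]
    by (simp add: eq1 rec_vars rec_fun_const)
  have eq: "rec_nat y (\<lambda>n r. r - Suc 0) x = y - x" for x y :: nat by (induction x) auto
  show "rec_fun (Suc (Suc 0)) (\<lambda>e. hd (tl e) - hd e)"
    using rec_fun_primrec[of "Suc 0" hd "\<lambda>n r e. r - Suc 0"] rec_fun_comp1[OF pred, of _ "\<lambda>e. hd (tl e)"]
    by (simp add: eq rec_vars)
qed

lemma dec_pred_less:
  assumes "rec_fun k a" "rec_fun k b" shows "dec_pred k (\<lambda>e. a e < b e)"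
proof -
  \<comment> \<open>Truncated subtraction: \<open>y - x\<close> is positive exactly if
    \<open>x < y\<close>, and subtracting twice from 1 turns any positive number into 1.\<close>
  have eq: "1 - (1 - (y - x)) = of_bool (x < y)" for x y :: nat by auto
  have "rec_fun k (\<lambda>e. 1 - (1 - (b e - a e)))"
    by (intro rec_fun_diff rec_fun_const assms)
  then show ?thesis unfolding dec_pred_def eq .
qed

lemma dec_pred_not: assumes "dec_pred k P" shows "dec_pred k (\<lambda>e. \<not> P e)"
proof -
  have "rec_fun k (\<lambda>e. 1 - of_bool (P e))"
    using assms unfolding dec_pred_def by (intro rec_fun_diff rec_fun_const)
  then show ?thesis unfolding dec_pred_def of_bool_not_iff
    by (rule rec_fun_cong) auto
qed

lemma dec_pred_conj: assumes "dec_pred k P" "dec_pred k Q" shows "dec_pred k (\<lambda>e. P e \<and> Q e)"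
proof -
  have "rec_fun k (\<lambda>e. of_bool (P e) * of_bool (Q e))"
    using assms unfolding dec_pred_def by (intro rec_fun_mult)
  then show ?thesis unfolding dec_pred_def of_bool_conj .
qed

lemma dec_pred_disj: assumes "dec_pred k P" "dec_pred k Q" shows "dec_pred k (\<lambda>e. P e \<or> Q e)"
  by (rule dec_pred_cong[OF dec_pred_not[OF dec_pred_conj[OF dec_pred_not dec_pred_not]]])
    (use assms in auto)

lemma dec_pred_imp: assumes "dec_pred k P" "dec_pred k Q" shows "dec_pred k (\<lambda>e. P e \<longrightarrow> Q e)"
  by (rule dec_pred_cong[OF dec_pred_disj[OF dec_pred_not]]) (use assms in auto)

lemma dec_pred_iff: assumes "dec_pred k P" "dec_pred k Q" shows "dec_pred k (\<lambda>e. P e \<longleftrightarrow> Q e)"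
  by (rule dec_pred_cong[OF dec_pred_conj[OF dec_pred_imp dec_pred_imp], of k P Q Q P])
    (use assms in auto)

lemma dec_pred_le:
  assumes "rec_fun k a" "rec_fun k b" shows "dec_pred k (\<lambda>e. a e \<le> b e)"
  by (rule dec_pred_cong[OF dec_pred_not[OF dec_pred_less[OF assms(2,1)]]]) auto

lemma dec_pred_eq:
  assumes "rec_fun k a" "rec_fun k b" shows "dec_pred k (\<lambda>e. a e = b e)"
  by (rule dec_pred_cong[OF dec_pred_conj[OF dec_pred_le[OF assms] dec_pred_le[OF assms(2,1)]]]) auto

text \<open>\<open>Minimize\<close> searches for a zero, so it is applied to the characteristic
  function of the negation. The existence hypothesis makes the search terminate.\<close>

lemma rec_fun_Least:
  assumes "dec_pred (Suc k) (\<lambda>e. P (hd e) (tl e))" "\<And>e. length e = k \<Longrightarrow> \<exists>n. P n e"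
  shows "rec_fun k (\<lambda>e. LEAST n. P n e)"
proof -
  obtain p where p: "\<And>e. length e = Suc k \<Longrightarrow> eval p e (of_bool (\<not> P (hd e) (tl e)))"
    using dec_pred_not[OF assms(1)] unfolding dec_pred_def rec_fun_def by blast
  have "eval (Minimize p) e (LEAST n. P n e)" if e: "length e = k" for e
  proof (rule ev_mn)
    have "P (LEAST n. P n e) e" using assms(2)[OF e] by (rule LeastI_ex)
    then show "eval p ((LEAST n. P n e) # e) 0"
      using p[of "(LEAST n. P n e) # e"] e by simp
    show "\<forall>m<LEAST n. P n e. \<exists>y. eval p (m # e) y \<and> 0 < y"
    proof (intro allI impI)
      fix m assume "m < (LEAST n. P n e)"
      then have "\<not> P m e" by (rule not_less_Least)
      then show "\<exists>y. eval p (m # e) y \<and> 0 < y" using p[of "m # e"] e by auto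
    qed
  qed
  then show ?thesis unfolding rec_fun_def by blast
qed

text \<open>An unbounded search that also stops at the bound \<open>t e\<close> is total. It ends
  strictly below the bound exactly if it has met a witness.\<close>

lemma dec_pred_bex:
  assumes "rec_fun k t" "dec_pred (Suc k) (\<lambda>e. P (hd e) (tl e))"
  shows "dec_pred k (\<lambda>e. \<exists>x<t e. P x e)"
proof -
  have "rec_fun k (\<lambda>e. LEAST n. t e \<le> n \<or> P n e)"
    by (rule rec_fun_Least) (auto intro!: dec_pred_disj dec_pred_le rec_fun_tl assms rec_vars)
  then have "dec_pred k (\<lambda>e. (LEAST n. t e \<le> n \<or> P n e) < t e)"
    using assms(1) by (rule dec_pred_less)
  then show ?thesis
  proof (rule dec_pred_cong)
    fix e
    have "t e \<le> (LEAST n. t e \<le> n \<or> P n e) \<or> P (LEAST n. t e \<le> n \<or> P n e) e"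
      by (rule LeastI[of _ "t e"]) simp
    moreover have "(LEAST n. t e \<le> n \<or> P n e) \<le> x" if "P x e" for x
      using that by (intro Least_le) simp
    ultimately show "((LEAST n. t e \<le> n \<or> P n e) < t e) = (\<exists>x<t e. P x e)"
      by (meson le_less_trans not_le)
  qed
qed

lemma dec_pred_ball:
  assumes "rec_fun k t" "dec_pred (Suc k) (\<lambda>e. P (hd e) (tl e))"
  shows "dec_pred k (\<lambda>e. \<forall>x<t e. P x e)"
  by (rule dec_pred_cong[OF dec_pred_not[OF dec_pred_bex[OF assms(1) dec_pred_not[OF assms(2)]]]]) auto

lemma rec_fun_div:
  assumes "rec_fun k a" "rec_fun k b" shows "rec_fun k (\<lambda>e. a e div b e)"
proof -
  \<comment> \<open>The disjunct \<open>b e = 0\<close> keeps the search total and yields 0, in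
    agreement with division by zero in HOL.\<close>
  have "rec_fun k (\<lambda>e. LEAST n. b e = 0 \<or> a e < Suc n * b e)"
  proof (rule rec_fun_Least)
    show "dec_pred (Suc k) (\<lambda>e. b (tl e) = 0 \<or> a (tl e) < Suc (hd e) * b (tl e))"
      by (intro dec_pred_disj dec_pred_eq dec_pred_less rec_fun_mult rec_fun_Suc rec_fun_const
          rec_fun_tl assms rec_vars)
    show "\<exists>n. b e = 0 \<or> a e < Suc n * b e" for e
      by (metis dividend_less_div_times mult_Suc neq0_conv)
  qed
  then show ?thesis
  proof (rule rec_fun_cong)
    fix e
    show "(LEAST n. b e = 0 \<or> a e < Suc n * b e) = a e div b e"
    proof (cases "b e = 0")
      case True
      then show ?thesis by simp
    next
      case False
      have *: "a e < Suc n * b e \<longleftrightarrow> a e div b e \<le> n" for n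
        using False by (simp add: div_less_iff_less_mult less_Suc_eq_le[symmetric] del: mult_Suc)
      show ?thesis unfolding * using False by (auto intro: Least_equality)
    qed
  qed
qed

lemma rec_fun_mod:
  assumes "rec_fun k a" "rec_fun k b" shows "rec_fun k (\<lambda>e. a e mod b e)"
proof -
  have "rec_fun k (\<lambda>e. a e - b e * (a e div b e))"
    by (intro rec_fun_diff rec_fun_mult rec_fun_div assms)
  then show ?thesis by (simp add: minus_mult_div_eq_mod)
qed

text \<open>Structural rules: with these, \<open>intro\<close> proves an explicitly written bounded
  formula decidable by decomposing its syntax.\<close>

lemmas rec_intros = rec_fun_add rec_fun_mult rec_fun_power rec_fun_diff rec_fun_div rec_fun_mod
  rec_fun_Suc rec_vars rec_fun_const dec_pred_bex dec_pred_ball dec_pred_not dec_pred_conj dec_pred_disj dec_pred_imp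
  dec_pred_iff dec_pred_less dec_pred_le dec_pred_eq

section \<open>Coding of pairs and finite sets\<close>

lemma rec_fun_prod_encode:
  assumes "rec_fun k a" "rec_fun k b" shows "rec_fun k (\<lambda>e. prod_encode (a e, b e))"
  unfolding prod_encode_def triangle_def split_conv by (intro rec_intros assms)

text \<open>Inversion by search. Each component is at most the code, so the quantifier over the
  second one can be bounded, and injectivity of the pairing leaves only one solution.\<close>

lemma rec_fun_fst_prod_decode:
  assumes "rec_fun k a" shows "rec_fun k (\<lambda>e. fst (prod_decode (a e)))"
proof (rule rec_fun_comp1[OF _ assms])
  have eq: "(LEAST x. \<exists>y<Suc c. prod_encode (x, y) = c) = fst (prod_decode c)" for c
  proof (rule Least_equality)
    show "\<exists>y<Suc c. prod_encode (fst (prod_decode c), y) = c"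
      by (rule exI[of _ "snd (prod_decode c)"]) (metis le_prod_encode_2 less_Suc_eq_le prod.collapse prod_decode_inverse)
  next
    fix x assume "\<exists>y<Suc c. prod_encode (x, y) = c"
    then show "fst (prod_decode c) \<le> x" by (metis prod_encode_inverse fst_conv order_refl)
  qed
  have "rec_fun (Suc 0) (\<lambda>e. LEAST x. \<exists>y<Suc (hd e). prod_encode (x, y) = hd e)"
  proof (rule rec_fun_Least)
    show "dec_pred (Suc (Suc 0)) (\<lambda>e. \<exists>y<Suc (hd (tl e)). prod_encode (hd e, y) = hd (tl e))"
      by (intro rec_intros rec_fun_prod_encode)
    show "\<exists>n. \<exists>y<Suc (hd e). prod_encode (n, y) = hd e" for e
      by (metis le_prod_encode_2 less_Suc_eq_le prod.collapse prod_decode_inverse)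
  qed
  then show "rec_fun (Suc 0) (\<lambda>e. fst (prod_decode (hd e)))" unfolding eq .
qed

lemma rec_fun_snd_prod_decode:
  assumes "rec_fun k a" shows "rec_fun k (\<lambda>e. snd (prod_decode (a e)))"
proof (rule rec_fun_comp1[OF _ assms])
  have eq: "(LEAST y. prod_encode (fst (prod_decode c), y) = c) = snd (prod_decode c)" for c
    by (rule Least_equality) (auto, metis prod_encode_inverse snd_conv order_refl)
  have "rec_fun (Suc 0) (\<lambda>e. LEAST y. prod_encode (fst (prod_decode (hd e)), y) = hd e)"
  proof (rule rec_fun_Least)
    show "dec_pred (Suc (Suc 0)) (\<lambda>e. prod_encode (fst (prod_decode (hd (tl e))), hd e) = hd (tl e))"
      by (intro rec_intros rec_fun_prod_encode rec_fun_fst_prod_decode)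
    show "\<exists>y. prod_encode (fst (prod_decode (hd e)), y) = hd e" for e
      by (metis prod.collapse prod_decode_inverse)
  qed
  then show "rec_fun (Suc 0) (\<lambda>e. snd (prod_decode (hd e)))" unfolding eq .
qed

lemma dec_pred_set_decode:
  assumes "rec_fun k a" "rec_fun k b" shows "dec_pred k (\<lambda>e. a e \<in> set_decode (b e))"
proof -
  have "dec_pred k (\<lambda>e. (b e div 2 ^ a e) mod 2 = 1)" by (intro rec_intros assms)
  then show ?thesis by (simp add: set_decode_def odd_iff_mod_2_eq_one)
qed

section \<open>Factorization types of words\<close>

text \<open>Length 1 has to be recognizable because special positions are isolated as one-letter
  factors, and length 0 because two nonempty factors separated only by empty ones touch each
  other.\<close>

definition piece_type :: "'a set list \<Rightarrow> nat \<times> 'a set" where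
  "piece_type z = (min 2 (length z), \<Union>(set z))"

text \<open>Empty factors are allowed, so factorizations into fewer than n factors are included.\<close>
definition fact_types :: "nat \<Rightarrow> 'a set list \<Rightarrow> (nat \<times> 'a set) list set" where
  "fact_types n w = {map piece_type zs | zs. concat zs = w \<and> length zs = n}"

text \<open>A factorization of a product of two words cuts each of them into staggered lists of factors:
  once the second word has started, nothing is left of the first.\<close>
fun staggered :: "('b \<Rightarrow> bool) \<Rightarrow> 'b list \<Rightarrow> 'b list \<Rightarrow> bool" where
  "staggered P (x # xs) (y # ys) \<longleftrightarrow> staggered P xs ys \<and> (P y \<longrightarrow> (\<forall>x\<in>set xs. \<not> P x))"
| "staggered P _ _ \<longleftrightarrow> True"

lemma staggered_map: "staggered P (map f xs) (map f ys) \<longleftrightarrow> staggered (P \<circ> f) xs ys"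
proof (induction xs arbitrary: ys)
  case (Cons x xs)
  then show ?case by (cases ys) auto
qed simp

text \<open>At the position where the second list contributes its first letter, the remaining
  factors of the first list are empty. Hence merging the factors pairwise does not change the order
  of the letters.\<close>

lemma concat_map2_append:
  assumes "length xs = length ys" "staggered (\<lambda>z. z \<noteq> []) xs ys"
  shows "concat (map2 (@) xs ys) = concat xs @ concat ys"
  using assms
proof (induction xs ys rule: list_induct2)
  case (Cons x xs y ys)
  show ?case
  proof (cases "y = []")
    case False
    then have e: "concat xs = []" using Cons.prems by simp
    have "concat (map2 (@) (x # xs) (y # ys)) = (x @ y) @ concat xs @ concat ys"
      using Cons by simp
    then show ?thesis unfolding concat.simps e by simp
  next
    case True
    then show ?thesis using Cons by simp
  qed
qed simp

text \<open>The border between \<open>x\<close> and \<open>y\<close> falls into one factor, which is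
  divided. Earlier factors belong to \<open>x\<close> with an empty partner in \<open>y\<close>,
  later ones to \<open>y\<close> with an empty partner in \<open>x\<close>.\<close>

lemma concat_eq_append_split:
  assumes "concat zs = x @ y"
  shows "\<exists>xs ys. length xs = length zs \<and> length ys = length zs \<and> concat xs = x \<and> concat ys = y \<and>
           zs = map2 (@) xs ys \<and> staggered (\<lambda>z. z \<noteq> []) xs ys"
  using assms
proof (induction zs arbitrary: x y)
  case Nil
  then show ?case by (intro exI[of _ "[]"]) auto
next
  case (Cons z zs)
  show ?case
  proof (cases "length z \<le> length x")
    case True
    then obtain x' where x': "x = z @ x'"
      using Cons.prems by (metis append_eq_append_conv_if concat.simps(2) append_take_drop_id)
    then have "concat zs = x' @ y" using Cons.prems by simp
    then obtain xs ys where *: "length xs = length zs" "length ys = length zs" "concat xs = x'"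
      "concat ys = y" "zs = map2 (@) xs ys" "staggered (\<lambda>z. z \<noteq> []) xs ys"
      using Cons.IH by blast
    show ?thesis
    proof (intro exI conjI)
      show "z # zs = map2 (@) (z # xs) ([] # ys)" using *(5) by simp
    qed (use *(1-4,6) x' in simp_all)
  next
    case False
    then obtain r where r: "z = x @ r"
      using Cons.prems by (metis append_eq_append_conv_if concat.simps(2) append_take_drop_id nat_le_linear)
    \<comment> \<open>The border lies in \<open>z\<close>, so all later factors have an empty part
      in \<open>x\<close>.\<close>
    let ?xs = "replicate (length zs) []"
    have "map2 (@) (replicate (length us) []) us = us" for us :: "'a list list"
      by (rule nth_equalityI) auto
    note 1 = this[of zs]
    have "staggered (\<lambda>z. z \<noteq> []) (replicate (length us) []) us" for us :: "'a list list"
      by (induction us) simp_all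
    note 2 = this[of zs]
    show ?thesis
    proof (intro exI conjI)
      show "z # zs = map2 (@) (x # ?xs) (r # zs)" using r by (simp only: list.map zip_Cons_Cons 1 split_conv)
      show "concat (x # ?xs) = x" by simp
      show "concat (r # zs) = y" using r Cons.prems by simp
    qed (use 2 in simp_all)
  qed
qed

definition add_type :: "nat \<times> 'a set \<Rightarrow> nat \<times> 'a set \<Rightarrow> nat \<times> 'a set" where
  "add_type s t = (min 2 (fst s + fst t), snd s \<union> snd t)"

lemma piece_type_append: "piece_type (x @ y) = add_type (piece_type x) (piece_type y)"
  by (auto simp: piece_type_def add_type_def)

lemma map_piece_type_map2:
  "map piece_type (map2 (@) xs ys) = map2 add_type (map piece_type xs) (map piece_type ys)"
  by (induction xs arbitrary: ys) (auto simp: piece_type_append zip_Cons1 split: list.split)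

text \<open>Emptiness of a factor is visible in its type. Hence the side condition on splittings can
  be stated for types, and the types of a product depend on the types of its two parts
  alone.\<close>

lemma staggered_piece_type:
  "staggered (\<lambda>z. z \<noteq> []) xs ys \<longleftrightarrow> staggered (\<lambda>t. fst t \<noteq> 0) (map piece_type xs) (map piece_type ys)"
  unfolding staggered_map by (rule arg_cong[where f = "\<lambda>P. staggered P xs ys"]) (auto simp: piece_type_def fun_eq_iff)

lemma fact_types_append:
  "fact_types n (x @ y) =
     {map2 add_type ss ts | ss ts. ss \<in> fact_types n x \<and> ts \<in> fact_types n y \<and> staggered (\<lambda>t. fst t \<noteq> 0) ss ts}"
  (is "?L = ?R")
proof
  show "?L \<subseteq> ?R"
  proof
    fix us assume "us \<in> ?L"
    then obtain zs where zs: "us = map piece_type zs" "concat zs = x @ y" "length zs = n"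
      unfolding fact_types_def by auto
    obtain xs ys where "length xs = n" "length ys = n" "concat xs = x" "concat ys = y"
      "zs = map2 (@) xs ys" "staggered (\<lambda>z. z \<noteq> []) xs ys"
      using concat_eq_append_split[OF zs(2)] zs(3) by blast
    then show "us \<in> ?R" unfolding zs(1) fact_types_def
      by (auto simp: map_piece_type_map2 staggered_piece_type simp del: map_map)
  qed
  show "?R \<subseteq> ?L"
  proof
    fix us assume "us \<in> ?R"
    then obtain xs ys where *: "us = map2 add_type (map piece_type xs) (map piece_type ys)"
      "concat xs = x" "concat ys = y" "length xs = n" "length ys = n"
      "staggered (\<lambda>t. fst t \<noteq> 0) (map piece_type xs) (map piece_type ys)"
      unfolding fact_types_def by blast
    have "concat (map2 (@) xs ys) = x @ y"
      using *(2-5) concat_map2_append[of xs ys] *(6)[folded staggered_piece_type] by simp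
    moreover have "length (map2 (@) xs ys) = n" using *(4,5) by simp
    ultimately have "map piece_type (map2 (@) xs ys) \<in> ?L" unfolding fact_types_def by blast
    then show "us \<in> ?L" unfolding map_piece_type_map2 *(1) .
  qed
qed

text \<open>A bound for the number of values of \<open>fact_types n\<close> over subsets of a set
  with at most \<open>c\<close> elements: there are at most \<open>3 * 2 ^ c\<close> types of one
  factor, then come \<open>n\<close>-tuples of types, then sets of such tuples.\<close>

definition short_bound :: "nat \<Rightarrow> nat \<Rightarrow> nat" where
  "short_bound c n = 2 ^ ((3 * 2 ^ c) ^ n)"

text \<open>Two prefixes with the same factorization types are interchangeable, so a word in which no
  prefix can be shortened has pairwise different prefix types.\<close>
lemma short_word_same_types:
  assumes "finite V" "card V \<le> c" "w \<in> lists (Pow V)"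
  shows "\<exists>w' \<in> lists (Pow V). length w' \<le> short_bound c n \<and> fact_types n w' = fact_types n w"
  using assms(3)
proof (induction "length w" arbitrary: w rule: less_induct)
  case less
  define T where "T = {..2::nat} \<times> Pow V"
  define C where "C = Pow {ts. set ts \<subseteq> T \<and> length ts = n}"
  have T: "finite T" "card T \<le> 3 * 2 ^ c" "card T > 0"
    using assms(1,2) by (auto simp: T_def card_cartesian_product card_Pow card_gt_0_iff power_increasing)
  have "card T ^ n \<le> (3 * 2 ^ c) ^ n" using T(2) by (rule power_mono) simp
  then have C: "finite C" "card C \<le> short_bound c n"
    unfolding C_def short_bound_def using T(1)
    by (simp_all add: card_Pow card_lists_length_eq finite_lists_length_eq del: power_mult_distrib)
  have inC: "fact_types n v \<in> C" if "v \<in> lists (Pow V)" for v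
    using that unfolding C_def fact_types_def T_def piece_type_def by fastforce
  show ?case
  proof (cases "length w \<le> short_bound c n")
    case True
    then show ?thesis using less.prems by blast
  next
    case False
    have "(\<lambda>i. fact_types n (take i w)) ` {..length w} \<subseteq> C"
      using inC less.prems by (auto simp: in_lists_conv_set dest: in_set_takeD)
    then have "card ((\<lambda>i. fact_types n (take i w)) ` {..length w}) \<le> card C"
      using C(1) by (rule card_mono[rotated])
    \<comment> \<open>There are \<open>length w + 1\<close> prefixes, which is more than
      \<open>card C\<close>.\<close>
    then have "\<not> inj_on (\<lambda>i. fact_types n (take i w)) {..length w}"
      using C(2) False by (auto dest: card_image)
    then obtain i j where ij: "i < j" "j \<le> length w" "fact_types n (take i w) = fact_types n (take j w)"
      unfolding inj_on_def by (metis atMost_iff nat_neq_iff)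
    \<comment> \<open>Cutting out the letters between the two prefixes keeps the types of the whole
      word.\<close>
    define v where "v = take i w @ drop j w"
    have v: "v \<in> lists (Pow V)"
      using less.prems by (auto simp: v_def in_lists_conv_set dest!: in_set_takeD in_set_dropD)
    have "fact_types n v = fact_types n w"
      using ij(3) fact_types_append[of n "take i w" "drop j w"] fact_types_append[of n "take j w" "drop j w"]
      by (simp add: v_def)
    moreover have "length v < length w" using ij by (simp add: v_def)
    ultimately show ?thesis using less.hyps[OF _ v] by simp
  qed
qed

section \<open>Factorizations as monotone sequences of cut positions\<close>

lemma fact_types_cuts:
  assumes "ts \<in> fact_types n w"
  shows "\<exists>d. mono d \<and> d 0 = 0 \<and> d n = length w \<and>
    (\<forall>k<n. ts ! k = (min 2 (d (Suc k) - d k), \<Union>i\<in>{d k..<d (Suc k)}. w ! i))"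
proof -
  obtain zs where zs: "ts = map piece_type zs" "concat zs = w" "length zs = n"
    using assms unfolding fact_types_def by blast
  \<comment> \<open>The cut \<open>d k\<close> is the position at which factor number
    \<open>k\<close> begins.\<close>
  define d where "d k = length (concat (take k zs))" for k
  have d_Suc: "d (Suc k) = d k + length (zs ! k)" if "k < n" for k
    using that zs(3) by (simp add: d_def take_Suc_conv_app_nth)
  have "mono d"
  proof (rule monoI)
    fix k l :: nat assume "k \<le> l"
    then have "concat (take l zs) = concat (take k zs) @ concat (take (l - k) (drop k zs))"
      by (metis concat_append le_add_diff_inverse take_add)
    then show "d k \<le> d l" by (simp add: d_def)
  qed
  moreover have "ts ! k = (min 2 (d (Suc k) - d k), \<Union>i\<in>{d k..<d (Suc k)}. w ! i)" if k: "k < n" for k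
  proof -
    have "w = concat (take k zs) @ zs ! k @ concat (drop (Suc k) zs)"
      using k zs by (metis concat.simps(2) concat_append id_take_nth_drop)
    then have "w ! (d k + j) = zs ! k ! j" if "j < length (zs ! k)" for j
      using that by (simp add: d_def nth_append)
    then have "(\<lambda>i. w ! i) ` {d k..<d (Suc k)} = set (zs ! k)"
      unfolding set_conv_nth d_Suc[OF k]
      by (auto simp: image_iff) (metis le_add_diff_inverse less_diff_conv2 add.commute, metis le_add1 nat_add_left_cancel_less atLeastLessThan_iff)
    then show ?thesis using k zs d_Suc[OF k] by (simp add: piece_type_def)
  qed
  ultimately show ?thesis using zs by (intro exI[of _ d]) (auto simp: d_def)
qed

lemma cuts_fact_types:
  assumes "mono d" "d 0 = 0" "d n = length w"
  shows "map (\<lambda>k. (min 2 (d (Suc k) - d k), \<Union>i\<in>{d k..<d (Suc k)}. w ! i)) [0..<n] \<in> fact_types n w"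
proof -
  define zs where "zs = map (\<lambda>k. map ((!) w) [d k..<d (Suc k)]) [0..<n]"
  have "concat (map (\<lambda>k. map ((!) w) [d k..<d (Suc k)]) [0..<k]) = map ((!) w) [0..<d k]" for k
  proof (induction k)
    case (Suc k)
    have "[0..<d (Suc k)] = [0..<d k] @ [d k..<d (Suc k)]"
      using monoD[OF assms(1), of k "Suc k"] by (metis le_SucI le_add_diff_inverse order_refl upt_add_eq_append zero_le)
    then show ?case using Suc by simp
  qed (use assms in simp)
  then have "concat zs = w" using assms(3) by (simp add: zs_def map_nth)
  moreover have "length zs = n" by (simp add: zs_def)
  moreover have "map piece_type zs = map (\<lambda>k. (min 2 (d (Suc k) - d k), \<Union>i\<in>{d k..<d (Suc k)}. w ! i)) [0..<n]"
    by (simp add: zs_def piece_type_def)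
  ultimately show ?thesis unfolding fact_types_def by force
qed

text \<open>At most \<open>m\<close> marked positions give \<open>m\<close> one-letter factors and
  \<open>m + 1\<close> gaps between and around them. If there are fewer marks, the surplus factors
  are empty. The induction splits off the least marked position; the start \<open>a\<close> is a
  parameter so that the hypothesis applies to what follows it.\<close>

lemma isolating_cuts:
  assumes "finite P" "card P \<le> m" "P \<subseteq> {a..<n}" "a \<le> n"
  shows "\<exists>c. mono c \<and> c 0 = a \<and> c (2 * m + 1) = n \<and>
    (\<forall>k < 2 * m + 1. c (Suc k) = Suc (c k) \<or> P \<inter> {c k..<c (Suc k)} = {})"
  using assms
proof (induction m arbitrary: P a)
  case 0
  then show ?case by (intro exI[of _ "\<lambda>k. if k = 0 then a else n"]) (auto simp: mono_def)
next
  case (Suc m)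
  show ?case
  proof (cases "P = {}")
    case True
    then show ?thesis using Suc.prems by (intro exI[of _ "\<lambda>k. if k = 0 then a else n"]) (auto simp: mono_def)
  next
    case False
    define p where "p = Min P"
    have p: "p \<in> P" "\<And>q. q \<in> P \<Longrightarrow> p \<le> q" using False Suc.prems(1) by (auto simp: p_def)
    have pn: "a \<le> p" "Suc p \<le> n" using p(1) Suc.prems(3) by auto
    have sub: "P - {p} \<subseteq> {Suc p..<n}" using Suc.prems(3) p(2) by (force simp: Suc_le_eq less_le)
    have "card (P - {p}) \<le> m" using Suc.prems(1,2) p(1) by simp
    from Suc.IH[OF _ this sub pn(2)] Suc.prems(1) obtain c where
      c: "mono c" "c 0 = Suc p" "c (2 * m + 1) = n"
      "\<And>k. k < 2 * m + 1 \<Longrightarrow> c (Suc k) = Suc (c k) \<or> (P - {p}) \<inter> {c k..<c (Suc k)} = {}" by auto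
    \<comment> \<open>The gap before \<open>p\<close> and the factor consisting of \<open>p\<close>
      alone come first; the inductive cuts follow, shifted by two.\<close>
    define c' where "c' k = (if k = 0 then a else if k = 1 then p else c (k - 2))" for k
    have "mono c'"
      unfolding mono_iff_le_Suc
    proof
      fix k
      consider "k = 0" | "k = 1" | j where "k = Suc (Suc j)" by (metis One_nat_def not0_implies_Suc)
      then show "c' k \<le> c' (Suc k)"
        using pn c(2) monoD[OF c(1)] by cases (auto simp: c'_def)
    qed
    moreover have "c' (Suc k) = Suc (c' k) \<or> P \<inter> {c' k..<c' (Suc k)} = {}" if k: "k < 2 * Suc m + 1" for k
    proof -
      consider "k = 0" | "k = 1" | j where "k = Suc (Suc j)" by (metis One_nat_def not0_implies_Suc)
      then show ?thesis
      proof cases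
        case 1
        then show ?thesis using p(2) by (force simp: c'_def)
      next
        case 2
        then show ?thesis using c(2) by (auto simp: c'_def)
      next
        case 3
        have "Suc p \<le> c j" using c(2) monoD[OF c(1), of 0 j] by simp
        then show ?thesis using c(4)[of j] k 3 by (auto simp: c'_def)
      qed
    qed
    moreover have "c' 0 = a" "c' (2 * Suc m + 1) = n" using c(3) by (simp_all add: c'_def)
    ultimately show ?thesis by blast
  qed
qed

section \<open>Realizations as embeddings\<close>

definition consec :: "'b list \<Rightarrow> 'b \<Rightarrow> 'b \<Rightarrow> bool" where
  "consec Q x y \<longleftrightarrow> (\<exists>i. Suc i < length Q \<and> Q ! i = x \<and> Q ! Suc i = y)"

abbreviation linked :: "'b list \<Rightarrow> 'b \<Rightarrow> 'b \<Rightarrow> bool" where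
  "linked Q x y \<equiv> consec Q x y \<or> consec Q y x"

abbreviation inner :: "'b list \<Rightarrow> 'b list" where
  "inner Q \<equiv> tl (butlast Q)"

lemma consec_Nil [simp]: "\<not> consec [] x y"
  by (simp add: consec_def)

lemma consec_Cons: "consec (z # Q) x y \<longleftrightarrow> Q \<noteq> [] \<and> x = z \<and> y = hd Q \<or> consec Q x y"
proof
  assume "consec (z # Q) x y"
  then obtain i where i: "Suc i < length (z # Q)" "(z # Q) ! i = x" "(z # Q) ! Suc i = y"
    unfolding consec_def by blast
  then show "Q \<noteq> [] \<and> x = z \<and> y = hd Q \<or> consec Q x y"
    by (cases i) (auto simp: hd_conv_nth consec_def)
next
  assume *: "Q \<noteq> [] \<and> x = z \<and> y = hd Q \<or> consec Q x y"
  show "consec (z # Q) x y"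
  proof (cases "consec Q x y")
    case True
    then obtain i where "Suc i < length Q" "Q ! i = x" "Q ! Suc i = y" unfolding consec_def by blast
    then show ?thesis unfolding consec_def by (intro exI[of _ "Suc i"]) auto
  next
    case False
    then show ?thesis using * unfolding consec_def by (intro exI[of _ 0]) (auto simp: hd_conv_nth)
  qed
qed

lemma consec_append:
  "consec (xs @ ys) x y \<longleftrightarrow>
     consec xs x y \<or> consec ys x y \<or> xs \<noteq> [] \<and> ys \<noteq> [] \<and> x = last xs \<and> y = hd ys"
  by (induction xs) (auto simp: consec_Cons hd_append)

lemma consec_in_set: "consec Q x y \<Longrightarrow> x \<in> set Q \<and> y \<in> set Q"
  by (induction Q) (auto simp: consec_Cons)

lemma consec_map: "consec Q x y \<Longrightarrow> consec (map h Q) (h x) (h y)"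
  by (induction Q) (auto simp: consec_Cons hd_map)

lemma consec_rev: "consec (rev Q) x y \<longleftrightarrow> consec Q y x"
  by (induction Q) (auto simp: consec_append consec_Cons last_rev)

lemma path_edges_linked: "{x, y} \<in> path_edges Q \<longleftrightarrow> linked Q x y"
  by (auto simp: path_edges_def consec_def doubleton_eq_iff)

lemma path_edges_eq: "path_edges Q = {{x, y} | x y. consec Q x y}"
  by (auto simp: path_edges_def consec_def)

lemma list_ends_inner:
  assumes "3 \<le> length Q"
  obtains a b xs where "Q = a # xs @ [b]" "xs \<noteq> []" "inner Q = xs" "hd Q = a" "last Q = b"
proof -
  obtain a Q' where Q: "Q = a # Q'" "2 \<le> length Q'" using assms by (cases Q) auto
  then obtain xs b where "Q' = xs @ [b]" by (cases Q' rule: rev_cases) auto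
  then show ?thesis using Q by (intro that[of a xs b]) (auto simp: butlast_append)
qed

lemma set_ends_inner: "3 \<le> length Q \<Longrightarrow> set Q = {hd Q, last Q} \<union> set (inner Q)"
  by (erule list_ends_inner) auto

text \<open>With length at least 3 no step joins the two ends. Since inner vertices are never images
  of vertices, a path edge cannot be confused with an edge between two such images.\<close>

lemma consec_inner: "3 \<le> length Q \<Longrightarrow> consec Q x y \<Longrightarrow> x \<in> set (inner Q) \<or> y \<in> set (inner Q)"
  by (erule list_ends_inner) (auto simp: consec_append consec_Cons hd_append dest: consec_in_set)

lemma consec_distinct: "distinct Q \<Longrightarrow> consec Q x y \<Longrightarrow> x \<noteq> y"
  by (auto simp: consec_def nth_eq_iff_index_eq)

lemma consec_right_unique: "distinct Q \<Longrightarrow> consec Q x y \<Longrightarrow> consec Q x z \<Longrightarrow> y = z"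
  unfolding consec_def by (metis Suc_lessD nth_eq_iff_index_eq)

lemma consec_left_unique: "distinct Q \<Longrightarrow> consec Q x z \<Longrightarrow> consec Q y z \<Longrightarrow> x = y"
  unfolding consec_def by (metis nat.inject nth_eq_iff_index_eq)

text \<open>A pointwise form of \<open>is_realization\<close>: in place of a set of extra edges it
  says which adjacencies must occur and which may occur among the named vertices. It constrains
  \<open>adj\<close> only on those vertices, so it also describes an induced copy inside a larger
  graph.\<close>

locale realizes =
  fixes F :: "('a, 'z) pathograph_scheme"
    and adj :: "'b \<Rightarrow> 'b \<Rightarrow> bool"
    and f :: "'a \<Rightarrow> 'b"
    and Q :: "'a \<Rightarrow> 'b list"
  assumes inj: "inj_on f (pV F)"
    and length_path: "t \<in> pU F \<Longrightarrow> 3 \<le> length (Q t)"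
    and distinct_path: "t \<in> pU F \<Longrightarrow> distinct (Q t)"
    and ends: "t \<in> pU F \<Longrightarrow> {hd (Q t), last (Q t)} = f ` pPi F t"
    and inner_vertex: "t \<in> pU F \<Longrightarrow> x \<in> set (inner (Q t)) \<Longrightarrow> x \<notin> f ` pV F"
    and inner_inner: "t \<in> pU F \<Longrightarrow> t' \<in> pU F \<Longrightarrow> x \<in> set (inner (Q t)) \<Longrightarrow> x \<in> set (inner (Q t')) \<Longrightarrow> t = t'"
    and adj_vertices: "a \<in> pV F \<Longrightarrow> b \<in> pV F \<Longrightarrow> adj (f a) (f b) \<longleftrightarrow> {a, b} \<in> pE F"
    and adj_consec: "t \<in> pU F \<Longrightarrow> consec (Q t) x y \<Longrightarrow> adj x y"
    and adj_inner: "t \<in> pU F \<Longrightarrow> x \<in> set (inner (Q t)) \<Longrightarrow> y \<in> set (inner (Q t)) \<Longrightarrow> adj x y \<Longrightarrow> linked (Q t) x y"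
    and adj_spoke: "a \<in> pV F \<Longrightarrow> t \<in> pU F \<Longrightarrow> x \<in> set (inner (Q t)) \<Longrightarrow> adj (f a) x \<Longrightarrow>
      (a, t) \<in> pS F \<or> linked (Q t) (f a) x"
    and adj_rung: "t \<in> pU F \<Longrightarrow> t' \<in> pU F \<Longrightarrow> t \<noteq> t' \<Longrightarrow> x \<in> set (inner (Q t)) \<Longrightarrow> y \<in> set (inner (Q t')) \<Longrightarrow>
      adj x y \<Longrightarrow> {t, t'} \<in> pR F"
    and spoke: "(a, t) \<in> pS F \<Longrightarrow> \<exists>x\<in>set (inner (Q t)). adj (f a) x"
    and rung: "t \<in> pU F \<Longrightarrow> t' \<in> pU F \<Longrightarrow> {t, t'} \<in> pR F \<Longrightarrow> t \<noteq> t' \<Longrightarrow>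
      \<exists>x\<in>set (inner (Q t)). \<exists>y\<in>set (inner (Q t')). adj x y"

definition image_of :: "('a, 'z) pathograph_scheme \<Rightarrow> ('a \<Rightarrow> 'b) \<Rightarrow> ('a \<Rightarrow> 'b list) \<Rightarrow> 'b set" where
  "image_of F f Q = f ` pV F \<union> (\<Union>t\<in>pU F. set (inner (Q t)))"

text \<open>Forwards, the disjointness conditions determine from the two ends of an edge whether it
  comes from \<open>pE F\<close>, from a path or from the extra edges. Backwards, the extra edges
  are recovered as all edges of \<open>D\<close> permitted by spokes and rungs.\<close>

lemma is_realization_iff_realizes:
  fixes F :: "('a, 'z) pathograph_scheme"
  assumes "wf_pathograph F"
  shows "is_realization F (W, D) \<longleftrightarrow>
    (\<forall>e\<in>D. two_subset W e) \<and> (\<exists>f Q. realizes F (\<lambda>x y. {x, y} \<in> D) f Q \<and> image_of F f Q = W)"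
proof -
  have wfE: "\<And>e. e \<in> pE F \<Longrightarrow> e \<subseteq> pV F \<and> card e = 2" and wfS: "pS F \<subseteq> pV F \<times> pU F"
    and wfR: "\<And>r. r \<in> pR F \<Longrightarrow> r \<subseteq> pU F \<and> card r = 2"
    and wfP: "\<And>t. t \<in> pU F \<Longrightarrow> pPi F t \<subseteq> pV F"
    using assms unfolding wf_pathograph_def two_subset_def by auto
  show ?thesis
  proof
    assume "is_realization F (W, D)"
    then show "(\<forall>e\<in>D. two_subset W e) \<and> (\<exists>f Q. realizes F (\<lambda>x y. {x, y} \<in> D) f Q \<and> image_of F f Q = W)"
      unfolding is_realization_def Let_def fst_conv snd_conv
    proof (elim exE conjE, goal_cases)
      case (1 f Q X)
      note inj = 1(1) and Q = bspec[OF 1(2)] and dis1 = bspec[OF 1(3)] and dis2 = bspec[OF bspec[OF 1(4)], THEN mp]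
        and W = 1(5) and X = 1(6) and XS = 1(7) and XR = 1(8) and D = 1(9)
      have RU: "t \<in> pU F \<and> t' \<in> pU F" if "{t, t'} \<in> pR F" for t t' using wfR[OF that] by blast
      \<comment> \<open>An elimination rule for extra edges. It resolves once which end is the
        branch vertex of a spoke and in which order the urpaths of a rung occur.\<close>
      have Xc: P if xyX: "{x, y} \<in> X"
        and P1: "\<And>v t. v \<in> pV F \<Longrightarrow> t \<in> pU F \<Longrightarrow> (v, t) \<in> pS F \<Longrightarrow> x = f v \<Longrightarrow> y \<in> set (inner (Q t)) \<Longrightarrow> P"
        and P2: "\<And>v t. v \<in> pV F \<Longrightarrow> t \<in> pU F \<Longrightarrow> (v, t) \<in> pS F \<Longrightarrow> y = f v \<Longrightarrow> x \<in> set (inner (Q t)) \<Longrightarrow> P"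
        and P3: "\<And>t t'. t \<in> pU F \<Longrightarrow> t' \<in> pU F \<Longrightarrow> {t, t'} \<in> pR F \<Longrightarrow> t \<noteq> t' \<Longrightarrow>
          x \<in> set (inner (Q t)) \<Longrightarrow> y \<in> set (inner (Q t')) \<Longrightarrow> P"
      for x y P
      proof -
        consider v u z where "(v, u) \<in> pS F" "z \<in> set (inner (Q u))" "{x, y} = {f v, z}"
          | p q u u' where "{u, u'} \<in> pR F" "u \<noteq> u'" "p \<in> set (inner (Q u))" "q \<in> set (inner (Q u'))" "{x, y} = {p, q}"
          using subsetD[OF X xyX] by (elim UnE CollectE exE conjE) metis+
        then show ?thesis
        proof cases
          case 1
          have "v \<in> pV F" "u \<in> pU F" using 1(1) wfS by auto
          moreover have "x = f v \<and> y = z \<or> x = z \<and> y = f v" using 1(3) by (auto simp: doubleton_eq_iff)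
          ultimately show ?thesis using P1[of v u] P2[of v u] 1(1,2) by blast
        next
          case 2
          then have "x = p \<and> y = q \<or> x = q \<and> y = p" by (auto simp: doubleton_eq_iff)
          moreover have "{u', u} \<in> pR F" using 2(1) by (simp add: insert_commute)
          ultimately show ?thesis using RU[OF 2(1)] P3[of u u'] P3[of u' u] 2(1-4) by blast
        qed
      qed
      have imgE: "\<exists>a b. {a, b} \<in> pE F \<and> a \<in> pV F \<and> b \<in> pV F \<and> x = f a \<and> y = f b"
        if xyE: "{x, y} \<in> (\<lambda>e. f ` e) ` pE F" for x y
      proof -
        obtain e where e: "e \<in> pE F" "{x, y} = f ` e" using xyE by blast
        obtain a b where ab: "e = {a, b}" using wfE[OF e(1)] by (meson card_2_iff)
        then have "x = f a \<and> y = f b \<or> x = f b \<and> y = f a" using e(2) by (auto simp: doubleton_eq_iff)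
        moreover have "{a, b} \<in> pE F" "{b, a} \<in> pE F" using e(1) ab by (simp_all add: insert_commute)
        moreover have "a \<in> pV F" "b \<in> pV F" using wfE[OF e(1)] ab by auto
        ultimately show ?thesis by blast
      qed
      have QV: "hd (Q t) \<in> f ` pV F" "last (Q t) \<in> f ` pV F" if "t \<in> pU F" for t
        using Q[OF that] wfP[OF that] by blast+
      \<comment> \<open>A path edge has an inner vertex of its own path at one end, and its other
        end is an inner vertex of that path or an image of a vertex.\<close>
      have cQ: "(x \<in> set (inner (Q t)) \<or> y \<in> set (inner (Q t))) \<and> x \<in> f ` pV F \<union> set (inner (Q t)) \<and>
          y \<in> f ` pV F \<union> set (inner (Q t)) \<and> x \<noteq> y" if "t \<in> pU F" "linked (Q t) x y" for t x y
        using that Q[OF that(1)] QV[OF that(1)] set_ends_inner[of "Q t"] consec_inner[of "Q t"]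
          consec_in_set[of "Q t"] consec_distinct[of "Q t"] by (metis UnE UnI1 UnI2 empty_iff insert_iff)
      have Dc: "{x, y} \<in> D \<longleftrightarrow> {x, y} \<in> (\<lambda>e. f ` e) ` pE F \<or> (\<exists>t\<in>pU F. linked (Q t) x y) \<or> {x, y} \<in> X" for x y
        unfolding D by (auto simp: path_edges_linked)
      have in1: "t \<in> pU F \<Longrightarrow> x \<in> set (inner (Q t)) \<Longrightarrow> x \<in> f ` pV F \<Longrightarrow> False" for t x
        using dis1 by blast
      have in2: "t \<in> pU F \<Longrightarrow> t' \<in> pU F \<Longrightarrow> x \<in> set (inner (Q t)) \<Longrightarrow> x \<in> set (inner (Q t')) \<Longrightarrow> t = t'" for t t' x
        using dis2 by blast
      have "two_subset W e" if e: "e \<in> D" for e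
      proof -
        obtain x y where xy: "e = {x, y}"
        proof -
          consider "e \<in> (\<lambda>e. f ` e) ` pE F" | t where "t \<in> pU F" "e \<in> path_edges (Q t)" | "e \<in> X"
            using e D by blast
          then show ?thesis
          proof cases
            case 1
            then obtain e' where e': "e' \<in> pE F" "e = f ` e'" by blast
            then obtain a b where "e' = {a, b}" using wfE[OF e'(1)] by (meson card_2_iff)
            then show ?thesis using e'(2) that by auto
          next
            case 2
            then show ?thesis using that by (auto simp: path_edges_def)
          next
            case 3
            from subsetD[OF X this] show ?thesis by (elim UnE CollectE exE conjE) (rule that; assumption)+
          qed
        qed
        have "x \<in> W \<and> y \<in> W \<and> x \<noteq> y"
        proof -
          consider "{x, y} \<in> (\<lambda>e. f ` e) ` pE F" | t where "t \<in> pU F" "linked (Q t) x y" | "{x, y} \<in> X"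
            using e xy Dc by blast
          then show ?thesis
          proof cases
            case 1
            then obtain a b where ab: "{a, b} \<in> pE F" "a \<in> pV F" "b \<in> pV F" "x = f a" "y = f b"
              using imgE by blast
            moreover have "a \<noteq> b" using wfE[OF ab(1)] by auto
            ultimately show ?thesis using W inj by (auto dest: inj_onD)
          next
            case 2
            then show ?thesis using cQ[OF 2] W by blast
          next
            case 3
            then show ?thesis
              by (rule Xc) (use W in1 in2 in blast)+
          qed
        qed
        then show ?thesis using xy by (auto simp: two_subset_def)
      qed
      moreover have "realizes F (\<lambda>x y. {x, y} \<in> D) f Q"
      proof
        fix a b assume ab: "a \<in> pV F" "b \<in> pV F"
        show "({f a, f b} \<in> D) = ({a, b} \<in> pE F)"
        proof
          assume "{f a, f b} \<in> D"
          then consider "{f a, f b} \<in> (\<lambda>e. f ` e) ` pE F" | t where "t \<in> pU F" "linked (Q t) (f a) (f b)" | "{f a, f b} \<in> X"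
            unfolding Dc by blast
          then show "{a, b} \<in> pE F"
          proof cases
            case 1
            then obtain a' b' where "{a', b'} \<in> pE F" "a' \<in> pV F" "b' \<in> pV F" "f a = f a'" "f b = f b'"
              using imgE by blast
            then show ?thesis using inj_onD[OF inj, of a a'] inj_onD[OF inj, of b b'] ab by simp
          next
            case 2
            then show ?thesis using cQ[OF 2] ab in1 by blast
          next
            case 3
            then show ?thesis by (rule Xc) (use ab in1 in blast)+
          qed
        next
          assume "{a, b} \<in> pE F"
          then show "{f a, f b} \<in> D" unfolding D by (intro UnI1 image_eqI[where x = "{a, b}"]) auto
        qed
      next
        fix t x y assume t: "t \<in> pU F" "x \<in> set (inner (Q t))" "y \<in> set (inner (Q t))" "{x, y} \<in> D"
        from t(4) consider "{x, y} \<in> (\<lambda>e. f ` e) ` pE F" | t' where "t' \<in> pU F" "linked (Q t') x y" | "{x, y} \<in> X"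
          unfolding Dc by blast
        then show "linked (Q t) x y"
        proof cases
          case 1
          then show ?thesis using imgE[OF 1] t in1 by blast
        next
          case 2
          then show ?thesis using cQ[OF 2] t in1 in2 by metis
        next
          case 3
          then show ?thesis
            by (rule Xc) (use in1[OF t(1,2)] in1[OF t(1,3)] in2[OF _ t(1) _ t(2)] in2[OF _ t(1) _ t(3)] in blast)+
        qed
      next
        fix a t x assume t: "a \<in> pV F" "t \<in> pU F" "x \<in> set (inner (Q t))" "{f a, x} \<in> D"
        from t(4) consider "{f a, x} \<in> (\<lambda>e. f ` e) ` pE F" | t' where "t' \<in> pU F" "linked (Q t') (f a) x" | "{f a, x} \<in> X"
          unfolding Dc by blast
        then show "(a, t) \<in> pS F \<or> linked (Q t) (f a) x"
        proof cases
          case 1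
          then show ?thesis using imgE[OF 1] in1[OF t(2,3)] by blast
        next
          case 2
          then show ?thesis using cQ[OF 2] in1[OF 2(1)] in2[OF 2(1) t(2) _ t(3)] t(1) 2(2) in1[OF t(2,3)] by blast
        next
          case 3
          then show ?thesis
          proof (rule Xc)
            fix v t' assume v: "v \<in> pV F" "t' \<in> pU F" "(v, t') \<in> pS F" "f a = f v" "x \<in> set (inner (Q t'))"
            then have "a = v" using inj t(1) by (auto dest: inj_onD)
            moreover have "t = t'" using in2[OF t(2) v(2) t(3) v(5)] .
            ultimately show ?thesis using v(3) by blast
          qed (use t(1) in1 in1[OF t(2,3)] in blast)+
        qed
      next
        fix t t' x y
        assume t: "t \<in> pU F" "t' \<in> pU F" "t \<noteq> t'" "x \<in> set (inner (Q t))" "y \<in> set (inner (Q t'))" "{x, y} \<in> D"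
        from t(6) consider "{x, y} \<in> (\<lambda>e. f ` e) ` pE F" | t' where "t' \<in> pU F" "linked (Q t') x y" | "{x, y} \<in> X"
          unfolding Dc by blast
        then show "{t, t'} \<in> pR F"
        proof cases
          case 1
          then show ?thesis using imgE[OF 1] in1[OF t(1,4)] by blast
        next
          case 2
          then show ?thesis using cQ[OF 2] in1[OF t(1,4)] in1[OF t(2,5)] in2[OF 2(1) t(1) _ t(4)] in2[OF 2(1) t(2) _ t(5)] t(3) by blast
        next
          case 3
          then show ?thesis
          proof (rule Xc)
            fix s s' assume s: "s \<in> pU F" "s' \<in> pU F" "{s, s'} \<in> pR F" "x \<in> set (inner (Q s))" "y \<in> set (inner (Q s'))"
            have "s = t" "s' = t'" using in2[OF s(1) t(1) s(4) t(4)] in2[OF s(2) t(2) s(5) t(5)] .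
            then show ?thesis using s(3) by simp
          qed (use in1[OF t(1,4)] in1[OF t(2,5)] in blast)+
        qed
      next
        fix a t assume "(a, t) \<in> pS F"
        then have "\<exists>x\<in>set (inner (Q t)). {f a, x} \<in> X" using bspec[OF XS, of "(a, t)"] by simp
        then show "\<exists>x\<in>set (inner (Q t)). {f a, x} \<in> D" unfolding D by blast
      next
        fix t t' assume "t \<in> pU F" "t' \<in> pU F" "{t, t'} \<in> pR F" "t \<noteq> t'"
        then show "\<exists>x\<in>set (inner (Q t)). \<exists>y\<in>set (inner (Q t')). {x, y} \<in> D" using XR[rule_format, of t t'] unfolding D by blast
      next
        fix t x y assume "t \<in> pU F" "consec (Q t) x y"
        then show "{x, y} \<in> D" unfolding Dc by blast
      next
        fix t t' x assume "t \<in> pU F" "t' \<in> pU F" "x \<in> set (inner (Q t))" "x \<in> set (inner (Q t'))"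
        then show "t = t'" by (rule in2)
      next
        fix t x assume "t \<in> pU F" "x \<in> set (inner (Q t))"
        then show "x \<notin> f ` pV F" using in1 by blast
      qed (use inj Q in simp_all)
      moreover have "image_of F f Q = W" by (simp add: image_of_def W)
      ultimately show ?case by blast
    qed
  next
    assume "(\<forall>e\<in>D. two_subset W e) \<and> (\<exists>f Q. realizes F (\<lambda>x y. {x, y} \<in> D) f Q \<and> image_of F f Q = W)"
    then obtain f Q where D2: "\<And>e. e \<in> D \<Longrightarrow> two_subset W e" and rz: "realizes F (\<lambda>x y. {x, y} \<in> D) f Q"
      and W: "W = f ` pV F \<union> (\<Union>t\<in>pU F. set (inner (Q t)))" unfolding image_of_def by blast
    interpret realizes F "\<lambda>x y. {x, y} \<in> D" f Q by (rule rz)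
    \<comment> \<open>All edges that spokes and rungs could contribute; the witness for the extra
      edges is \<open>D \<inter> ?A\<close>.\<close>
    let ?A = "{{f v, x} | v u x. (v, u) \<in> pS F \<and> x \<in> set (inner (Q u))}
             \<union> {{x, y} | x y u u'. {u, u'} \<in> pR F \<and> u \<noteq> u' \<and> x \<in> set (inner (Q u)) \<and> y \<in> set (inner (Q u'))}"
    have Dsub: "e \<in> ((\<lambda>e. f ` e) ` pE F) \<union> (\<Union>u\<in>pU F. path_edges (Q u)) \<union> (D \<inter> ?A)" if e: "e \<in> D" for e
    proof -
      obtain x y where xy: "e = {x, y}" "x \<in> W" "y \<in> W"
        using D2[OF e] unfolding two_subset_def by (auto simp: card_2_iff)
      have sp: "{f a, z} \<in> (\<Union>u\<in>pU F. path_edges (Q u)) \<union> (D \<inter> ?A)"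
        if "a \<in> pV F" "t \<in> pU F" "z \<in> set (inner (Q t))" "{f a, z} \<in> D" for a t z
      proof -
        have "(a, t) \<in> pS F \<or> linked (Q t) (f a) z" using adj_spoke that by blast
        then show ?thesis
        proof
          assume "(a, t) \<in> pS F"
          then show ?thesis using that by blast
        next
          assume "linked (Q t) (f a) z"
          then have "{f a, z} \<in> path_edges (Q t)" by (simp add: path_edges_linked)
          then show ?thesis using that(2) by blast
        qed
      qed
      \<comment> \<open>Both ends lie in the image, so each is the image of a vertex or an inner
        vertex of some path; these cases exhaust all edges.\<close>
      consider a b where "a \<in> pV F" "b \<in> pV F" "x = f a" "y = f b"
        | a t where "a \<in> pV F" "t \<in> pU F" "x = f a" "y \<in> set (inner (Q t))"
        | a t where "a \<in> pV F" "t \<in> pU F" "y = f a" "x \<in> set (inner (Q t))"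
        | t t' where "t \<in> pU F" "t' \<in> pU F" "x \<in> set (inner (Q t))" "y \<in> set (inner (Q t'))"
        using xy(2,3) unfolding W by blast
      then show ?thesis
      proof cases
        case 1
        then have "{a, b} \<in> pE F" using adj_vertices e xy(1) by blast
        then have "f ` {a, b} \<in> (\<lambda>e. f ` e) ` pE F" by (rule imageI)
        moreover have "f ` {a, b} = e" using xy(1) 1 by simp
        ultimately show ?thesis by simp
      next
        case 2
        then show ?thesis using sp[OF 2(1,2,4)] e xy(1) by blast
      next
        case 3
        have "{f a, x} = e" using xy(1) 3 by auto
        then show ?thesis using sp[OF 3(1,2,4)] e by blast
      next
        case 4
        show ?thesis
        proof (cases "t = t'")
          case True
          then have "linked (Q t) x y" using adj_inner 4 e xy(1) by blast
          then have "e \<in> path_edges (Q t)" by (simp add: xy(1) path_edges_linked)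
          then show ?thesis using 4(1) by blast
        next
          case False
          then have "{t, t'} \<in> pR F" using adj_rung 4 e xy(1) by blast
          then have "e \<in> ?A" using False 4 xy(1) by blast
          then show ?thesis using e by blast
        qed
      qed
    qed
    have Dsup: "((\<lambda>e. f ` e) ` pE F) \<union> (\<Union>u\<in>pU F. path_edges (Q u)) \<subseteq> D"
    proof -
      have "f ` e \<in> D" if e: "e \<in> pE F" for e
      proof -
        obtain a b where "e = {a, b}" using wfE[OF e] by (meson card_2_iff)
        then show ?thesis using wfE[OF e] e adj_vertices by auto
      qed
      moreover have "path_edges (Q u) \<subseteq> D" if "u \<in> pU F" for u
        using that adj_consec unfolding path_edges_eq by blast
      ultimately show ?thesis by blast
    qed
    have S: "\<exists>x\<in>set (inner (Q u)). {f v, x} \<in> D \<inter> ?A" if vu: "(v, u) \<in> pS F" for v u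
    proof -
      obtain x where "x \<in> set (inner (Q u))" "{f v, x} \<in> D" using spoke[OF vu] by blast
      then show ?thesis using vu by (intro bexI[of _ x]) auto
    qed
    have R: "\<exists>x\<in>set (inner (Q u)). \<exists>y\<in>set (inner (Q u')). {x, y} \<in> D \<inter> ?A"
      if u: "u \<in> pU F" "u' \<in> pU F" "{u, u'} \<in> pR F" "u \<noteq> u'" for u u'
    proof -
      obtain x y where xy: "x \<in> set (inner (Q u))" "y \<in> set (inner (Q u'))" "{x, y} \<in> D"
        using rung[OF u] by blast
      have "{x, y} \<in> ?A" using xy(1,2) u(3,4) by blast
      then show ?thesis using xy by blast
    qed
    have D: "D = ((\<lambda>e. f ` e) ` pE F) \<union> (\<Union>u\<in>pU F. path_edges (Q u)) \<union> (D \<inter> ?A)" (is "D = ?B")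
    proof
      show "D \<subseteq> ?B" using Dsub by (rule subsetI)
      show "?B \<subseteq> D" using Dsup by (intro Un_least) simp_all
    qed
    show "is_realization F (W, D)"
      unfolding is_realization_def Let_def fst_conv snd_conv
    proof (intro exI conjI)
      show "inj_on f (pV F)" by (rule inj)
      show "\<forall>u\<in>pU F. 3 \<le> length (Q u) \<and> distinct (Q u) \<and> {hd (Q u), last (Q u)} = f ` pPi F u"
        using length_path distinct_path ends by blast
      show "\<forall>u\<in>pU F. set (inner (Q u)) \<inter> f ` pV F = {}" using inner_vertex by blast
      show "\<forall>u\<in>pU F. \<forall>u'\<in>pU F. u \<noteq> u' \<longrightarrow> set (inner (Q u)) \<inter> set (inner (Q u')) = {}"
        using inner_inner by blast
      show "W = f ` pV F \<union> (\<Union>u\<in>pU F. set (inner (Q u)))" by (rule W)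
      show "D \<inter> ?A \<subseteq> ?A" by (rule Int_lower2)
      show "\<forall>(v, u)\<in>pS F. \<exists>x\<in>set (inner (Q u)). {f v, x} \<in> D \<inter> ?A"
        by (clarify, rule S)
      show "\<forall>u\<in>pU F. \<forall>u'\<in>pU F. {u, u'} \<in> pR F \<and> u \<noteq> u' \<longrightarrow>
          (\<exists>x\<in>set (inner (Q u)). \<exists>y\<in>set (inner (Q u')). {x, y} \<in> D \<inter> ?A)"
        by (intro ballI impI, elim conjE, rule R)
    qed (rule D)
  qed
qed

text \<open>Serves two purposes: transport along an isomorphism and, with \<open>id\<close> for
  \<open>h\<close>, a change of the adjacency relation outside the image.\<close>

lemma realizes_cong:
  assumes "wf_pathograph F" "realizes F adj f Q"
    and h: "inj_on h (image_of F f Q)"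
    and adj: "\<And>x y. x \<in> image_of F f Q \<Longrightarrow> y \<in> image_of F f Q \<Longrightarrow> adj' (h x) (h y) \<longleftrightarrow> adj x y"
  shows "realizes F adj' (h \<circ> f) (map h \<circ> Q)" "image_of F (h \<circ> f) (map h \<circ> Q) = h ` image_of F f Q"
proof -
  have inner: "set (inner (map h xs)) = h ` set (inner xs)" for xs
    by (simp add: map_butlast[symmetric] map_tl[symmetric])
  show im: "image_of F (h \<circ> f) (map h \<circ> Q) = h ` image_of F f Q"
    unfolding image_of_def by (auto simp: inner)
  have wfS: "pS F \<subseteq> pV F \<times> pU F" and wfP: "\<And>t. t \<in> pU F \<Longrightarrow> pPi F t \<subseteq> pV F"
    using assms unfolding wf_pathograph_def two_subset_def by auto
  interpret realizes F adj f Q by (rule assms(2))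
  have fI: "f a \<in> image_of F f Q" if "a \<in> pV F" for a using that by (auto simp: image_of_def)
  have iI: "x \<in> image_of F f Q" if "t \<in> pU F" "x \<in> set (inner (Q t))" for t x using that by (auto simp: image_of_def)
  have QI: "x \<in> image_of F f Q" if t: "t \<in> pU F" "x \<in> set (Q t)" for t x
  proof -
    have "x \<in> f ` pPi F t \<union> set (inner (Q t))"
      using t(2) set_ends_inner[OF length_path[OF t(1)]] ends[OF t(1)] by simp
    then show ?thesis using wfP[OF t(1)] t(1) by (auto simp: image_of_def)
  qed
  have cm: "\<exists>x0 y0. x = h x0 \<and> y = h y0 \<and> consec (Q t) x0 y0" if "consec (map h (Q t)) x y" for t x y
    using that unfolding consec_def by (metis Suc_lessD length_map nth_map)
  have lm: "linked (map h (Q t)) (h x) (h y)" if "linked (Q t) x y" for t x y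
    using that consec_map by fast
  show "realizes F adj' (h \<circ> f) (map h \<circ> Q)"
    unfolding comp_def
  proof
    show "inj_on (\<lambda>a. h (f a)) (pV F)"
      using inj h fI by (auto simp: inj_on_def)
  next
    fix t assume t: "t \<in> pU F"
    show "3 \<le> length (map h (Q t))" using length_path[OF t] by simp
    show "distinct (map h (Q t))"
      using distinct_path[OF t] h QI[OF t] by (auto simp: distinct_map intro: inj_on_subset)
    have "Q t \<noteq> []" using length_path[OF t] by auto
    then have "{hd (map h (Q t)), last (map h (Q t))} = h ` {hd (Q t), last (Q t)}"
      by (simp add: hd_map last_map)
    then show "{hd (map h (Q t)), last (map h (Q t))} = (\<lambda>a. h (f a)) ` pPi F t"
      using ends[OF t] by (simp add: image_image)
  next
    fix t x assume t: "t \<in> pU F" "x \<in> set (inner (map h (Q t)))"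
    then obtain x0 where x0: "x = h x0" "x0 \<in> set (inner (Q t))" by (auto simp: inner)
    show "x \<notin> (\<lambda>a. h (f a)) ` pV F"
      using inner_vertex[OF t(1) x0(2)] inj_onD[OF h _ iI[OF t(1) x0(2)] fI] x0(1) by auto
  next
    fix t t' x assume t: "t \<in> pU F" "t' \<in> pU F" "x \<in> set (inner (map h (Q t)))" "x \<in> set (inner (map h (Q t')))"
    obtain x0 where x0: "x = h x0" "x0 \<in> set (inner (Q t))" using t(3) by (auto simp: inner)
    obtain x1 where x1: "x = h x1" "x1 \<in> set (inner (Q t'))" using t(4) by (auto simp: inner)
    have "x0 = x1" using x0(1) x1(1) inj_onD[OF h _ iI[OF t(1) x0(2)] iI[OF t(2) x1(2)]] by simp
    then show "t = t'" using inner_inner[OF t(1,2) x0(2)] x1(2) by simp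
  next
    fix a b assume "a \<in> pV F" "b \<in> pV F"
    then show "adj' (h (f a)) (h (f b)) = ({a, b} \<in> pE F)" using adj_vertices adj fI by simp
  next
    fix t x y assume t: "t \<in> pU F" "consec (map h (Q t)) x y"
    then obtain x0 y0 where *: "x = h x0" "y = h y0" "consec (Q t) x0 y0" using cm by blast
    then show "adj' x y"
      using adj_consec[OF t(1) *(3)] adj QI[OF t(1)] consec_in_set[OF *(3)] by simp
  next
    fix t x y assume t: "t \<in> pU F" "x \<in> set (inner (map h (Q t)))" "y \<in> set (inner (map h (Q t)))" "adj' x y"
    then obtain x0 y0 where *: "x = h x0" "y = h y0" "x0 \<in> set (inner (Q t))" "y0 \<in> set (inner (Q t))"
      by (auto simp: inner)
    then have "adj x0 y0" using t adj iI by auto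
    then show "linked (map h (Q t)) x y" using adj_inner[OF t(1) *(3,4)] lm *(1,2) by simp
  next
    fix a t x assume t: "a \<in> pV F" "t \<in> pU F" "x \<in> set (inner (map h (Q t)))" "adj' (h (f a)) x"
    then obtain x0 where *: "x = h x0" "x0 \<in> set (inner (Q t))" by (auto simp: inner)
    then have "adj (f a) x0" using t adj iI fI by auto
    then show "(a, t) \<in> pS F \<or> linked (map h (Q t)) (h (f a)) x"
      using adj_spoke[OF t(1,2) *(2)] lm *(1) by blast
  next
    fix t t' x y
    assume t: "t \<in> pU F" "t' \<in> pU F" "t \<noteq> t'" "x \<in> set (inner (map h (Q t)))"
      "y \<in> set (inner (map h (Q t')))" "adj' x y"
    then obtain x0 y0 where *: "x = h x0" "y = h y0" "x0 \<in> set (inner (Q t))" "y0 \<in> set (inner (Q t'))"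
      by (auto simp: inner)
    then have "adj x0 y0" using t adj iI by auto
    then show "{t, t'} \<in> pR F" using adj_rung[OF t(1-3) *(3,4)] by simp
  next
    fix a t assume at: "(a, t) \<in> pS F"
    then have "a \<in> pV F" "t \<in> pU F" using wfS by auto
    moreover obtain x where "x \<in> set (inner (Q t))" "adj (f a) x" using spoke[OF at] by blast
    ultimately show "\<exists>x\<in>set (inner (map h (Q t))). adj' (h (f a)) x"
      using adj fI iI by (auto simp: inner)
  next
    fix t t' assume t: "t \<in> pU F" "t' \<in> pU F" "{t, t'} \<in> pR F" "t \<noteq> t'"
    then obtain x y where "x \<in> set (inner (Q t))" "y \<in> set (inner (Q t'))" "adj x y" using rung by blast
    then show "\<exists>x\<in>set (inner (map h (Q t))). \<exists>y\<in>set (inner (map h (Q t'))). adj' x y"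
      using t adj iI by (auto simp: inner)
  qed
qed

text \<open>The vertex set of the induced subgraph is the image of the embedding, and on that set
  the induced edges agree with all edges. This removes the choice of a vertex subset.\<close>

lemma contains_iff_realizes:
  assumes "wf_pathograph F" "\<forall>e\<in>D. two_subset W e"
  shows "contains (W, D) F \<longleftrightarrow> (\<exists>f Q. realizes F (\<lambda>x y. {x, y} \<in> D) f Q \<and> image_of F f Q \<subseteq> W)"
proof
  assume "contains (W, D) F"
  then obtain A where A: "A \<subseteq> W" "is_realization F (A, {e \<in> D. e \<subseteq> A})"
    unfolding contains_def induced_subgraph_def by auto
  obtain f Q where rz: "realizes F (\<lambda>x y. {x, y} \<in> {e \<in> D. e \<subseteq> A}) f Q" "image_of F f Q = A"
    using iffD1[OF is_realization_iff_realizes[OF assms(1)] A(2)] by (elim conjE exE)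
  have "realizes F (\<lambda>x y. {x, y} \<in> D) (id \<circ> f) (map id \<circ> Q)"
    by (rule realizes_cong(1)[OF assms(1) rz(1)]) (use rz(2) in auto)
  then have "realizes F (\<lambda>x y. {x, y} \<in> D) f Q" by (simp add: comp_def)
  moreover have "image_of F f Q \<subseteq> W" unfolding rz(2) by (rule A(1))
  ultimately show "\<exists>f Q. realizes F (\<lambda>x y. {x, y} \<in> D) f Q \<and> image_of F f Q \<subseteq> W"
    by (intro exI conjI)
next
  assume "\<exists>f Q. realizes F (\<lambda>x y. {x, y} \<in> D) f Q \<and> image_of F f Q \<subseteq> W"
  then obtain f Q where rz: "realizes F (\<lambda>x y. {x, y} \<in> D) f Q" "image_of F f Q \<subseteq> W" by (elim conjE exE)
  let ?A = "image_of F f Q"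
  have "realizes F (\<lambda>x y. {x, y} \<in> {e \<in> D. e \<subseteq> ?A}) (id \<circ> f) (map id \<circ> Q)"
    by (rule realizes_cong(1)[OF assms(1) rz(1)]) auto
  then have "realizes F (\<lambda>x y. {x, y} \<in> {e \<in> D. e \<subseteq> ?A}) f Q" by (simp add: comp_def)
  moreover have "\<forall>e\<in>{e \<in> D. e \<subseteq> ?A}. two_subset ?A e" using assms(2) by (auto simp: two_subset_def)
  ultimately have "is_realization F (?A, {e \<in> D. e \<subseteq> ?A})"
    by (intro iffD2[OF is_realization_iff_realizes[OF assms(1)]] conjI exI) (assumption | rule refl)+
  then show "contains (W, D) F"
    unfolding contains_def induced_subgraph_def using rz(2) by auto
qed

section \<open>Graphs of words and matching cuts\<close>

lemma consec_asym: "distinct Q \<Longrightarrow> consec Q x y \<Longrightarrow> \<not> consec Q y x"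
proof
  assume *: "distinct Q" "consec Q x y" "consec Q y x"
  obtain i where i: "Suc i < length Q" "Q ! i = x" "Q ! Suc i = y" using *(2) by (auto simp: consec_def)
  obtain j where j: "Suc j < length Q" "Q ! j = y" "Q ! Suc j = x" using *(3) by (auto simp: consec_def)
  have "i = Suc j" using nth_eq_iff_index_eq[OF *(1), of i "Suc j"] i j by simp
  moreover have "j = Suc i" using nth_eq_iff_index_eq[OF *(1), of j "Suc i"] i j by simp
  ultimately show False by simp
qed

lemma consec_map_iff:
  "consec (map g ks) b b' \<longleftrightarrow> (\<exists>k k'. consec ks k k' \<and> b = g k \<and> b' = g k')"
proof (induction ks)
  case (Cons k ks)
  then show ?case by (cases ks) (auto simp: consec_Cons)
qed simp

lemma consec_upt:
  "consec (map g [a..<b]) x y \<longleftrightarrow> (\<exists>j\<ge>a. Suc j < b \<and> x = g j \<and> y = g (Suc j))"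
proof
  assume "consec (map g [a..<b]) x y"
  then obtain i where "Suc i < b - a" "x = g (a + i)" "y = g (Suc (a + i))"
    unfolding consec_def by auto
  then show "\<exists>j\<ge>a. Suc j < b \<and> x = g j \<and> y = g (Suc j)" by (intro exI[of _ "a + i"]) auto
next
  assume "\<exists>j\<ge>a. Suc j < b \<and> x = g j \<and> y = g (Suc j)"
  then obtain j where "a \<le> j" "Suc j < b" "x = g j" "y = g (Suc j)" by blast
  then show "consec (map g [a..<b]) x y" unfolding consec_def by (intro exI[of _ "j - a"]) auto
qed

text \<open>Nonempty blocks guarantee that every step leaving a block enters the very next one.
  Paths are later decomposed into one block per slot.\<close>

lemma consec_concat:
  assumes "\<forall>b\<in>set bs. b \<noteq> []"
  shows "consec (concat bs) x y \<longleftrightarrow>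
    (\<exists>b\<in>set bs. consec b x y) \<or> (\<exists>b b'. consec bs b b' \<and> x = last b \<and> y = hd b')"
  using assms
proof (induction bs)
  case (Cons b bs)
  have "concat bs \<noteq> [] \<longleftrightarrow> bs \<noteq> []" using Cons.prems by (cases bs) auto
  moreover have "bs \<noteq> [] \<Longrightarrow> hd (concat bs) = hd (hd bs)" using Cons.prems by (cases bs) auto
  ultimately have "consec (concat (b # bs)) x y \<longleftrightarrow>
      consec b x y \<or> consec (concat bs) x y \<or> bs \<noteq> [] \<and> x = last b \<and> y = hd (hd bs)"
    using Cons.prems by (auto simp: consec_append)
  moreover have "(\<exists>b1 b'. consec (b # bs) b1 b' \<and> x = last b1 \<and> y = hd b') \<longleftrightarrow>
      bs \<noteq> [] \<and> x = last b \<and> y = hd (hd bs) \<or> (\<exists>b1 b'. consec bs b1 b' \<and> x = last b1 \<and> y = hd b')"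
    unfolding consec_Cons by blast
  ultimately show ?case using Cons.IH Cons.prems by auto
qed simp

lemma consec_concat_map:
  assumes "\<And>k. k \<in> set ks \<Longrightarrow> g k \<noteq> []"
  shows "consec (concat (map g ks)) x y \<longleftrightarrow>
    (\<exists>k\<in>set ks. consec (g k) x y) \<or> (\<exists>k k'. consec ks k k' \<and> x = last (g k) \<and> y = hd (g k'))"
proof -
  have "\<forall>b\<in>set (map g ks). b \<noteq> []" using assms by auto
  note * = consec_concat[OF this, of x y]
  have "(\<exists>b b'. consec (map g ks) b b' \<and> x = last b \<and> y = hd b') \<longleftrightarrow>
      (\<exists>k k'. consec ks k k' \<and> x = last (g k) \<and> y = hd (g k'))"
    unfolding consec_map_iff by blast
  then show ?thesis unfolding * by simp
qed

lemma distinct_concat_map: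
  assumes "distinct ks" "\<And>k. k \<in> set ks \<Longrightarrow> distinct (g k)"
    "\<And>k k'. k \<in> set ks \<Longrightarrow> k' \<in> set ks \<Longrightarrow> k \<noteq> k' \<Longrightarrow> set (g k) \<inter> set (g k') = {}"
  shows "distinct (concat (map g ks))"
  using assms
proof (induction ks)
  case (Cons k ks)
  have "set (g k) \<inter> set (g k') = {}" if "k' \<in> set ks" for k'
    using Cons.prems(3)[of k k'] Cons.prems(1) that by auto
  then show ?case using Cons by auto
qed simp

lemma distinct_concat_mapD:
  assumes "distinct (concat (map g ks))" "\<forall>k\<in>set ks. g k \<noteq> []"
  shows "distinct ks"
  using assms
proof (induction ks)
  case (Cons k ks)
  obtain x where x: "x \<in> set (g k)" using Cons.prems(2) by (cases "g k") auto
  have "k \<notin> set ks"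
  proof
    assume "k \<in> set ks"
    then have "x \<in> set (concat (map g ks))" using x by auto
    then show False using Cons.prems(1) x by auto
  qed
  then show ?case using Cons by simp
qed simp

text \<open>In a list without repetitions every element has at most one successor, so a chain of
  steps that starts at \<open>hd ys\<close> is forced to run along \<open>ys\<close>.\<close>

lemma consec_chain_prefix:
  assumes "distinct (xs @ ys)" "ys \<noteq> []" "zs \<noteq> []" "hd ys = hd zs"
    "\<And>a b. consec zs a b \<Longrightarrow> consec (xs @ ys) a b"
  shows "\<exists>ys'. ys = zs @ ys'"
  using assms
proof (induction zs arbitrary: xs ys)
  case (Cons z zs)
  obtain ys1 where ys: "ys = z # ys1" using Cons.prems(2,4) by (cases ys) auto
  show ?case
  proof (cases "zs = []")
    case True
    then show ?thesis using ys by simp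
  next
    case False
    have c: "consec (xs @ z # ys1) z (hd zs)" using Cons.prems(5)[of z "hd zs"] False ys by (simp add: consec_Cons)
    \<comment> \<open>Otherwise \<open>z\<close> would be the last vertex of the whole list and
      could not have a successor.\<close>
    have ys1: "ys1 \<noteq> []"
    proof
      assume "ys1 = []"
      then have "consec (xs @ [z]) z (hd zs)" using c by simp
      then show False using Cons.prems(1) ys \<open>ys1 = []\<close>
        by (auto simp: consec_append consec_Cons dest: consec_in_set)
    qed
    then have "consec (xs @ z # ys1) z (hd ys1)" by (simp add: consec_append consec_Cons)
    then have "hd ys1 = hd zs" using consec_right_unique[OF Cons.prems(1)] c ys by auto
    moreover have "consec ((xs @ [z]) @ ys1) a b" if "consec zs a b" for a b
      using Cons.prems(5)[of a b] that ys by (simp add: consec_Cons)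
    ultimately obtain ys' where "ys1 = zs @ ys'"
      using Cons.IH[of "xs @ [z]" ys1] Cons.prems(1) ys ys1 False by auto
    then show ?thesis using ys by simp
  qed
qed simp

lemma ex_consec_left: "y \<in> set Q \<Longrightarrow> y \<noteq> hd Q \<Longrightarrow> \<exists>x. consec Q x y"
proof -
  assume *: "y \<in> set Q" "y \<noteq> hd Q"
  obtain as bs where Q: "Q = as @ y # bs" using *(1) by (meson split_list)
  then have "as \<noteq> []" using *(2) by auto
  then have "consec Q (last as) y" using Q by (simp add: consec_append)
  then show ?thesis ..
qed

lemma ex_consec_right: "y \<in> set Q \<Longrightarrow> y \<noteq> last Q \<Longrightarrow> \<exists>x. consec Q y x"
  using ex_consec_left[of y "rev Q"] by (auto simp: consec_rev hd_rev)

section \<open>Graphs of words and the slots of a system of cuts\<close>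

type_synonym 'a wvertex = "'a + 'a \<times> nat"

text \<open>\<open>Inl v\<close> is a branch vertex and \<open>Inr (u, i)\<close> the internal
  vertex at position \<open>i\<close> of the word of \<open>u\<close>. There are no edges between
  two different words, which reflects the absence of rungs.\<close>

fun word_adj :: "'a set set \<Rightarrow> ('a \<Rightarrow> 'a set list) \<Rightarrow> 'a wvertex \<Rightarrow> 'a wvertex \<Rightarrow> bool" where
  "word_adj E w (Inl v) (Inl v') \<longleftrightarrow> {v, v'} \<in> E"
| "word_adj E w (Inl v) (Inr (u, i)) \<longleftrightarrow> v \<in> w u ! i"
| "word_adj E w (Inr (u, i)) (Inl v) \<longleftrightarrow> v \<in> w u ! i"
| "word_adj E w (Inr (u, i)) (Inr (u', j)) \<longleftrightarrow> u = u' \<and> (j = Suc i \<or> i = Suc j)"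

definition word_verts :: "'a set \<Rightarrow> 'a set \<Rightarrow> ('a \<Rightarrow> 'a set list) \<Rightarrow> 'a wvertex set" where
  "word_verts V U w = Inl ` V \<union> {Inr (u, i) | u i. u \<in> U \<and> i < length (w u)}"

lemma word_adj_sym: "word_adj E w x y \<longleftrightarrow> word_adj E w y x"
  by (cases x; cases y) (auto simp: insert_commute)

text \<open>The number of the factor that contains position \<open>i\<close>. The minimum passes
  over empty factors, as these contain no position.\<close>

definition slot :: "('a \<Rightarrow> nat \<Rightarrow> nat) \<Rightarrow> 'a \<Rightarrow> nat \<Rightarrow> nat" where
  "slot c u i = (LEAST k. i < c u (Suc k))"

text \<open>Slots reuse the type of vertices: \<open>Inr (u, k)\<close> then stands for factor
  \<open>k\<close> of the word of \<open>u\<close>, and each branch vertex is a slot of its own.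
  Slot names are therefore shared by both words, which is how vertices of the two graphs are
  compared.\<close>

fun slot_of :: "('a \<Rightarrow> nat \<Rightarrow> nat) \<Rightarrow> 'a wvertex \<Rightarrow> 'a wvertex" where
  "slot_of c (Inl v) = Inl v"
| "slot_of c (Inr (u, i)) = Inr (u, slot c u i)"

fun slot_list :: "('a \<Rightarrow> nat \<Rightarrow> nat) \<Rightarrow> 'a wvertex \<Rightarrow> 'a wvertex list" where
  "slot_list c (Inl v) = [Inl v]"
| "slot_list c (Inr (u, k)) = map (\<lambda>i. Inr (u, i)) [c u k..<c u (Suc k)]"

lemma slot_eq:
  assumes "mono (c u)" "c u k \<le> i" "i < c u (Suc k)"
  shows "slot c u i = k"
  unfolding slot_def
proof (rule Least_equality)
  fix j assume "i < c u (Suc j)"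
  then have "\<not> Suc j \<le> k" using monoD[OF assms(1), of "Suc j" k] assms(2) by auto
  then show "k \<le> j" by simp
qed (rule assms(3))

lemma slot_bounds:
  assumes "mono (c u)" "c u 0 = 0" "i < c u n"
  shows "slot c u i < n" "c u (slot c u i) \<le> i" "i < c u (Suc (slot c u i))"
proof -
  obtain m where n: "n = Suc m" using assms by (cases n) auto
  then have m: "i < c u (Suc m)" using assms(3) by simp
  show "i < c u (Suc (slot c u i))" unfolding slot_def using m by (rule LeastI)
  have "slot c u i \<le> m" unfolding slot_def using m by (rule Least_le)
  then show "slot c u i < n" using n by simp
  show "c u (slot c u i) \<le> i"
  proof (cases "slot c u i")
    case 0
    then show ?thesis using assms(2) by simp
  next
    case (Suc k)
    then have "\<not> i < c u (Suc k)" using not_less_Least[of k "\<lambda>k. i < c u (Suc k)"] by (simp add: slot_def)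
    then show ?thesis using Suc by simp
  qed
qed

text \<open>Equality of \<open>piece_type\<close> factor by factor, expressed through cut positions.
  The conditions are symmetric (\<open>swapped\<close>), so every transfer statement can also be
  used backwards.\<close>

locale matched_cuts =
  fixes U :: "'a set" and s w :: "'a \<Rightarrow> 'a set list" and n :: nat
    and c d :: "'a \<Rightarrow> nat \<Rightarrow> nat"
  assumes c: "u \<in> U \<Longrightarrow> mono (c u)" "u \<in> U \<Longrightarrow> c u 0 = 0" "u \<in> U \<Longrightarrow> c u n = length (s u)"
    and d: "u \<in> U \<Longrightarrow> mono (d u)" "u \<in> U \<Longrightarrow> d u 0 = 0" "u \<in> U \<Longrightarrow> d u n = length (w u)"
    and same_length: "u \<in> U \<Longrightarrow> k < n \<Longrightarrow> min 2 (c u (Suc k) - c u k) = min 2 (d u (Suc k) - d u k)"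
    and same_letters: "u \<in> U \<Longrightarrow> k < n \<Longrightarrow>
      (\<Union>i\<in>{c u k..<c u (Suc k)}. s u ! i) = (\<Union>i\<in>{d u k..<d u (Suc k)}. w u ! i)"
begin

lemma slot_of_Inr:
  assumes "Inr (u, i) \<in> word_verts V U s"
  obtains k where "u \<in> U" "i < length (s u)" "k < n" "slot c u i = k" "c u k \<le> i" "i < c u (Suc k)"
    "slot_of c (Inr (u, i)) = Inr (u, k)"
proof -
  have u: "u \<in> U" "i < length (s u)" using assms by (auto simp: word_verts_def)
  show ?thesis using that[of "slot c u i"] slot_bounds[of c u i n] c[OF u(1)] u by simp
qed

lemma set_slot_list:
  assumes "x \<in> word_verts V U s"
  shows "set (slot_list c (slot_of c x)) = {y \<in> word_verts V U s. slot_of c y = slot_of c x}"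
proof (cases x)
  case (Inl v)
  then show ?thesis using assms by (auto elim!: slot_of.elims)
next
  case (Inr p)
  obtain u i where x: "x = Inr (u, i)" using Inr by (cases p) auto
  obtain k where k: "u \<in> U" "k < n" "c u k \<le> i" "i < c u (Suc k)" "slot_of c (Inr (u, i)) = Inr (u, k)"
    using slot_of_Inr assms x by metis
  have "j < length (s u)" if "j < c u (Suc k)" for j
    using that monoD[OF c(1)[OF k(1)], of "Suc k" n] c(3)[OF k(1)] k(2) by simp
  moreover have "c u k \<le> j \<and> j < c u (Suc k)" if "slot c u j = k" "j < length (s u)" for j
    using slot_bounds[of c u j n] that c[OF k(1)] by auto
  ultimately show ?thesis using k(1) slot_eq[of c u k, OF c(1)[OF k(1)]]
    unfolding x k(5) by (auto simp: word_verts_def)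
qed

lemma slot_list_nonempty: "x \<in> word_verts V U s \<Longrightarrow> slot_list c (slot_of c x) \<noteq> []"
  using set_slot_list[of x] by fastforce

text \<open>A factor that is empty on one side is empty on the other, so a run of empty factors
  takes up no room in either word.\<close>

lemma same_gap:
  assumes u: "u \<in> U" and "j \<le> k" "k \<le> n" "c u j = c u k"
  shows "d u j = d u k"
  using assms(2-)
proof (induction k)
  case (Suc k)
  show ?case
  proof (cases "j = Suc k")
    case False
    then have jk: "j \<le> k" using Suc.prems(1) by simp
    have "c u j \<le> c u k" "c u k \<le> c u (Suc k)" using monoD[OF c(1)[OF u]] jk by simp_all
    then have *: "c u k = c u j" "c u (Suc k) = c u k" using Suc.prems(3) by simp_all
    then have "min 2 (d u (Suc k) - d u k) = 0" using same_length[OF u, of k] Suc.prems(2) by simp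
    then have "d u (Suc k) = d u k" using monoD[OF d(1)[OF u], of k "Suc k"] by simp
    then show ?thesis using Suc.IH jk Suc.prems(2) * by simp
  qed simp
qed simp

text \<open>Nothing but empty factors can lie between the slots of two neighbouring positions. By
  \<open>same_gap\<close> the two factors touch in the other word as well.\<close>

lemma adjacent_slots:
  assumes "u \<in> U" "k < n" "k' < n" "k \<noteq> k'"
    "c u k \<le> i" "i < c u (Suc k)" "c u k' \<le> Suc i" "Suc i < c u (Suc k')"
  shows "k < k'" "Suc i = c u (Suc k)" "Suc i = c u k'" "d u (Suc k) = d u k'"
    "d u k < d u (Suc k)" "d u k' < d u (Suc k')"
proof -
  note m = monoD[OF c(1)[OF assms(1)]]
  show k: "k < k'" using m[of "Suc k'" k] assms(4-) by (cases k k' rule: linorder_cases) auto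
  then have "c u (Suc k) \<le> c u k'" by (intro m) simp
  then show *: "Suc i = c u (Suc k)" "Suc i = c u k'" using assms(5-) by auto
  then show "d u (Suc k) = d u k'" using same_gap[OF assms(1), of "Suc k" k'] k assms(3) by simp
  show "d u k < d u (Suc k)" using same_length[OF assms(1,2)] assms(5,6) by (auto simp: min_def split: if_splits)
  show "d u k' < d u (Suc k')" using same_length[OF assms(1,3)] assms(7,8) by (auto simp: min_def split: if_splits)
qed

lemma in_word_verts: "u \<in> U \<Longrightarrow> k < n \<Longrightarrow> i < d u (Suc k) \<Longrightarrow> Inr (u, i) \<in> word_verts V U w"
  using monoD[OF d(1), of u "Suc k" n] d(3)[of u] by (auto simp: word_verts_def)

lemma slot_of_d: "u \<in> U \<Longrightarrow> d u k \<le> i \<Longrightarrow> i < d u (Suc k) \<Longrightarrow> slot_of d (Inr (u, i)) = Inr (u, k)"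
  using slot_eq[of d u k i] d(1) by simp

lemma vertex_transfer:
  assumes "x \<in> word_verts V U s"
  shows "\<exists>x'\<in>word_verts V U w. slot_of d x' = slot_of c x"
proof (cases x)
  case (Inl v)
  then show ?thesis using assms by (intro bexI[of _ x]) (auto simp: word_verts_def)
next
  case (Inr p)
  obtain u i where x: "x = Inr (u, i)" using Inr by (cases p) auto
  obtain k where k: "u \<in> U" "k < n" "c u k \<le> i" "i < c u (Suc k)" "slot_of c (Inr (u, i)) = Inr (u, k)"
    using slot_of_Inr assms x by metis
  have "d u k < d u (Suc k)" using same_length[OF k(1,2)] k(3,4) by (auto simp: min_def split: if_splits)
  then show ?thesis using slot_of_d[OF k(1), of k "d u k"] in_word_verts[OF k(1,2)] k(5) x
    by (intro bexI[of _ "Inr (u, d u k)"]) auto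
qed

lemma adj_transfer_step:
  assumes "Inr (u, i) \<in> word_verts V U s" "Inr (u, Suc i) \<in> word_verts V U s"
    "slot_of c (Inr (u, i)) \<noteq> slot_of c (Inr (u, Suc i))"
  shows "\<exists>j. Inr (u, j) \<in> word_verts V U w \<and> Inr (u, Suc j) \<in> word_verts V U w \<and>
    slot_of d (Inr (u, j)) = slot_of c (Inr (u, i)) \<and> slot_of d (Inr (u, Suc j)) = slot_of c (Inr (u, Suc i))"
proof -
  obtain k where k: "u \<in> U" "k < n" "c u k \<le> i" "i < c u (Suc k)" "slot_of c (Inr (u, i)) = Inr (u, k)"
    using slot_of_Inr assms(1) by metis
  obtain k' where k': "k' < n" "c u k' \<le> Suc i" "Suc i < c u (Suc k')" "slot_of c (Inr (u, Suc i)) = Inr (u, k')"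
    using slot_of_Inr assms(2) by metis
  have "k \<noteq> k'" using assms(3) k(5) k'(4) by simp
  note a = adjacent_slots[OF k(1,2) k'(1) this k(3,4) k'(2,3)]
  \<comment> \<open>The last position of factor \<open>k\<close> in the target word; its successor
    opens factor \<open>k'\<close>.\<close>
  define j where "j = d u (Suc k) - 1"
  have j: "d u k \<le> j" "j < d u (Suc k)" "Suc j = d u k'" using a by (auto simp: j_def)
  show ?thesis
    unfolding k(5) k'(4)
    using in_word_verts[OF k(1,2) j(2)] in_word_verts[OF k(1) k'(1), of "Suc j"] slot_of_d[OF k(1) j(1,2)]
      slot_of_d[OF k(1), of k' "Suc j"] j(3) a(6) by (intro exI[of _ j]) auto
qed

lemma adj_transfer_letter:
  assumes "Inr (u, i) \<in> word_verts V U s" "v \<in> s u ! i"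
  shows "\<exists>j. Inr (u, j) \<in> word_verts V U w \<and> slot_of d (Inr (u, j)) = slot_of c (Inr (u, i)) \<and> v \<in> w u ! j"
proof -
  obtain k where k: "u \<in> U" "k < n" "c u k \<le> i" "i < c u (Suc k)" "slot_of c (Inr (u, i)) = Inr (u, k)"
    using slot_of_Inr assms(1) by metis
  then have "v \<in> (\<Union>i\<in>{c u k..<c u (Suc k)}. s u ! i)" using assms(2) by auto
  then obtain j where "d u k \<le> j" "j < d u (Suc k)" "v \<in> w u ! j" unfolding same_letters[OF k(1,2)] by auto
  then show ?thesis using in_word_verts[OF k(1,2)] slot_of_d[OF k(1)] k(5) by metis
qed

text \<open>For different slots, the existence of an edge between them is a property of types: an
  edge to a branch vertex shows in the union of letters, an edge along the word in the fact that the
  two factors touch. Edges inside one slot are treated separately, through the blocks of a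
  path.\<close>

lemma adj_transfer:
  assumes "x \<in> word_verts V U s" "y \<in> word_verts V U s" "slot_of c x \<noteq> slot_of c y" "word_adj E s x y"
  shows "\<exists>x'\<in>word_verts V U w. \<exists>y'\<in>word_verts V U w.
    slot_of d x' = slot_of c x \<and> slot_of d y' = slot_of c y \<and> word_adj E w x' y'"
proof -
  have Inl: "slot_of d (Inl v) = slot_of c (Inl v) \<and> Inl v \<in> word_verts V U w"
    if "Inl v \<in> word_verts V U s" for v
    using that by (auto simp: word_verts_def)
  consider v v' where "x = Inl v" "y = Inl v'" | v u i where "x = Inl v" "y = Inr (u, i)"
    | v u i where "y = Inl v" "x = Inr (u, i)" | u i u' j where "x = Inr (u, i)" "y = Inr (u', j)"
    by (metis old.prod.exhaust sum.exhaust)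
  then show ?thesis
  proof cases
    case 1
    then show ?thesis using assms Inl[of v] Inl[of v'] by (intro bexI[of _ x] bexI[of _ y]) auto
  next
    case 2
    then obtain j where "Inr (u, j) \<in> word_verts V U w" "slot_of d (Inr (u, j)) = slot_of c y" "v \<in> w u ! j"
      using adj_transfer_letter[of u i V v] assms by auto
    then show ?thesis using 2 assms Inl[of v] by (intro bexI[of _ x] bexI[of _ "Inr (u, j)"]) auto
  next
    case 3
    then obtain j where "Inr (u, j) \<in> word_verts V U w" "slot_of d (Inr (u, j)) = slot_of c x" "v \<in> w u ! j"
      using adj_transfer_letter[of u i V v] assms by auto
    then show ?thesis using 3 assms Inl[of v] by (intro bexI[of _ y] bexI[of _ "Inr (u, j)"]) auto
  next
    case 4
    then have u: "u' = u" "j = Suc i \<or> i = Suc j" using assms(4) by auto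
    from u(2) show ?thesis
    proof
      assume j: "j = Suc i"
      then obtain p where "Inr (u, p) \<in> word_verts V U w" "Inr (u, Suc p) \<in> word_verts V U w"
        "slot_of d (Inr (u, p)) = slot_of c x" "slot_of d (Inr (u, Suc p)) = slot_of c y"
        using adj_transfer_step[of u i] assms(1-3) 4 u(1) by blast
      then show ?thesis by (intro bexI[of _ "Inr (u, p)"] bexI[of _ "Inr (u, Suc p)"]) auto
    next
      assume j: "i = Suc j"
      then obtain p where "Inr (u, p) \<in> word_verts V U w" "Inr (u, Suc p) \<in> word_verts V U w"
        "slot_of d (Inr (u, p)) = slot_of c y" "slot_of d (Inr (u, Suc p)) = slot_of c x"
        using adj_transfer_step[of u j] assms(1-3) 4 u(1) by metis
      then show ?thesis by (intro bexI[of _ "Inr (u, p)"] bexI[of _ "Inr (u, Suc p)"]) auto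
    qed
  qed
qed

lemma swapped: "matched_cuts U w s n d c"
  by unfold_locales (use c d same_length same_letters in auto)

end

section \<open>Transfer of an embedded realization\<close>

text \<open>At a non-special internal vertex a path of the copy continues along the word in both directions.\<close>
definition special :: "('a, 'z) pathograph_scheme \<Rightarrow> ('a \<Rightarrow> 'b wvertex) \<Rightarrow> ('a \<Rightarrow> 'b wvertex list) \<Rightarrow> 'b wvertex \<Rightarrow> bool" where
  "special F f Q x \<longleftrightarrow> x \<in> f ` pV F \<or>
     (\<exists>t\<in>pU F. \<exists>y. linked (Q t) x y \<and> (y \<in> range Inl \<or> y \<in> f ` pV F))"

text \<open>The copy lives in the graph of \<open>s\<close> and is to be moved to that of
  \<open>w\<close>. The assumption \<open>isolated\<close> is what \<open>isolating_cuts\<close>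
  provides: a special position is alone in its slot.\<close>

locale word_transfer = matched_cuts U s w n c d + realizes F "word_adj E s" f Q
  for V U :: "'b set" and E :: "'b set set" and s w :: "'b \<Rightarrow> 'b set list" and n :: nat
    and c d :: "'b \<Rightarrow> nat \<Rightarrow> nat"
    and F :: "('a, 'z) pathograph_scheme" and f :: "'a \<Rightarrow> 'b wvertex" and Q :: "'a \<Rightarrow> 'b wvertex list" +
  assumes wf: "wf_pathograph F"
    and image: "image_of F f Q \<subseteq> word_verts V U s"
    and isolated: "u \<in> U \<Longrightarrow> k < n \<Longrightarrow> c u k \<le> i \<Longrightarrow> i < c u (Suc k) \<Longrightarrow> special F f Q (Inr (u, i)) \<Longrightarrow>
      c u (Suc k) = Suc (c u k)"
begin

abbreviation "Vs \<equiv> word_verts V U s"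
abbreviation "Vw \<equiv> word_verts V U w"

lemma wf_endpoints: "t \<in> pU F \<Longrightarrow> pPi F t \<subseteq> pV F"
  and wf_spoke: "(a, t) \<in> pS F \<Longrightarrow> a \<in> pV F \<and> t \<in> pU F"
  and wf_edge: "{a} \<notin> pE F"
  using wf unfolding wf_pathograph_def two_subset_def by auto

lemma f_in: "a \<in> pV F \<Longrightarrow> f a \<in> Vs"
  using image by (auto simp: image_of_def)

lemma inner_in: "t \<in> pU F \<Longrightarrow> x \<in> set (inner (Q t)) \<Longrightarrow> x \<in> Vs"
  using image by (auto simp: image_of_def)

lemma path_cases:
  assumes "t \<in> pU F" "x \<in> set (Q t)"
  shows "x \<in> f ` pV F \<or> x \<in> set (inner (Q t))"
  using set_ends_inner[OF length_path[OF assms(1)]] ends[OF assms(1)] wf_endpoints[OF assms(1)] assms(2) by auto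

lemma path_in: "t \<in> pU F \<Longrightarrow> x \<in> set (Q t) \<Longrightarrow> x \<in> Vs"
  using path_cases f_in inner_in by blast

text \<open>An inner vertex has a predecessor and a successor on its path. If it is not special,
  neither of them is a branch vertex or the image of a vertex, so they are two distinct neighbouring
  positions of the same word, that is, the two neighbours on either side.\<close>

lemma nonspecial_neighbours:
  assumes t: "t \<in> pU F" and x: "Inr (u, i) \<in> set (inner (Q t))" and ns: "\<not> special F f Q (Inr (u, i))"
  shows "i > 0" "Inr (u, i - 1) \<in> set (inner (Q t))" "Inr (u, Suc i) \<in> set (inner (Q t))"
    "consec (Q t) (Inr (u, i - 1)) (Inr (u, i)) \<and> consec (Q t) (Inr (u, i)) (Inr (u, Suc i)) \<or>
     consec (Q t) (Inr (u, Suc i)) (Inr (u, i)) \<and> consec (Q t) (Inr (u, i)) (Inr (u, i - 1))"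
proof -
  let ?x = "Inr (u, i)"
  have xQ: "?x \<in> set (Q t)" using x set_ends_inner[OF length_path[OF t]] by auto
  have xf: "?x \<notin> f ` pV F" using inner_vertex[OF t x] .
  have "hd (Q t) \<in> f ` pV F" "last (Q t) \<in> f ` pV F" using ends[OF t] wf_endpoints[OF t] by auto
  then have "?x \<noteq> hd (Q t)" "?x \<noteq> last (Q t)" using xf by auto
  then obtain p q where pq: "consec (Q t) p ?x" "consec (Q t) ?x q"
    using ex_consec_left[OF xQ] ex_consec_right[OF xQ] by blast
  have nb: "\<exists>j. y = Inr (u, j) \<and> (j = Suc i \<or> i = Suc j) \<and> y \<in> set (inner (Q t))" if "linked (Q t) ?x y" for y
  proof -
    have "y \<notin> range Inl" "y \<notin> f ` pV F" using ns that t unfolding special_def by blast+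
    then obtain u' j where y: "y = Inr (u', j)" by (cases y) auto
    have "word_adj E s ?x y" using that adj_consec[OF t] word_adj_sym by blast
    moreover have "y \<in> set (Q t)" using that consec_in_set by fast
    ultimately show ?thesis using y path_cases[OF t, of y] \<open>y \<notin> f ` pV F\<close> by auto
  qed
  obtain j where j: "p = Inr (u, j)" "j = Suc i \<or> i = Suc j" "p \<in> set (inner (Q t))" using nb pq(1) by blast
  obtain k where k: "q = Inr (u, k)" "k = Suc i \<or> i = Suc k" "q \<in> set (inner (Q t))" using nb pq(2) by blast
  have "p \<noteq> q" using consec_asym[OF distinct_path[OF t] pq(1)] pq(2) by auto
  then have "j = Suc i \<and> i = Suc k \<or> i = Suc j \<and> k = Suc i" using j k by auto
  then show "i > 0" "Inr (u, i - 1) \<in> set (inner (Q t))" "Inr (u, Suc i) \<in> set (inner (Q t))"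
    "consec (Q t) (Inr (u, i - 1)) ?x \<and> consec (Q t) ?x (Inr (u, Suc i)) \<or>
     consec (Q t) (Inr (u, Suc i)) ?x \<and> consec (Q t) ?x (Inr (u, i - 1))"
    using j k pq by auto
qed

text \<open>A slot with several positions contains no special one, so a path that enters it
  continues in both directions until the slot is exhausted. Hence a slot is avoided or traversed
  completely.\<close>

lemma slot_inner:
  assumes t: "t \<in> pU F" and x: "Inr (u, i) \<in> set (inner (Q t))"
    and k: "u \<in> U" "k < n" "c u k \<le> i" "i < c u (Suc k)" "c u (Suc k) \<noteq> Suc (c u k)"
    and j: "c u k \<le> j" "j < c u (Suc k)"
  shows "Inr (u, j) \<in> set (inner (Q t))"
proof -
  have ns: "\<not> special F f Q (Inr (u, j))" if "c u k \<le> j" "j < c u (Suc k)" for j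
    using isolated[OF k(1,2) that] k(5) by blast
  have up: "i + m < c u (Suc k) \<Longrightarrow> Inr (u, i + m) \<in> set (inner (Q t))" for m
  proof (induction m)
    case (Suc m)
    then have "Inr (u, i + m) \<in> set (inner (Q t))" by simp
    then show ?case using nonspecial_neighbours(3)[OF t _ ns, of "i + m"] Suc.prems k(3) by simp
  qed (use x in simp)
  have down: "c u k + m \<le> i \<Longrightarrow> Inr (u, i - m) \<in> set (inner (Q t))" for m
  proof (induction m)
    case (Suc m)
    then have "Inr (u, i - m) \<in> set (inner (Q t))" by simp
    then show ?case using nonspecial_neighbours(2)[OF t _ ns, of "i - m"] Suc.prems k(4) by simp
  qed (use x in simp)
  show ?thesis
  proof (cases "i \<le> j")
    case True
    then show ?thesis using up[of "j - i"] j by simp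
  next
    case False
    then show ?thesis using down[of "i - j"] j by simp
  qed
qed

text \<open>The direction is tested at the left end of the source slot. A block with one element is
  its own reverse, so for such a slot both values give the same block.\<close>

fun reversed :: "'a \<Rightarrow> 'b wvertex \<Rightarrow> bool" where
  "reversed t (Inl v) = False"
| "reversed t (Inr (u, k)) = consec (Q t) (Inr (u, Suc (c u k))) (Inr (u, c u k))"

text \<open>The direction of traversal is read off from the source path and reused for the target slot.\<close>
definition block :: "'a \<Rightarrow> ('b \<Rightarrow> nat \<Rightarrow> nat) \<Rightarrow> 'b wvertex \<Rightarrow> 'b wvertex list" where
  "block t b \<kappa> = (if reversed t \<kappa> then rev (slot_list b \<kappa>) else slot_list b \<kappa>)"

lemma set_block [simp]: "set (block t b \<kappa>) = set (slot_list b \<kappa>)"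
  by (simp add: block_def)

lemma distinct_block: "distinct (block t b \<kappa>)"
  by (cases \<kappa>) (auto simp: block_def distinct_map inj_on_def)

text \<open>Two opposite steps between the same vertices cannot occur on a path without repetitions,
  so the direction at the left end propagates through the slot. The final step covered here already
  leads out of the slot.\<close>

lemma slot_direction:
  assumes t: "t \<in> pU F" and x: "Inr (u, i) \<in> set (inner (Q t))"
    and k: "u \<in> U" "k < n" "c u k \<le> i" "i < c u (Suc k)" "c u (Suc k) \<noteq> Suc (c u k)"
    and j: "c u k \<le> j" "j < c u (Suc k)"
  shows "if reversed t (Inr (u, k)) then consec (Q t) (Inr (u, Suc j)) (Inr (u, j))
    else consec (Q t) (Inr (u, j)) (Inr (u, Suc j))"
proof -
  have ns: "\<not> special F f Q (Inr (u, j))" if "c u k \<le> j" "j < c u (Suc k)" for j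
    using isolated[OF k(1,2) that] k(5) by blast
  have inn: "Inr (u, j) \<in> set (inner (Q t))" if "c u k \<le> j" "j < c u (Suc k)" for j
    using slot_inner[OF t x k that] .
  note nn = nonspecial_neighbours(4)[OF t inn ns]
  note asym = consec_asym[OF distinct_path[OF t]]
  have "if reversed t (Inr (u, k)) then consec (Q t) (Inr (u, Suc (c u k + m))) (Inr (u, c u k + m))
    else consec (Q t) (Inr (u, c u k + m)) (Inr (u, Suc (c u k + m)))" if "c u k + m < c u (Suc k)" for m
    using that
  proof (induction m)
    case 0
    then show ?case using nn[of "c u k"] by auto
  next
    case (Suc m)
    show ?case
    proof (cases "reversed t (Inr (u, k))")
      case True
      then have "consec (Q t) (Inr (u, Suc (c u k + m))) (Inr (u, c u k + m))" using Suc by simp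
      then show ?thesis using True nn[of "Suc (c u k + m)"] Suc.prems asym by fastforce
    next
      case False
      then have "consec (Q t) (Inr (u, c u k + m)) (Inr (u, Suc (c u k + m)))" using Suc by simp
      then show ?thesis using False nn[of "Suc (c u k + m)"] Suc.prems asym by fastforce
    qed
  qed
  moreover have "c u k + (j - c u k) = j" using j(1) by simp
  ultimately show ?thesis using j(2) by metis
qed

lemma special_vertex: "a \<in> pV F \<Longrightarrow> special F f Q (f a)"
  by (auto simp: special_def)

lemma special_slot:
  assumes "x \<in> Vs" "special F f Q x"
  shows "slot_list c (slot_of c x) = [x]"
proof (cases x)
  case (Inr p)
  obtain u i where x: "x = Inr (u, i)" using Inr by (cases p) auto
  obtain k where k: "u \<in> U" "k < n" "c u k \<le> i" "i < c u (Suc k)" "slot_of c (Inr (u, i)) = Inr (u, k)"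
    using slot_of_Inr assms(1) x by metis
  have "c u (Suc k) = Suc (c u k)" using isolated[OF k(1-4)] assms(2) x by simp
  then show ?thesis using k(3-5) x by simp
qed simp

text \<open>A block that has a step has at least two elements, so its slot contains no special
  position and the path runs through it in the direction recorded by
  \<open>reversed\<close>.\<close>

lemma consec_block:
  assumes t: "t \<in> pU F" and x: "x \<in> set (Q t)" and ab: "consec (block t c (slot_of c x)) a b"
  shows "consec (Q t) a b"
proof -
  have xV: "x \<in> Vs" using path_in[OF t x] .
  have len: "slot_list c (slot_of c x) \<noteq> [y]" for y
    using ab by (auto simp: block_def consec_Cons split: if_splits)
  then have "\<not> special F f Q x" using special_slot[OF xV] by blast
  then have xi: "x \<in> set (inner (Q t))" using path_cases[OF t x] special_vertex by blast
  obtain u i where xe: "x = Inr (u, i)"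
    using len by (cases x) auto
  obtain k where k: "u \<in> U" "k < n" "c u k \<le> i" "i < c u (Suc k)" "slot_of c (Inr (u, i)) = Inr (u, k)"
    using slot_of_Inr xV xe by metis
  have ne: "c u (Suc k) \<noteq> Suc (c u k)"
  proof
    assume "c u (Suc k) = Suc (c u k)"
    then have "slot_list c (slot_of c x) = [Inr (u, c u k)]" unfolding xe k(5) by simp
    then show False using len by blast
  qed
  note dir = slot_direction[OF t xi[unfolded xe] k(1-4) ne]
  show ?thesis
  proof (cases "reversed t (Inr (u, k))")
    case True
    then have "consec (map (\<lambda>i. Inr (u, i)) [c u k..<c u (Suc k)]) b a"
      using ab[unfolded block_def xe k(5)] by (simp add: consec_rev)
    then show ?thesis unfolding consec_upt using dir True by auto
  next
    case False
    then have "consec (map (\<lambda>i. Inr (u, i)) [c u k..<c u (Suc k)]) a b"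
      using ab[unfolded block_def xe k(5)] by (simp del: upt_Suc)
    then show ?thesis unfolding consec_upt using dir False by auto
  qed
qed

text \<open>Blocks are peeled off from the front. The invariant is that the treated part
  \<open>xs\<close> and the rest \<open>ys\<close> have no slot in common, which forces the next
  vertex to open its block.\<close>

lemma path_suffix_blocks:
  assumes t: "t \<in> pU F"
  shows "Q t = xs @ ys \<Longrightarrow> (\<forall>x\<in>set xs. \<forall>y\<in>set ys. slot_of c x \<noteq> slot_of c y) \<Longrightarrow>
    \<exists>ks. ys = concat (map (block t c) ks) \<and> set ks = slot_of c ` set ys"
proof (induction "length ys" arbitrary: xs ys rule: less_induct)
  case less
  show ?case
  proof (cases ys)
    case Nil
    then show ?thesis by (intro exI[of _ "[]"]) simp
  next
    case (Cons y ys0)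
    let ?b = "block t c (slot_of c y)"
    have yQ: "y \<in> set (Q t)" using less.prems(1) Cons by simp
    have yV: "y \<in> Vs" using path_in[OF t yQ] .
    have sb: "set ?b = {z \<in> Vs. slot_of c z = slot_of c y}" using set_slot_list[OF yV] by simp
    have yb: "y \<in> set ?b" using sb yV by simp
    \<comment> \<open>Otherwise the predecessor of \<open>y\<close> in its block precedes
      \<open>y\<close> on the path as well, so it lies in \<open>xs\<close> but in the slot of
      \<open>y\<close>.\<close>
    have "hd ?b = y"
    proof (rule ccontr)
      assume "hd ?b \<noteq> y"
      then obtain p where p: "consec ?b p y" using ex_consec_left[OF yb] by auto
      then have pQ: "consec (xs @ y # ys0) p y" using consec_block[OF t yQ] less.prems(1) Cons by simp
      have "distinct (xs @ y # ys0)" using distinct_path[OF t] less.prems(1) Cons by simp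
      then have "p \<in> set xs"
        using pQ by (auto simp: consec_append consec_Cons dest: consec_in_set)
      moreover have "slot_of c p = slot_of c y" using p consec_in_set sb by fastforce
      ultimately show False using less.prems(2) Cons by auto
    qed
    then obtain ys' where ys': "ys = ?b @ ys'"
      using consec_chain_prefix[of xs ys ?b] distinct_path[OF t] less.prems(1) Cons yb consec_block[OF t yQ]
      by fastforce
    have "length ys' < length ys" using ys' yb by (cases ?b) auto
    moreover have "Q t = (xs @ ?b) @ ys'" using less.prems(1) ys' by simp
    moreover have "\<forall>x\<in>set (xs @ ?b). \<forall>z\<in>set ys'. slot_of c x \<noteq> slot_of c z"
    proof (intro ballI)
      fix x z assume x: "x \<in> set (xs @ ?b)" and z: "z \<in> set ys'"
      have zQ: "z \<in> set (Q t)" using z less.prems(1) ys' by simp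
      show "slot_of c x \<noteq> slot_of c z"
      proof (cases "x \<in> set xs")
        case True
        then show ?thesis using less.prems(2) z ys' by auto
      next
        case False
        then have "slot_of c x = slot_of c y" using x sb by auto
        moreover have "z \<notin> set ?b" using z ys' distinct_path[OF t] less.prems(1) by auto
        ultimately show ?thesis using sb path_in[OF t zQ] by auto
      qed
    qed
    ultimately obtain ks where ks: "ys' = concat (map (block t c) ks)" "set ks = slot_of c ` set ys'"
      using less.hyps by blast
    have "slot_of c ` set ?b = {slot_of c y}" using sb yb by auto
    then show ?thesis using ks ys' by (intro exI[of _ "slot_of c y # ks"]) (auto simp: image_Un)
  qed
qed

section \<open>The path moved to the target word, block by block\<close>

definition path_blocks :: "'a \<Rightarrow> 'b wvertex list" where
  "path_blocks t = (SOME ks. Q t = concat (map (block t c) ks) \<and> set ks = slot_of c ` set (Q t))"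

lemma path_blocks:
  assumes "t \<in> pU F"
  shows "Q t = concat (map (block t c) (path_blocks t))" "set (path_blocks t) = slot_of c ` set (Q t)"
proof -
  have "\<exists>ks. Q t = concat (map (block t c) ks) \<and> set ks = slot_of c ` set (Q t)"
    using path_suffix_blocks[OF assms, of "[]" "Q t"] by simp
  from someI_ex[OF this] show "Q t = concat (map (block t c) (path_blocks t))"
    "set (path_blocks t) = slot_of c ` set (Q t)"
    unfolding path_blocks_def by auto
qed

definition new_path :: "'a \<Rightarrow> 'b wvertex list" where
  "new_path t = concat (map (block t d) (path_blocks t))"

text \<open>Meant for special vertices, in particular images of vertices of \<open>F\<close>: their
  slots have one element on both sides, so taking the head involves no choice.\<close>

definition new_vertex :: "'b wvertex \<Rightarrow> 'b wvertex" where
  "new_vertex x = hd (slot_list d (slot_of c x))"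

lemma set_slot_list_new:
  assumes "x \<in> Vs"
  shows "set (slot_list d (slot_of c x)) = {y \<in> Vw. slot_of d y = slot_of c x}"
    and "slot_list d (slot_of c x) \<noteq> []"
proof -
  obtain x' where x': "x' \<in> Vw" "slot_of d x' = slot_of c x" using vertex_transfer[OF assms] by blast
  show "set (slot_list d (slot_of c x)) = {y \<in> Vw. slot_of d y = slot_of c x}"
    using matched_cuts.set_slot_list[OF swapped x'(1)] x'(2) by simp
  show "slot_list d (slot_of c x) \<noteq> []"
    using matched_cuts.slot_list_nonempty[OF swapped x'(1)] x'(2) by simp
qed

text \<open>Here the distinction between length 1 and larger lengths in \<open>piece_type\<close> is
  used.\<close>

lemma single_slot_iff:
  assumes "x \<in> Vs"
  shows "length (slot_list d (slot_of c x)) = 1 \<longleftrightarrow> length (slot_list c (slot_of c x)) = 1"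
proof (cases x)
  case (Inr p)
  obtain u i where x: "x = Inr (u, i)" using Inr by (cases p) auto
  obtain k where k: "u \<in> U" "k < n" "slot_of c (Inr (u, i)) = Inr (u, k)"
    using slot_of_Inr assms x by metis
  show ?thesis using same_length[OF k(1,2)] unfolding x k(3) by (auto simp: min_def split: if_splits)
qed simp

lemma new_vertex_in: "x \<in> Vs \<Longrightarrow> new_vertex x \<in> Vw"
  and slot_of_new_vertex: "x \<in> Vs \<Longrightarrow> slot_of d (new_vertex x) = slot_of c x"
  using set_slot_list_new[of x] hd_in_set[of "slot_list d (slot_of c x)"] unfolding new_vertex_def by auto

lemma special_new_slot:
  assumes "x \<in> Vs" "special F f Q x"
  shows "slot_list d (slot_of c x) = [new_vertex x]"
proof -
  have "length (slot_list d (slot_of c x)) = 1"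
    using single_slot_iff[OF assms(1)] special_slot[OF assms] by simp
  then show ?thesis unfolding new_vertex_def by (cases "slot_list d (slot_of c x)") auto
qed

lemma block_ends:
  assumes "b u k < b u (Suc k)"
  shows "hd (block t b (Inr (u, k))) = Inr (u, if reversed t (Inr (u, k)) then b u (Suc k) - 1 else b u k)"
    and "last (block t b (Inr (u, k))) = Inr (u, if reversed t (Inr (u, k)) then b u k else b u (Suc k) - 1)"
  using assms by (auto simp: block_def hd_rev last_rev hd_map last_map simp del: reversed.simps)

text \<open>Which end of its slot a block starts or stops at depends on the direction only, and
  source and target share the direction. If the source slot has a single position, left and right
  end coincide there, and they also coincide in the target.\<close>

lemma block_ends_transfer:
  assumes k: "u \<in> U" "k < n" "c u k < c u (Suc k)"
  shows "last (block t c (Inr (u, k))) = Inr (u, c u (Suc k) - 1) \<Longrightarrow> last (block t d (Inr (u, k))) = Inr (u, d u (Suc k) - 1)"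
    and "last (block t c (Inr (u, k))) = Inr (u, c u k) \<Longrightarrow> last (block t d (Inr (u, k))) = Inr (u, d u k)"
    and "hd (block t c (Inr (u, k))) = Inr (u, c u (Suc k) - 1) \<Longrightarrow> hd (block t d (Inr (u, k))) = Inr (u, d u (Suc k) - 1)"
    and "hd (block t c (Inr (u, k))) = Inr (u, c u k) \<Longrightarrow> hd (block t d (Inr (u, k))) = Inr (u, d u k)"
proof -
  have dk: "d u k < d u (Suc k)" and one: "c u (Suc k) - 1 = c u k \<Longrightarrow> d u (Suc k) - 1 = d u k"
    using same_length[OF k(1,2)] k(3) by (auto simp: min_def split: if_splits)
  note e = block_ends[of c u k t, OF k(3)] block_ends[of d u k t, OF dk]
  show "last (block t c (Inr (u, k))) = Inr (u, c u (Suc k) - 1) \<Longrightarrow> last (block t d (Inr (u, k))) = Inr (u, d u (Suc k) - 1)"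
    "last (block t c (Inr (u, k))) = Inr (u, c u k) \<Longrightarrow> last (block t d (Inr (u, k))) = Inr (u, d u k)"
    "hd (block t c (Inr (u, k))) = Inr (u, c u (Suc k) - 1) \<Longrightarrow> hd (block t d (Inr (u, k))) = Inr (u, d u (Suc k) - 1)"
    "hd (block t c (Inr (u, k))) = Inr (u, c u k) \<Longrightarrow> hd (block t d (Inr (u, k))) = Inr (u, d u k)"
    unfolding e using one by (auto split: if_splits simp del: reversed.simps)
qed

lemma path_block_vertex:
  assumes "t \<in> pU F" "\<kappa> \<in> set (path_blocks t)"
  obtains z where "z \<in> set (Q t)" "z \<in> Vs" "\<kappa> = slot_of c z" "block t c \<kappa> \<noteq> []" "block t d \<kappa> \<noteq> []"
    "\<And>x. x \<in> set (block t c \<kappa>) \<longleftrightarrow> x \<in> Vs \<and> slot_of c x = \<kappa>"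
    "\<And>x. x \<in> set (block t d \<kappa>) \<longleftrightarrow> x \<in> Vw \<and> slot_of d x = \<kappa>"
proof -
  obtain z where z: "z \<in> set (Q t)" "\<kappa> = slot_of c z" using assms path_blocks(2)[OF assms(1)] by auto
  have zV: "z \<in> Vs" using path_in[OF assms(1) z(1)] .
  have "block t b \<kappa> \<noteq> []" if "slot_list b \<kappa> \<noteq> []" for b using that by (simp add: block_def)
  then show ?thesis
    using that[of z] z zV slot_list_nonempty[OF zV] set_slot_list[OF zV] set_slot_list_new[OF zV] by auto
qed

lemma distinct_path_blocks: "t \<in> pU F \<Longrightarrow> distinct (path_blocks t)"
  using distinct_concat_mapD[of "block t c" "path_blocks t"] path_blocks(1)[of t] distinct_path[of t]
    path_block_vertex[of t] by metis

lemma consec_path: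
  assumes t: "t \<in> pU F"
  shows "consec (Q t) x y \<longleftrightarrow> (\<exists>\<kappa>\<in>set (path_blocks t). consec (block t c \<kappa>) x y) \<or>
    (\<exists>\<kappa> \<kappa>'. consec (path_blocks t) \<kappa> \<kappa>' \<and> x = last (block t c \<kappa>) \<and> y = hd (block t c \<kappa>'))"
  by (subst path_blocks(1)[OF t], rule consec_concat_map) (metis path_block_vertex[OF t])

lemma consec_new_path:
  assumes t: "t \<in> pU F"
  shows "consec (new_path t) x y \<longleftrightarrow> (\<exists>\<kappa>\<in>set (path_blocks t). consec (block t d \<kappa>) x y) \<or>
    (\<exists>\<kappa> \<kappa>'. consec (path_blocks t) \<kappa> \<kappa>' \<and> x = last (block t d \<kappa>) \<and> y = hd (block t d \<kappa>'))"
  unfolding new_path_def by (rule consec_concat_map) (metis path_block_vertex[OF t])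

text \<open>Two consecutive blocks of the new path must be joined by exactly one edge, or the path
  would not be induced. If both slots are single, \<open>adj_transfer\<close> gives the edge.
  Otherwise a slot with several positions has no special one, so the path crosses the junction
  between neighbouring positions of one word, and the two target factors touch only at the
  corresponding ends.\<close>

lemma junction:
  assumes t: "t \<in> pU F" and kk: "consec (path_blocks t) \<kappa> \<kappa>'"
  shows "word_adj E w (last (block t d \<kappa>)) (hd (block t d \<kappa>'))"
    and "x \<in> set (block t d \<kappa>) \<Longrightarrow> y \<in> set (block t d \<kappa>') \<Longrightarrow> word_adj E w x y \<Longrightarrow>
      x = last (block t d \<kappa>) \<and> y = hd (block t d \<kappa>')"
proof -
  have k1: "\<kappa> \<in> set (path_blocks t)" and k2: "\<kappa>' \<in> set (path_blocks t)" using consec_in_set[OF kk] by auto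
  obtain z1 where z1: "z1 \<in> Vs" "\<kappa> = slot_of c z1" "block t c \<kappa> \<noteq> []" "block t d \<kappa> \<noteq> []"
    "\<And>x. x \<in> set (block t c \<kappa>) \<longleftrightarrow> x \<in> Vs \<and> slot_of c x = \<kappa>"
    "\<And>x. x \<in> set (block t d \<kappa>) \<longleftrightarrow> x \<in> Vw \<and> slot_of d x = \<kappa>"
    using path_block_vertex[OF t k1] by metis
  obtain z2 where z2: "z2 \<in> Vs" "\<kappa>' = slot_of c z2" "block t c \<kappa>' \<noteq> []" "block t d \<kappa>' \<noteq> []"
    "\<And>x. x \<in> set (block t c \<kappa>') \<longleftrightarrow> x \<in> Vs \<and> slot_of c x = \<kappa>'"
    "\<And>x. x \<in> set (block t d \<kappa>') \<longleftrightarrow> x \<in> Vw \<and> slot_of d x = \<kappa>'"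
    using path_block_vertex[OF t k2] by metis
  define x' where "x' = last (block t c \<kappa>)"
  define y' where "y' = hd (block t c \<kappa>')"
  have x': "x' \<in> Vs" "slot_of c x' = \<kappa>" using z1(5)[of x'] last_in_set[OF z1(3)] by (auto simp: x'_def)
  have y': "y' \<in> Vs" "slot_of c y' = \<kappa>'" using z2(5)[of y'] hd_in_set[OF z2(3)] by (auto simp: y'_def)
  have xy: "consec (Q t) x' y'" unfolding consec_path[OF t] x'_def y'_def using kk by blast
  have adj: "word_adj E s x' y'" using adj_consec[OF t xy] .
  have ne: "\<kappa> \<noteq> \<kappa>'" using consec_distinct[OF distinct_path_blocks[OF t] kk] .
  have single: "block t d (slot_of c z) = [hd (slot_list d (slot_of c z))]"
    if "length (slot_list c (slot_of c z)) = 1" "z \<in> Vs" for z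
  proof -
    have "length (slot_list d (slot_of c z)) = 1" using single_slot_iff[OF that(2)] that(1) by simp
    then obtain y where "slot_list d (slot_of c z) = [y]" by (auto simp: length_Suc_conv)
    then show ?thesis by (simp add: block_def)
  qed
  have "word_adj E w (last (block t d \<kappa>)) (hd (block t d \<kappa>')) \<and>
    (\<forall>x y. x \<in> set (block t d \<kappa>) \<longrightarrow> y \<in> set (block t d \<kappa>') \<longrightarrow> word_adj E w x y \<longrightarrow>
      x = last (block t d \<kappa>) \<and> y = hd (block t d \<kappa>'))"
  proof (cases "length (slot_list c \<kappa>) = 1 \<and> length (slot_list c \<kappa>') = 1")
    case True
    obtain x y where b: "block t d \<kappa> = [x]" "block t d \<kappa>' = [y]"
      using single[of z1] single[of z2] True z1(1,2) z2(1,2) by auto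
    obtain x1 y1 where "x1 \<in> Vw" "y1 \<in> Vw" "slot_of d x1 = \<kappa>" "slot_of d y1 = \<kappa>'" "word_adj E w x1 y1"
      using adj_transfer[OF x'(1) y'(1) _ adj] ne x'(2) y'(2) by auto
    then have "x1 = x" "y1 = y" using z1(6)[of x1] z2(6)[of y1] b by auto
    then show ?thesis using b \<open>word_adj E w x1 y1\<close> by auto
  next
    case False
    have "x' \<notin> range Inl \<and> y' \<notin> range Inl"
    proof (cases "length (slot_list c \<kappa>) = 1")
      case True
      then have "length (slot_list c \<kappa>') \<noteq> 1" using False by simp
      then have "\<not> special F f Q y'" using special_slot[OF y'(1)] y'(2) by auto
      then have "x' \<notin> range Inl" using xy t unfolding special_def by blast
      moreover have "y' \<notin> range Inl" using \<open>length (slot_list c \<kappa>') \<noteq> 1\<close> y'(2) by auto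
      ultimately show ?thesis by blast
    next
      case False
      then have "\<not> special F f Q x'" using special_slot[OF x'(1)] x'(2) by auto
      then have "y' \<notin> range Inl" using xy t unfolding special_def by blast
      moreover have "x' \<notin> range Inl" using False x'(2) by auto
      ultimately show ?thesis by blast
    qed
    then obtain u i u' i' where xi: "x' = Inr (u, i)" and yi0: "y' = Inr (u', i')"
      by (cases x'; cases y') auto
    then have u': "u' = u" and ii: "i' = Suc i \<or> i = Suc i'" using adj by auto
    have yi: "y' = Inr (u, i')" using yi0 u' by simp
    obtain k where k: "u \<in> U" "k < n" "c u k \<le> i" "i < c u (Suc k)" "\<kappa> = Inr (u, k)"
      using slot_of_Inr x' xi by metis
    obtain k' where k': "k' < n" "c u k' \<le> i'" "i' < c u (Suc k')" "\<kappa>' = Inr (u, k')"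
      using slot_of_Inr y' yi by metis
    have kne: "k \<noteq> k'" using ne k(5) k'(4) by simp
    have ck: "c u k < c u (Suc k)" "c u k' < c u (Suc k')" using k k' by auto
    have bl: "\<exists>p. x = Inr (u, p) \<and> d u k \<le> p \<and> p < d u (Suc k)" if "x \<in> set (block t d \<kappa>)" for x
      using that k(5) by auto
    have bl': "\<exists>p. x = Inr (u, p) \<and> d u k' \<le> p \<and> p < d u (Suc k')" if "x \<in> set (block t d \<kappa>')" for x
      using that k'(4) by auto
    \<comment> \<open>The path crosses the junction upwards or downwards along the word; the two
      cases mirror each other.\<close>
    from ii show ?thesis
    proof
      assume i': "i' = Suc i"
      note a = adjacent_slots[OF k(1,2) k'(1) kne k(3,4) k'(2,3)[unfolded i']]
      have "last (block t c \<kappa>) = Inr (u, c u (Suc k) - 1)" using a(2) xi by (simp add: x'_def)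
      then have l: "last (block t d \<kappa>) = Inr (u, d u (Suc k) - 1)"
        using block_ends_transfer(1)[OF k(1,2) ck(1)] k(5) by simp
      have "hd (block t c \<kappa>') = Inr (u, c u k')" using a(3) yi i' by (simp add: y'_def)
      then have h: "hd (block t d \<kappa>') = Inr (u, d u k')"
        using block_ends_transfer(4)[OF k(1) k'(1) ck(2)] k'(4) by simp
      have "x = last (block t d \<kappa>) \<and> y = hd (block t d \<kappa>')"
        if b: "x \<in> set (block t d \<kappa>)" "y \<in> set (block t d \<kappa>')" "word_adj E w x y" for x y
      proof -
        obtain p where p: "x = Inr (u, p)" "d u k \<le> p" "p < d u (Suc k)" using bl[OF b(1)] by blast
        obtain q where q: "y = Inr (u, q)" "d u k' \<le> q" "q < d u (Suc k')" using bl'[OF b(2)] by blast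
        have "q = Suc p \<or> p = Suc q" using b(3) p(1) q(1) by simp
        then have "p = d u (Suc k) - 1 \<and> q = d u k'" using a(4) p(2,3) q(2,3) by auto
        then show ?thesis using l h p q by simp
      qed
      moreover have "word_adj E w (last (block t d \<kappa>)) (hd (block t d \<kappa>'))" using l h a(4,5) by simp
      ultimately show ?thesis by blast
    next
      assume i': "i = Suc i'"
      note a = adjacent_slots[OF k(1) k'(1) k(2) kne[symmetric] k'(2,3) k(3,4)[unfolded i']]
      have "last (block t c \<kappa>) = Inr (u, c u k)" using a(3) xi i' by (simp add: x'_def)
      then have l: "last (block t d \<kappa>) = Inr (u, d u k)"
        using block_ends_transfer(2)[OF k(1,2) ck(1)] k(5) by simp
      have "hd (block t c \<kappa>') = Inr (u, c u (Suc k') - 1)" using a(2) yi by (simp add: y'_def)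
      then have h: "hd (block t d \<kappa>') = Inr (u, d u (Suc k') - 1)"
        using block_ends_transfer(3)[OF k(1) k'(1) ck(2)] k'(4) by simp
      have "x = last (block t d \<kappa>) \<and> y = hd (block t d \<kappa>')"
        if b: "x \<in> set (block t d \<kappa>)" "y \<in> set (block t d \<kappa>')" "word_adj E w x y" for x y
      proof -
        obtain p where p: "x = Inr (u, p)" "d u k \<le> p" "p < d u (Suc k)" using bl[OF b(1)] by blast
        obtain q where q: "y = Inr (u, q)" "d u k' \<le> q" "q < d u (Suc k')" using bl'[OF b(2)] by blast
        have "q = Suc p \<or> p = Suc q" using b(3) p(1) q(1) by simp
        then have "q = d u (Suc k') - 1 \<and> p = d u k" using a(4) p(2,3) q(2,3) by auto
        then show ?thesis using l h p q by simp
      qed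
      moreover have "word_adj E w (last (block t d \<kappa>)) (hd (block t d \<kappa>'))" using l h a(4,5) by simp
      ultimately show ?thesis by blast
    qed
  qed
  then show "word_adj E w (last (block t d \<kappa>)) (hd (block t d \<kappa>'))"
    "x \<in> set (block t d \<kappa>) \<Longrightarrow> y \<in> set (block t d \<kappa>') \<Longrightarrow> word_adj E w x y \<Longrightarrow>
      x = last (block t d \<kappa>) \<and> y = hd (block t d \<kappa>')" by blast+
qed

lemma vertex_slot_unique:
  assumes a: "a \<in> pV F"
  shows "y \<in> Vs \<Longrightarrow> slot_of c y = slot_of c (f a) \<Longrightarrow> y = f a"
    and "y \<in> Vw \<Longrightarrow> slot_of d y = slot_of c (f a) \<Longrightarrow> y = new_vertex (f a)"
    and "block t c (slot_of c (f a)) = [f a]" "block t d (slot_of c (f a)) = [new_vertex (f a)]"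
proof -
  note s1 = special_slot[OF f_in[OF a] special_vertex[OF a]]
  note s2 = special_new_slot[OF f_in[OF a] special_vertex[OF a]]
  show "y \<in> Vs \<Longrightarrow> slot_of c y = slot_of c (f a) \<Longrightarrow> y = f a"
    using set_slot_list[OF f_in[OF a]] s1 by auto
  show "y \<in> Vw \<Longrightarrow> slot_of d y = slot_of c (f a) \<Longrightarrow> y = new_vertex (f a)"
    using set_slot_list_new(1)[OF f_in[OF a]] s2 by auto
  show "block t c (slot_of c (f a)) = [f a]" "block t d (slot_of c (f a)) = [new_vertex (f a)]"
    using s1 s2 by (simp_all add: block_def)
qed

text \<open>The ends of a path are images of vertices, hence special, so each end forms a block by
  itself and the inner vertices are exactly the blocks in between.\<close>

lemma path_blocks_ends:
  assumes t: "t \<in> pU F"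
  obtains mid where "path_blocks t = slot_of c (hd (Q t)) # mid @ [slot_of c (last (Q t))]"
    "inner (Q t) = concat (map (block t c) mid)" "mid \<noteq> []"
proof -
  obtain a b where ab: "a \<in> pV F" "b \<in> pV F" "hd (Q t) = f a" "last (Q t) = f b"
    using ends[OF t] wf_endpoints[OF t] by blast
  have Q: "Q t = concat (map (block t c) (path_blocks t))" using path_blocks(1)[OF t] .
  have len: "3 \<le> length (Q t)" using length_path[OF t] .
  have "path_blocks t \<noteq> []" using Q len by auto
  then obtain k ks where ks: "path_blocks t = k # ks" by (cases "path_blocks t") auto
  have nb: "block t c k' \<noteq> [] \<and> (\<forall>x\<in>set (block t c k'). slot_of c x = k')" if k': "k' \<in> set (path_blocks t)" for k'
    using path_block_vertex[OF t k'] by metis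
  have "f a \<in> set (block t c k)" using Q ks ab(3) nb[of k] hd_in_set[of "block t c k"] by simp
  then have k: "k = slot_of c (f a)" using nb[of k] ks by auto
  then have Q1: "Q t = f a # concat (map (block t c) ks)" using Q ks vertex_slot_unique(3)[OF ab(1)] by simp
  then have "ks \<noteq> []" using len by auto
  then obtain mid k' where mid: "ks = mid @ [k']" by (cases ks rule: rev_cases) auto
  have k'in: "k' \<in> set (path_blocks t)" using ks mid by simp
  have "f b \<in> set (block t c k')"
    using Q1 mid ab(4) nb[OF k'in] last_in_set[of "block t c k'"] by simp
  then have k': "k' = slot_of c (f b)" using nb[OF k'in] by auto
  then have Q2: "Q t = f a # concat (map (block t c) mid) @ [f b]"
    using Q1 mid vertex_slot_unique(3)[OF ab(2)] by simp
  then have "inner (Q t) = concat (map (block t c) mid)" by (simp add: butlast_append)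
  moreover have "mid \<noteq> []" using Q2 len by auto
  ultimately show ?thesis using that ks mid k k' ab by simp
qed

text \<open>The inner part of a path is a union of slots, and the new path occupies the same slots.
  Questions of disjointness and adjacency for new paths are thereby reduced to slots.\<close>

lemma new_path_ends:
  assumes t: "t \<in> pU F"
  shows "hd (new_path t) = new_vertex (hd (Q t))" "last (new_path t) = new_vertex (last (Q t))"
    "3 \<le> length (new_path t)"
    "x \<in> set (inner (new_path t)) \<longleftrightarrow> x \<in> Vw \<and> slot_of d x \<in> slot_of c ` set (inner (Q t))"
    "x' \<in> set (inner (Q t)) \<Longrightarrow> y' \<in> Vs \<Longrightarrow> slot_of c y' = slot_of c x' \<Longrightarrow> y' \<in> set (inner (Q t))"
proof -
  obtain mid where mid: "path_blocks t = slot_of c (hd (Q t)) # mid @ [slot_of c (last (Q t))]"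
    "inner (Q t) = concat (map (block t c) mid)" "mid \<noteq> []" using path_blocks_ends[OF t] by blast
  obtain a b where ab: "a \<in> pV F" "b \<in> pV F" "hd (Q t) = f a" "last (Q t) = f b"
    using ends[OF t] wf_endpoints[OF t] by blast
  have N: "new_path t = new_vertex (f a) # concat (map (block t d) mid) @ [new_vertex (f b)]"
    using mid(1) ab vertex_slot_unique(4) by (simp add: new_path_def)
  have "k \<in> set (path_blocks t)" if "k \<in> set mid" for k using mid(1) that by simp
  then have bl: "block t d k \<noteq> [] \<and> block t c k \<noteq> [] \<and> (\<forall>x. x \<in> set (block t c k) \<longleftrightarrow> x \<in> Vs \<and> slot_of c x = k) \<and>
      (\<forall>x. x \<in> set (block t d k) \<longleftrightarrow> x \<in> Vw \<and> slot_of d x = k)" if k: "k \<in> set mid" for k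
    using path_block_vertex[OF t] k by metis
  show "hd (new_path t) = new_vertex (hd (Q t))" "last (new_path t) = new_vertex (last (Q t))" using N ab by auto
  have "concat (map (block t d) mid) \<noteq> []" using bl mid(3) by (cases mid) auto
  then show "3 \<le> length (new_path t)" unfolding N by (cases "concat (map (block t d) mid)") auto
  have I: "inner (new_path t) = concat (map (block t d) mid)" unfolding N by (simp add: butlast_append)
  have inn: "z \<in> set (inner (Q t)) \<longleftrightarrow> z \<in> Vs \<and> slot_of c z \<in> set mid" for z
    unfolding mid(2) using bl by auto
  have "k \<in> slot_of c ` set (inner (Q t))" if k: "k \<in> set mid" for k
  proof -
    obtain z where "z \<in> set (block t c k)" using bl[OF k] by (cases "block t c k") auto
    then show ?thesis using bl[OF k] inn k by auto
  qed
  then have "set mid = slot_of c ` set (inner (Q t))" using inn by blast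
  then show "x \<in> set (inner (new_path t)) \<longleftrightarrow> x \<in> Vw \<and> slot_of d x \<in> slot_of c ` set (inner (Q t))"
    unfolding I using bl by auto
  show "x' \<in> set (inner (Q t)) \<Longrightarrow> y' \<in> Vs \<Longrightarrow> slot_of c y' = slot_of c x' \<Longrightarrow> y' \<in> set (inner (Q t))"
    unfolding inn by simp
qed

text \<open>A step between different slots is the junction of two blocks. By the uniqueness in
  \<open>junction\<close>, an adjacent pair of target vertices in these slots can only be the new
  junction.\<close>

lemma linked_transfer:
  assumes t: "t \<in> pU F" and l: "linked (Q t) x' y'" and ne: "slot_of c x' \<noteq> slot_of c y'"
    and x: "x \<in> Vw" "slot_of d x = slot_of c x'" and y: "y \<in> Vw" "slot_of d y = slot_of c y'"
    and adj: "word_adj E w x y"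
  shows "linked (new_path t) x y"
proof -
  have *: "consec (new_path t) x y"
    if l: "consec (Q t) x' y'" and ne: "slot_of c x' \<noteq> slot_of c y'"
      and x: "x \<in> Vw" "slot_of d x = slot_of c x'" and y: "y \<in> Vw" "slot_of d y = slot_of c y'"
      and adj: "word_adj E w x y" for x y x' y'
  proof -
    have nb: "(\<forall>x. x \<in> set (block t c k) \<longrightarrow> slot_of c x = k) \<and> block t c k \<noteq> [] \<and>
      (\<forall>x. x \<in> set (block t d k) \<longleftrightarrow> x \<in> Vw \<and> slot_of d x = k)" if k: "k \<in> set (path_blocks t)" for k
      using path_block_vertex[OF t k] by metis
    have "\<not> (\<exists>\<kappa>\<in>set (path_blocks t). consec (block t c \<kappa>) x' y')"
    proof
      assume "\<exists>\<kappa>\<in>set (path_blocks t). consec (block t c \<kappa>) x' y'"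
      then obtain k where k: "k \<in> set (path_blocks t)" "consec (block t c k) x' y'" by blast
      then show False using nb[OF k(1)] consec_in_set[OF k(2)] ne by simp
    qed
    then obtain k k' where k: "consec (path_blocks t) k k'" "x' = last (block t c k)" "y' = hd (block t c k')"
      using l unfolding consec_path[OF t] by blast
    have kin: "k \<in> set (path_blocks t)" "k' \<in> set (path_blocks t)" using consec_in_set[OF k(1)] by auto
    have "slot_of c x' = k" "slot_of c y' = k'"
      using nb[OF kin(1)] nb[OF kin(2)] k(2,3) last_in_set[of "block t c k"] hd_in_set[of "block t c k'"] by metis+
    then have "x \<in> set (block t d k)" "y \<in> set (block t d k')"
      using nb[OF kin(1)] nb[OF kin(2)] x y by simp_all
    then have "x = last (block t d k) \<and> y = hd (block t d k')" using junction(2)[OF t k(1)] adj by blast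
    then show ?thesis unfolding consec_new_path[OF t] using k(1) by blast
  qed
  from l show ?thesis
  proof
    assume "consec (Q t) x' y'"
    then show ?thesis using *[OF _ ne x y adj] by blast
  next
    assume "consec (Q t) y' x'"
    then show ?thesis using *[OF _ ne[symmetric] y x] adj word_adj_sym by blast
  qed
qed

text \<open>Required edges are moved forwards and forbidden ones are excluded by moving them
  backwards; images of vertices are identified by their one-element slots. Only pairs within one
  slot need an argument of their own.\<close>

theorem realizes_new: "realizes F (word_adj E w) (new_vertex \<circ> f) new_path"
  and image_new: "image_of F (new_vertex \<circ> f) new_path \<subseteq> Vw"
proof -
  show "image_of F (new_vertex \<circ> f) new_path \<subseteq> Vw"
    unfolding image_of_def using new_vertex_in[OF f_in] new_path_ends(4) by auto
  have back_transfer: "\<exists>x'\<in>Vs. \<exists>y'\<in>Vs. slot_of c x' = slot_of d x \<and> slot_of c y' = slot_of d y \<and> word_adj E s x' y'"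
    if "x \<in> Vw" "y \<in> Vw" "slot_of d x \<noteq> slot_of d y" "word_adj E w x y" for x y
    using matched_cuts.adj_transfer[OF swapped that] .
  have fin: "f a \<in> Vs" "new_vertex (f a) \<in> Vw" "slot_of d (new_vertex (f a)) = slot_of c (f a)" if a: "a \<in> pV F" for a
    using f_in[OF a] new_vertex_in[OF f_in[OF a]] slot_of_new_vertex[OF f_in[OF a]] by auto
  have inn: "\<exists>x'\<in>set (inner (Q t)). x \<in> Vw \<and> slot_of d x = slot_of c x'"
    if "t \<in> pU F" "x \<in> set (inner (new_path t))" for t x
    using that new_path_ends(4) by auto
  have inn2: "x' \<in> set (inner (Q t))" if "t \<in> pU F" "x \<in> set (inner (new_path t))" "x' \<in> Vs" "slot_of c x' = slot_of d x" for t x x'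
    using inn[OF that(1,2)] new_path_ends(5)[OF that(1) _ that(3)] that(4) by auto
  have inn3: "x \<in> set (inner (new_path t))" if "t \<in> pU F" "x' \<in> set (inner (Q t))" "x \<in> Vw" "slot_of d x = slot_of c x'" for t x x'
    using that new_path_ends(4) by auto
  have ne1: "slot_of c (f a) \<noteq> slot_of d x" if "a \<in> pV F" "t \<in> pU F" "x \<in> set (inner (new_path t))" for a t x
    using inn2[OF that(2,3) f_in[OF that(1)]] inner_vertex[OF that(2)] that(1) by auto
  show "realizes F (word_adj E w) (new_vertex \<circ> f) new_path"
    unfolding comp_def
  proof
    show "inj_on (\<lambda>a. new_vertex (f a)) (pV F)"
    proof (rule inj_onI)
      fix a b assume ab: "a \<in> pV F" "b \<in> pV F" "new_vertex (f a) = new_vertex (f b)"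
      then have "slot_of c (f a) = slot_of c (f b)" using fin(3) by metis
      then have "f a = f b" using vertex_slot_unique(1)[OF ab(2) f_in[OF ab(1)]] by simp
      then show "a = b" using inj ab by (auto dest: inj_onD)
    qed
  next
    fix t assume t: "t \<in> pU F"
    show "3 \<le> length (new_path t)" using new_path_ends(3)[OF t] .
    show "distinct (new_path t)"
      unfolding new_path_def
    proof (rule distinct_concat_map)
      fix k k' assume k: "k \<in> set (path_blocks t)" "k' \<in> set (path_blocks t)" "k \<noteq> k'"
      have "\<forall>x. x \<in> set (block t d k) \<longrightarrow> slot_of d x = k" using path_block_vertex[OF t k(1)] by metis
      moreover have "\<forall>x. x \<in> set (block t d k') \<longrightarrow> slot_of d x = k'" using path_block_vertex[OF t k(2)] by metis
      ultimately show "set (block t d k) \<inter> set (block t d k') = {}" using k(3) by blast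
    qed (use distinct_path_blocks[OF t] distinct_block in simp_all)
    show "{hd (new_path t), last (new_path t)} = (\<lambda>a. new_vertex (f a)) ` pPi F t"
    proof -
      have "{hd (new_path t), last (new_path t)} = new_vertex ` {hd (Q t), last (Q t)}"
        using new_path_ends(1,2)[OF t] by simp
      then show ?thesis using ends[OF t] by (simp add: image_image)
    qed
  next
    fix t x assume t: "t \<in> pU F" "x \<in> set (inner (new_path t))"
    show "x \<notin> (\<lambda>a. new_vertex (f a)) ` pV F"
    proof
      assume "x \<in> (\<lambda>a. new_vertex (f a)) ` pV F"
      then obtain a where a: "a \<in> pV F" "x = new_vertex (f a)" by blast
      then show False using ne1[OF a(1) t] fin(3)[OF a(1)] by simp
    qed
  next
    fix t t' x assume t: "t \<in> pU F" "t' \<in> pU F" "x \<in> set (inner (new_path t))" "x \<in> set (inner (new_path t'))"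
    obtain x' where x': "x' \<in> set (inner (Q t))" "slot_of d x = slot_of c x'" using inn[OF t(1,3)] by blast
    then have "x' \<in> set (inner (Q t'))" using inn2[OF t(2,4) inner_in[OF t(1) x'(1)]] by simp
    then show "t = t'" using inner_inner[OF t(1,2) x'(1)] by simp
  next
    fix a b assume ab: "a \<in> pV F" "b \<in> pV F"
    show "word_adj E w (new_vertex (f a)) (new_vertex (f b)) \<longleftrightarrow> {a, b} \<in> pE F"
    proof (cases "a = b")
      \<comment> \<open>The set \<open>E\<close> is arbitrary, so loops must be excluded: a loop at
        a branch vertex would already be one in the source, and positions of words never carry
        loops.\<close>
      case True
      have "\<not> word_adj E s (f a) (f a)" using adj_vertices[OF ab(1,1)] wf_edge by simp
      then have "\<not> word_adj E w (new_vertex (f a)) (new_vertex (f a))"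
      proof (cases "f a")
        case (Inr p)
        obtain u i where "new_vertex (f a) = Inr (u, i)"
          using fin(3)[OF ab(1)] Inr by (cases "new_vertex (f a)"; cases p) auto
        then show ?thesis by simp
      qed (simp add: new_vertex_def)
      then show ?thesis using True wf_edge by simp
    next
      case False
      then have "f a \<noteq> f b" using inj ab by (auto dest: inj_onD)
      then have ne: "slot_of c (f a) \<noteq> slot_of c (f b)" using vertex_slot_unique(1)[OF ab(2) f_in[OF ab(1)]] by blast
      have "word_adj E w (new_vertex (f a)) (new_vertex (f b)) \<longleftrightarrow> word_adj E s (f a) (f b)"
      proof
        assume "word_adj E w (new_vertex (f a)) (new_vertex (f b))"
        then obtain x' y' where "x' \<in> Vs" "y' \<in> Vs" "slot_of c x' = slot_of c (f a)" "slot_of c y' = slot_of c (f b)" "word_adj E s x' y'"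
          using back_transfer[OF fin(2)[OF ab(1)] fin(2)[OF ab(2)]] fin(3)[OF ab(1)] fin(3)[OF ab(2)] ne by auto
        then show "word_adj E s (f a) (f b)" using vertex_slot_unique(1) ab by metis
      next
        assume "word_adj E s (f a) (f b)"
        then obtain x y where "x \<in> Vw" "y \<in> Vw" "slot_of d x = slot_of c (f a)" "slot_of d y = slot_of c (f b)" "word_adj E w x y"
          using adj_transfer[OF fin(1)[OF ab(1)] fin(1)[OF ab(2)] ne] by blast
        then show "word_adj E w (new_vertex (f a)) (new_vertex (f b))" using vertex_slot_unique(2) ab by metis
      qed
      then show ?thesis using adj_vertices[OF ab] by simp
    qed
  next
    fix t x y assume t: "t \<in> pU F" "consec (new_path t) x y"
    from t(2)[unfolded consec_new_path[OF t(1)]] show "word_adj E w x y"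
    proof
      assume "\<exists>\<kappa>\<in>set (path_blocks t). consec (block t d \<kappa>) x y"
      then obtain k where "consec (slot_list d k) x y \<or> consec (slot_list d k) y x"
        by (auto simp: block_def consec_rev split: if_splits)
      then show ?thesis by (cases k) (auto simp: consec_upt consec_Cons simp del: upt_Suc)
    qed (use junction(1)[OF t(1)] in auto)
  next
    fix t x y assume t: "t \<in> pU F" "x \<in> set (inner (new_path t))" "y \<in> set (inner (new_path t))" "word_adj E w x y"
    have xV: "x \<in> Vw" "y \<in> Vw" using inn[OF t(1,2)] inn[OF t(1,3)] by auto
    show "linked (new_path t) x y"
    proof (cases "slot_of d x = slot_of d y")
      case False
      then obtain x' y' where x': "x' \<in> Vs" "y' \<in> Vs" "slot_of c x' = slot_of d x" "slot_of c y' = slot_of d y" "word_adj E s x' y'"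
        using back_transfer[OF xV _ t(4)] by blast
      then have "linked (Q t) x' y'" using adj_inner[OF t(1) inn2[OF t(1,2)] inn2[OF t(1,3)]] by simp
      then show ?thesis using linked_transfer[OF t(1) _ _ xV(1) _ xV(2) _ t(4)] x'(3,4) False by simp
    next
      \<comment> \<open>Adjacent positions inside one slot are consecutive in its list, hence in the
        block, hence on the new path.\<close>
      case True
      obtain x' where x': "x' \<in> set (inner (Q t))" "slot_of d x = slot_of c x'" using inn[OF t(1,2)] by blast
      let ?k = "slot_of c x'"
      have "x' \<in> set (Q t)" using x'(1) set_ends_inner[OF length_path[OF t(1)]] by simp
      then have k: "?k \<in> set (path_blocks t)" using path_blocks(2)[OF t(1)] by simp
      have xs: "x \<in> set (slot_list d ?k)" "y \<in> set (slot_list d ?k)"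
        using set_slot_list_new(1)[OF inner_in[OF t(1) x'(1)]] xV x'(2) True by auto
      have "linked (slot_list d ?k) x y"
      proof (cases ?k)
        case (Inl v)
        then have "slot_list c ?k = [Inl v]" by simp
        moreover have "x' \<in> set (slot_list c ?k)" using set_slot_list[OF inner_in[OF t(1) x'(1)]] inner_in[OF t(1) x'(1)] by simp
        ultimately have "x' = Inl v" by simp
        then have "x = x'" "y = x'" using xs Inl by auto
        moreover have "\<not> word_adj E s x' x'"
        proof
          assume "word_adj E s x' x'"
          then have "linked (Q t) x' x'" using adj_inner[OF t(1) x'(1) x'(1)] by simp
          then show False using consec_distinct[OF distinct_path[OF t(1)]] by blast
        qed
        ultimately show ?thesis using t(4) \<open>x' = Inl v\<close> by simp
      next
        case (Inr p)
        obtain u k0 where "?k = Inr (u, k0)" using Inr by (cases p) auto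
        then show ?thesis using xs t(4) by (auto simp: consec_upt simp del: upt_Suc)
      qed
      then have "linked (block t d ?k) x y" by (auto simp: block_def consec_rev)
      then show ?thesis unfolding consec_new_path[OF t(1)] using k by blast
    qed
  next
    fix a t x assume t: "a \<in> pV F" "t \<in> pU F" "x \<in> set (inner (new_path t))" "word_adj E w (new_vertex (f a)) x"
    have xV: "x \<in> Vw" using inn[OF t(2,3)] by auto
    note ne = ne1[OF t(1-3)]
    obtain y' x' where x': "y' \<in> Vs" "x' \<in> Vs" "slot_of c y' = slot_of c (f a)" "slot_of c x' = slot_of d x" "word_adj E s y' x'"
      using back_transfer[OF fin(2)[OF t(1)] xV _ t(4)] fin(3)[OF t(1)] ne by auto
    have "y' = f a" using vertex_slot_unique(1)[OF t(1) x'(1,3)] .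
    then have "(a, t) \<in> pS F \<or> linked (Q t) (f a) x'"
      using adj_spoke[OF t(1,2) inn2[OF t(2,3) x'(2,4)]] x'(5) by simp
    then show "(a, t) \<in> pS F \<or> linked (new_path t) (new_vertex (f a)) x"
      using linked_transfer[OF t(2) _ _ fin(2,3)[OF t(1)] xV x'(4)[symmetric] t(4)] ne x'(4) by auto
  next
    fix t t' x y
    assume t: "t \<in> pU F" "t' \<in> pU F" "t \<noteq> t'" "x \<in> set (inner (new_path t))" "y \<in> set (inner (new_path t'))" "word_adj E w x y"
    have xV: "x \<in> Vw" "y \<in> Vw" using inn[OF t(1,4)] inn[OF t(2,5)] by auto
    have "slot_of d x \<noteq> slot_of d y"
    proof
      assume "slot_of d x = slot_of d y"
      then obtain x' where x': "x' \<in> set (inner (Q t))" "slot_of c x' = slot_of d y" using inn[OF t(1,4)] by auto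
      then have "x' \<in> set (inner (Q t'))" using inn2[OF t(2,5) inner_in[OF t(1) x'(1)]] by simp
      then show False using inner_inner[OF t(1,2) x'(1)] t(3) by simp
    qed
    then obtain x' y' where "x' \<in> Vs" "y' \<in> Vs" "slot_of c x' = slot_of d x" "slot_of c y' = slot_of d y" "word_adj E s x' y'"
      using back_transfer[OF xV _ t(6)] by blast
    then show "{t, t'} \<in> pR F" using adj_rung[OF t(1-3) inn2[OF t(1,4)] inn2[OF t(2,5)]] by simp
  next
    fix a t assume at: "(a, t) \<in> pS F"
    then have t: "a \<in> pV F" "t \<in> pU F" using wf_spoke by auto
    obtain x' where x': "x' \<in> set (inner (Q t))" "word_adj E s (f a) x'" using spoke[OF at] by blast
    have "x' \<noteq> f a" using inner_vertex[OF t(2) x'(1)] t(1) by blast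
    then have "slot_of c (f a) \<noteq> slot_of c x'" using vertex_slot_unique(1)[OF t(1) inner_in[OF t(2) x'(1)]] by auto
    then obtain y x where "y \<in> Vw" "x \<in> Vw" "slot_of d y = slot_of c (f a)" "slot_of d x = slot_of c x'" "word_adj E w y x"
      using adj_transfer[OF fin(1)[OF t(1)] inner_in[OF t(2) x'(1)] _ x'(2)] by blast
    then show "\<exists>x\<in>set (inner (new_path t)). word_adj E w (new_vertex (f a)) x"
      using vertex_slot_unique(2)[OF t(1)] inn3[OF t(2) x'(1)] by blast
  next
    fix t t' assume t: "t \<in> pU F" "t' \<in> pU F" "{t, t'} \<in> pR F" "t \<noteq> t'"
    obtain x' y' where x': "x' \<in> set (inner (Q t))" "y' \<in> set (inner (Q t'))" "word_adj E s x' y'"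
      using rung[OF t] by blast
    have "slot_of c x' \<noteq> slot_of c y'"
      using new_path_ends(5)[OF t(2) x'(2) inner_in[OF t(1) x'(1)]] inner_inner[OF t(1,2) x'(1)] t(4) by auto
    then obtain x y where "x \<in> Vw" "y \<in> Vw" "slot_of d x = slot_of c x'" "slot_of d y = slot_of c y'" "word_adj E w x y"
      using adj_transfer[OF inner_in[OF t(1) x'(1)] inner_in[OF t(2) x'(2)] _ x'(3)] by blast
    then show "\<exists>x\<in>set (inner (new_path t)). \<exists>y\<in>set (inner (new_path t')). word_adj E w x y"
      using inn3[OF t(1) x'(1)] inn3[OF t(2) x'(2)] by blast
  qed
qed

end

section \<open>Realizations without rungs as words\<close>

lemma card_le_oneI:
  assumes "\<And>x y. x \<in> S \<Longrightarrow> y \<in> S \<Longrightarrow> x = y"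
  shows "finite S \<and> card S \<le> 1"
proof (cases "S = {}")
  case False
  then obtain x where "x \<in> S" by blast
  then have "S = {x}" using assms by blast
  then show ?thesis by simp
qed simp

text \<open>A vertex has at most two neighbours on each path, one on either side. The vertices whose
  path neighbours count are the branch vertices in \<open>V\<close> and the images of vertices of
  \<open>F\<close>.\<close>

lemma card_special:
  fixes F :: "('a, 'z) pathograph_scheme" and V :: "'b set"
  assumes wf: "wf_pathograph F" and rz: "realizes F (word_adj E s) f Q" and im: "image_of F f Q \<subseteq> word_verts V U s"
    and V: "finite V"
  shows "finite {x. special F f Q x} \<and>
    card {x. special F f Q x} \<le> card (pV F) + 2 * card (pU F) * (card V + card (pV F))"
proof -
  interpret realizes F "word_adj E s" f Q by (rule rz)
  have fin: "finite (pV F)" "finite (pU F)" and wfP: "\<And>t. t \<in> pU F \<Longrightarrow> pPi F t \<subseteq> pV F"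
    using wf unfolding wf_pathograph_def two_subset_def by auto
  define Y where "Y = Inl ` V \<union> f ` pV F"
  define N where "N t y = {x. consec (Q t) x y} \<union> {x. consec (Q t) y x}" for t y
  have N: "finite (N t y) \<and> card (N t y) \<le> 2" if t: "t \<in> pU F" for t y
  proof -
    have "finite {x. consec (Q t) x y} \<and> card {x. consec (Q t) x y} \<le> 1"
      by (rule card_le_oneI) (use consec_left_unique[OF distinct_path[OF t]] in blast)
    moreover have "finite {x. consec (Q t) y x} \<and> card {x. consec (Q t) y x} \<le> 1"
      by (rule card_le_oneI) (use consec_right_unique[OF distinct_path[OF t]] in blast)
    ultimately show ?thesis unfolding N_def using card_Un_le[of "{x. consec (Q t) x y}" "{x. consec (Q t) y x}"] by auto
  qed
  have Y: "finite Y" "card Y \<le> card V + card (pV F)"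
  proof -
    show "finite Y" using V fin by (simp add: Y_def)
    show "card Y \<le> card V + card (pV F)"
      unfolding Y_def by (rule order_trans[OF card_Un_le]) (intro add_mono card_image_le V fin)
  qed
  have sub: "{x. special F f Q x} \<subseteq> f ` pV F \<union> (\<Union>t\<in>pU F. \<Union>y\<in>Y. N t y)"
  proof
    fix x assume "x \<in> {x. special F f Q x}"
    then consider "x \<in> f ` pV F" | t y where "t \<in> pU F" "linked (Q t) x y" "y \<in> range Inl \<or> y \<in> f ` pV F"
      unfolding special_def by blast
    then show "x \<in> f ` pV F \<union> (\<Union>t\<in>pU F. \<Union>y\<in>Y. N t y)"
    proof cases
      case 2
      have "y \<in> set (Q t)" using 2(2) consec_in_set by fast
      then have "y \<in> image_of F f Q"
        using set_ends_inner[OF length_path[OF 2(1)]] ends[OF 2(1)] wfP[OF 2(1)] 2(1) by (auto simp: image_of_def)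
      then have "y \<in> Y" using 2(3) im by (auto simp: Y_def word_verts_def)
      then show ?thesis using 2(1,2) by (auto simp: N_def)
    qed simp
  qed
  have "card (\<Union>t\<in>pU F. \<Union>y\<in>Y. N t y) \<le> (\<Sum>t\<in>pU F. card (\<Union>y\<in>Y. N t y))"
    using fin(2) by (rule card_UN_le)
  also have "\<dots> \<le> (\<Sum>t\<in>pU F. 2 * card Y)"
  proof (rule sum_mono)
    fix t assume t: "t \<in> pU F"
    have "card (\<Union>y\<in>Y. N t y) \<le> (\<Sum>y\<in>Y. card (N t y))" using Y(1) by (rule card_UN_le)
    also have "\<dots> \<le> (\<Sum>y\<in>Y. 2)" by (rule sum_mono) (use N[OF t] in blast)
    finally show "card (\<Union>y\<in>Y. N t y) \<le> 2 * card Y" by simp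
  qed
  also have "\<dots> \<le> 2 * card (pU F) * (card V + card (pV F))" using Y(2) by simp
  finally have "card (\<Union>t\<in>pU F. \<Union>y\<in>Y. N t y) \<le> 2 * card (pU F) * (card V + card (pV F))" .
  then have "card (f ` pV F \<union> (\<Union>t\<in>pU F. \<Union>y\<in>Y. N t y)) \<le> card (pV F) + 2 * card (pU F) * (card V + card (pV F))"
    using card_Un_le[of "f ` pV F" "\<Union>t\<in>pU F. \<Union>y\<in>Y. N t y"] card_image_le[OF fin(1), of f] by linarith
  moreover have "finite (f ` pV F \<union> (\<Union>t\<in>pU F. \<Union>y\<in>Y. N t y))" using fin Y(1) N by auto
  ultimately show ?thesis using sub by (meson card_mono finite_subset order_trans)
qed

text \<open>The words \<open>s\<close> are cut around the special positions of the copy, and the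
  inclusion of type sets supplies cuts of \<open>w\<close> with the same types. One inclusion
  suffices because it is used for this single factorization of each \<open>s u\<close>.\<close>

lemma realizes_word_transfer:
  fixes F :: "('a, 'z) pathograph_scheme" and V :: "'b set"
  assumes wf: "wf_pathograph F" and rz: "realizes F (word_adj E s) f Q" and im: "image_of F f Q \<subseteq> word_verts V U s"
    and V: "finite V" and m: "card (pV F) + 2 * card (pU F) * (card V + card (pV F)) \<le> m"
    and ty: "\<And>u. u \<in> U \<Longrightarrow> fact_types (2 * m + 1) (s u) \<subseteq> fact_types (2 * m + 1) (w u)"
  shows "\<exists>f Q. realizes F (word_adj E w) f Q \<and> image_of F f Q \<subseteq> word_verts V U w"
proof -
  define n where "n = 2 * m + 1"
  define P where "P u = {i. i < length (s u) \<and> special F f Q (Inr (u, i))}" for u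
  have P: "finite (P u)" "card (P u) \<le> m" for u
  proof -
    show "finite (P u)" by (simp add: P_def)
    have "card (P u) = card ((\<lambda>i. Inr (u, i) :: 'b wvertex) ` P u)" by (rule card_image[symmetric]) (simp add: inj_on_def)
    also have "\<dots> \<le> card {x. special F f Q x}"
      by (rule card_mono) (use card_special[OF wf rz im V] in \<open>auto simp: P_def\<close>)
    finally show "card (P u) \<le> m" using card_special[OF wf rz im V] m by linarith
  qed
  have "\<exists>c. mono c \<and> c 0 = 0 \<and> c n = length (s u) \<and>
      (\<forall>k<n. c (Suc k) = Suc (c k) \<or> P u \<inter> {c k..<c (Suc k)} = {})" for u
    unfolding n_def by (rule isolating_cuts) (use P in \<open>auto simp: P_def\<close>)
  then obtain c where c: "\<And>u. mono (c u)" "\<And>u. c u 0 = 0" "\<And>u. c u n = length (s u)"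
    "\<And>u k. k < n \<Longrightarrow> c u (Suc k) = Suc (c u k) \<or> P u \<inter> {c u k..<c u (Suc k)} = {}" by metis
  have "\<exists>d. mono d \<and> d 0 = 0 \<and> d n = length (w u) \<and>
      (\<forall>k<n. (min 2 (c u (Suc k) - c u k), \<Union>i\<in>{c u k..<c u (Suc k)}. s u ! i) =
        (min 2 (d (Suc k) - d k), \<Union>i\<in>{d k..<d (Suc k)}. w u ! i))" if u: "u \<in> U" for u
  proof -
    have "map (\<lambda>k. (min 2 (c u (Suc k) - c u k), \<Union>i\<in>{c u k..<c u (Suc k)}. s u ! i)) [0..<n] \<in> fact_types n (w u)"
      using cuts_fact_types[OF c(1,2,3)] ty[OF u] unfolding n_def by blast
    from fact_types_cuts[OF this] show ?thesis by (simp del: prod.inject)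
  qed
  then obtain d where d: "\<And>u. u \<in> U \<Longrightarrow> mono (d u) \<and> d u 0 = 0 \<and> d u n = length (w u) \<and>
      (\<forall>k<n. (min 2 (c u (Suc k) - c u k), \<Union>i\<in>{c u k..<c u (Suc k)}. s u ! i) =
        (min 2 (d u (Suc k) - d u k), \<Union>i\<in>{d u k..<d u (Suc k)}. w u ! i))" by metis
  interpret rz: realizes F "word_adj E s" f Q by (rule rz)
  interpret word_transfer V U E s w n c d F f Q
  proof
    fix u k i assume "u \<in> U" "k < n" "c u k \<le> i" "i < c u (Suc k)" "special F f Q (Inr (u, i))"
    moreover from this have "i < length (s u)" using monoD[OF c(1), of "Suc k" n u] c(3)[of u] by simp
    ultimately show "c u (Suc k) = Suc (c u k)" using c(4)[of k u] by (auto simp: P_def)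
  qed (use c d wf im in auto)
  show ?thesis using realizes_new image_new by blast
qed

text \<open>Letters also record the end edges of the path, so the two endpoints occur in the first and the last letter.\<close>
definition valid_words :: "('a, 'z) pathograph_scheme \<Rightarrow> ('a \<Rightarrow> 'a set list) \<Rightarrow> bool" where
  "valid_words H w \<longleftrightarrow> (\<forall>u\<in>pU H. w u \<in> lists (Pow (pV H)) \<and> w u \<noteq> [] \<and>
     (\<exists>a b. pPi H u = {a, b} \<and> a \<in> w u ! 0 \<and> b \<in> w u ! (length (w u) - 1) \<and>
       (\<forall>i<length (w u). \<forall>v\<in>w u ! i. (v, u) \<in> pS H \<or> i = 0 \<and> v = a \<or> Suc i = length (w u) \<and> v = b)) \<and>
     (\<forall>v. (v, u) \<in> pS H \<longrightarrow> (\<exists>i<length (w u). v \<in> w u ! i)))"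

text \<open>The path of \<open>u\<close> runs through all positions of its word, from the endpoint
  recorded in the first letter to the one recorded in the last.\<close>

lemma realizes_of_valid_words:
  assumes wf: "wf_pathograph H" "pR H = {}" and w: "valid_words H w"
  shows "\<exists>f Q. realizes H (word_adj (pE H) w) f Q \<and> image_of H f Q = word_verts (pV H) (pU H) w"
proof -
  obtain a b where ab: "\<And>u. u \<in> pU H \<Longrightarrow> pPi H u = {a u, b u} \<and> a u \<in> w u ! 0 \<and> b u \<in> w u ! (length (w u) - 1) \<and>
       (\<forall>i<length (w u). \<forall>v\<in>w u ! i. (v, u) \<in> pS H \<or> i = 0 \<and> v = a u \<or> Suc i = length (w u) \<and> v = b u)"
    using w unfolding valid_words_def by metis
  have w1: "w u \<in> lists (Pow (pV H))" "w u \<noteq> []" "\<And>v. (v, u) \<in> pS H \<Longrightarrow> \<exists>i<length (w u). v \<in> w u ! i"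
    if "u \<in> pU H" for u using w that unfolding valid_words_def by blast+
  have wfU: "two_subset (pV H) (pPi H u)" if "u \<in> pU H" for u using wf that unfolding wf_pathograph_def by blast
  have wfS: "v \<in> pV H \<and> u \<in> pU H" if "(v, u) \<in> pS H" for v u using wf that unfolding wf_pathograph_def by blast
  have abV: "a u \<noteq> b u" "a u \<in> pV H" "b u \<in> pV H" if "u \<in> pU H" for u
    using wfU[OF that] ab[OF that] by (auto simp: two_subset_def card_insert_if split: if_splits)
  define I :: "'a \<Rightarrow> 'a wvertex list" where "I u = map (\<lambda>i. Inr (u, i)) [0..<length (w u)]" for u
  define Q where "Q u = Inl (a u) # I u @ [Inl (b u)]" for u
  have inner: "inner (Q u) = I u" for u by (simp add: Q_def butlast_append)
  have setI: "set (I u) = {Inr (u, i) | i. i < length (w u)}" for u by (auto simp: I_def)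
  have Ine: "I u \<noteq> []" if "u \<in> pU H" for u using w1(2)[OF that] by (simp add: I_def)
  have hdI: "hd (I u) = Inr (u, 0)" "last (I u) = Inr (u, length (w u) - 1)" if "u \<in> pU H" for u
    using w1(2)[OF that] by (simp_all add: I_def hd_map last_map)
  have cQ: "consec (Q u) x y \<longleftrightarrow> x = Inl (a u) \<and> y = Inr (u, 0) \<or> x = Inr (u, length (w u) - 1) \<and> y = Inl (b u) \<or>
     (\<exists>j. Suc j < length (w u) \<and> x = Inr (u, j) \<and> y = Inr (u, Suc j))" if u: "u \<in> pU H" for u x y
    using hdI[OF u] Ine[OF u] unfolding Q_def I_def
    by (auto simp: consec_Cons consec_append consec_upt)
  have "realizes H (word_adj (pE H) w) Inl Q"
  proof
    show "inj_on Inl (pV H)" by simp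
  next
    fix t assume t: "t \<in> pU H"
    show "3 \<le> length (Q t)" using Ine[OF t] by (cases "I t") (auto simp: Q_def)
    show "distinct (Q t)" using abV[OF t] by (auto simp: Q_def I_def distinct_map inj_on_def)
    show "{hd (Q t), last (Q t)} = Inl ` pPi H t" using ab[OF t] by (simp add: Q_def)
  next
    fix t x assume "t \<in> pU H" "x \<in> set (inner (Q t))"
    then show "x \<notin> Inl ` pV H" by (auto simp: inner setI)
  next
    fix t t' x assume "x \<in> set (inner (Q t))" "x \<in> set (inner (Q t'))"
    then show "t = t'" by (auto simp: inner setI)
  next
    fix t x y assume t: "t \<in> pU H" "consec (Q t) x y"
    then show "word_adj (pE H) w x y" using ab[OF t(1)] by (auto simp: cQ)
  next
    fix t x y assume t: "t \<in> pU H" "x \<in> set (inner (Q t))" "y \<in> set (inner (Q t))" "word_adj (pE H) w x y"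
    then show "linked (Q t) x y" unfolding cQ[OF t(1)] by (auto simp: inner setI)
  next
    fix v t x assume t: "v \<in> pV H" "t \<in> pU H" "x \<in> set (inner (Q t))" "word_adj (pE H) w (Inl v) x"
    then obtain i where i: "x = Inr (t, i)" "i < length (w t)" "v \<in> w t ! i" by (auto simp: inner setI)
    then consider "(v, t) \<in> pS H" | "i = 0" "v = a t" | "Suc i = length (w t)" "v = b t" using ab[OF t(2)] by blast
    then show "(v, t) \<in> pS H \<or> linked (Q t) (Inl v) x"
    proof cases
      case 3
      then have "i = length (w t) - 1" by simp
      then show ?thesis unfolding cQ[OF t(2)] using i(1) 3(2) by simp
    qed (use i(1) in \<open>auto simp: cQ[OF t(2)]\<close>)
  next
    fix t t' x y
    assume "t \<noteq> t'" "x \<in> set (inner (Q t))" "y \<in> set (inner (Q t'))" "word_adj (pE H) w x y"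
    then show "{t, t'} \<in> pR H" by (auto simp: inner setI)
  next
    fix v t assume vt: "(v, t) \<in> pS H"
    then obtain i where "i < length (w t)" "v \<in> w t ! i" using w1(3) wfS by blast
    then show "\<exists>x\<in>set (inner (Q t)). word_adj (pE H) w (Inl v) x" by (auto simp: inner setI)
  qed (use wf(2) in auto)
  moreover have "image_of H Inl Q = word_verts (pV H) (pU H) w"
    by (auto simp: image_of_def word_verts_def inner setI)
  ultimately show ?thesis by blast
qed

text \<open>Each internal vertex is replaced by the set of its branch neighbours. Nothing is lost:
  without rungs, internal vertices of different paths are not adjacent, and those of one path are
  adjacent only if consecutive.\<close>

lemma valid_words_of_realizes:
  assumes wf: "wf_pathograph H" "pR H = {}" and rz: "realizes H adj f Q"
    and symp: "symp adj"
  shows "\<exists>w h. valid_words H w \<and> inj_on h (word_verts (pV H) (pU H) w) \<and>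
    h ` word_verts (pV H) (pU H) w = image_of H f Q \<and>
    (\<forall>x\<in>word_verts (pV H) (pU H) w. \<forall>y\<in>word_verts (pV H) (pU H) w. adj (h x) (h y) \<longleftrightarrow> word_adj (pE H) w x y)"
proof -
  interpret realizes H adj f Q by (rule rz)
  note sym = sympD[OF symp]
  have wfS: "v \<in> pV H \<and> u \<in> pU H" if "(v, u) \<in> pS H" for v u using wf that unfolding wf_pathograph_def by blast
  have wfP: "pPi H u \<subseteq> pV H" if "u \<in> pU H" for u using wf that unfolding wf_pathograph_def two_subset_def by blast
  define w where "w u = map (\<lambda>x. {v \<in> pV H. adj (f v) x}) (inner (Q u))" for u
  define h where "h = case_sum f (\<lambda>(u, i). inner (Q u) ! i)"
  let ?W = "word_verts (pV H) (pU H) w"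
  have len: "length (w u) = length (inner (Q u))" for u by (simp add: w_def)
  have wnth: "v \<in> w u ! i \<longleftrightarrow> v \<in> pV H \<and> adj (f v) (inner (Q u) ! i)" if "i < length (w u)" for u v i
    using that by (auto simp: w_def)
  \<comment> \<open>The endpoints are given only as a set; here \<open>a\<close> and
    \<open>b\<close> are named in the order in which \<open>Q u\<close> visits them.\<close>
  have split: "\<exists>a b. a \<in> pV H \<and> b \<in> pV H \<and> pPi H u = {a, b} \<and> Q u = f a # inner (Q u) @ [f b] \<and> inner (Q u) \<noteq> []"
    if u: "u \<in> pU H" for u
  proof -
    obtain x y xs where Q: "Q u = x # xs @ [y]" "xs \<noteq> []" "inner (Q u) = xs" "hd (Q u) = x" "last (Q u) = y"
      using list_ends_inner[OF length_path[OF u]] by metis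
    have e: "{x, y} = f ` pPi H u" using ends[OF u] Q by simp
    then obtain a b where ab: "a \<in> pPi H u" "b \<in> pPi H u" "x = f a" "y = f b" by (metis imageE insertCI)
    have "f ` pPi H u = f ` {a, b}" using e ab by simp
    then have "pPi H u = {a, b}"
      using inj_on_image_eq_iff[OF inj wfP[OF u], of "{a, b}"] ab wfP[OF u] by auto
    then show ?thesis using Q ab wfP[OF u] by auto
  qed
  have ilink: "linked (Q u) (inner (Q u) ! i) (inner (Q u) ! j) \<longleftrightarrow> j = Suc i \<or> i = Suc j"
    if u: "u \<in> pU H" and ij: "i < length (inner (Q u))" "j < length (inner (Q u))" for u i j
  proof -
    have dist: "distinct (inner (Q u))" using distinct_path[OF u] by (simp add: distinct_tl distinct_butlast)
    have *: "consec (Q u) (inner (Q u) ! i) (inner (Q u) ! j) \<longleftrightarrow> j = Suc i"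
      if ij: "i < length (inner (Q u))" "j < length (inner (Q u))" for i j
    proof -
      obtain a b where ab: "a \<in> pV H" "b \<in> pV H" "Q u = f a # inner (Q u) @ [f b]" using split[OF u] by blast
      have nf: "inner (Q u) ! i \<noteq> f a" "inner (Q u) ! j \<noteq> f b"
        using inner_vertex[OF u, of "inner (Q u) ! i"] inner_vertex[OF u, of "inner (Q u) ! j"] ij ab by auto
      have "consec (Q u) (inner (Q u) ! i) (inner (Q u) ! j) \<longleftrightarrow> consec (inner (Q u)) (inner (Q u) ! i) (inner (Q u) ! j)"
        by (subst ab(3)) (use nf in \<open>auto simp: consec_Cons consec_append\<close>)
      also have "\<dots> \<longleftrightarrow> j = Suc i"
        unfolding consec_def using nth_eq_iff_index_eq[OF dist] ij
        by (metis Suc_lessD)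
      finally show ?thesis .
    qed
    show ?thesis using *[OF ij] *[OF ij(2,1)] by blast
  qed
  have "valid_words H w"
    unfolding valid_words_def
  proof (intro ballI conjI allI impI)
    fix u assume u: "u \<in> pU H"
    obtain a b where ab: "a \<in> pV H" "b \<in> pV H" "pPi H u = {a, b}" "Q u = f a # inner (Q u) @ [f b]" "inner (Q u) \<noteq> []"
      using split[OF u] by blast
    show "w u \<in> lists (Pow (pV H))" by (auto simp: w_def)
    show "w u \<noteq> []" using ab(5) by (simp add: w_def)
    then have pos: "0 < length (w u)" "length (w u) - 1 < length (w u)" by auto
    have "consec (Q u) (f a) (inner (Q u) ! 0)"
      by (subst ab(4)) (use ab(5) in \<open>auto simp: consec_Cons hd_append hd_conv_nth\<close>)
    then have a0: "a \<in> w u ! 0" using wnth[OF pos(1)] adj_consec[OF u] ab(1) by simp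
    have "consec (Q u) (inner (Q u) ! (length (w u) - 1)) (f b)"
      by (subst ab(4)) (use ab(5) in \<open>auto simp: consec_Cons consec_append last_conv_nth len\<close>)
    then have b0: "b \<in> w u ! (length (w u) - 1)" using wnth[OF pos(2)] sym[OF adj_consec[OF u]] ab(2) by simp
    have "(v, u) \<in> pS H \<or> i = 0 \<and> v = a \<or> Suc i = length (w u) \<and> v = b"
      if i: "i < length (w u)" and v: "v \<in> w u ! i" for i v
    proof -
      let ?x = "inner (Q u) ! i"
      have vV: "v \<in> pV H" "adj (f v) ?x" using v wnth[OF i] by auto
      have xi: "?x \<in> set (inner (Q u))" using i len by simp
      have nx: "f v \<notin> set (inner (Q u))" using inner_vertex[OF u, of "f v"] vV(1) by blast
      have nf: "?x \<noteq> f a" "?x \<noteq> f b" using inner_vertex[OF u xi] ab(1,2) by auto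
      have dist: "distinct (inner (Q u))" using distinct_path[OF u] by (simp add: distinct_tl distinct_butlast)
      from adj_spoke[OF vV(1) u xi vV(2)] show ?thesis
      proof (elim disjE)
        assume "consec (Q u) (f v) ?x"
        then have "consec (f a # inner (Q u) @ [f b]) (f v) ?x" using ab(4) by metis
        then have "f v = f a \<and> ?x = inner (Q u) ! 0"
          using nx nf ab(5) by (auto simp: consec_Cons consec_append hd_append hd_conv_nth dest: consec_in_set)
        then have "v = a" "i = 0"
          using inj_onD[OF inj, of v a] vV(1) ab(1) nth_eq_iff_index_eq[OF dist, of i 0] i len pos by auto
        then show ?thesis by simp
      next
        assume "consec (Q u) ?x (f v)"
        then have "consec (f a # inner (Q u) @ [f b]) ?x (f v)" using ab(4) by metis
        then have "f v = f b \<and> ?x = inner (Q u) ! (length (w u) - 1)"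
          using nx nf ab(5) by (auto simp: consec_Cons consec_append last_conv_nth len dest: consec_in_set)
        then have "v = b" "i = length (w u) - 1"
          using inj_onD[OF inj, of v b] vV(1) ab(2) nth_eq_iff_index_eq[OF dist, of i "length (w u) - 1"] i len pos by auto
        then show ?thesis using pos by auto
      qed simp
    qed
    then show "\<exists>a b. pPi H u = {a, b} \<and> a \<in> w u ! 0 \<and> b \<in> w u ! (length (w u) - 1) \<and>
       (\<forall>i<length (w u). \<forall>v\<in>w u ! i. (v, u) \<in> pS H \<or> i = 0 \<and> v = a \<or> Suc i = length (w u) \<and> v = b)"
      using ab(3) a0 b0 by (intro exI[of _ a] exI[of _ b]) simp
  next
    fix u v assume vu: "(v, u) \<in> pS H"
    obtain x where x: "x \<in> set (inner (Q u))" "adj (f v) x" using spoke[OF vu] by blast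
    then obtain i where "i < length (w u)" "x = inner (Q u) ! i" using len by (metis in_set_conv_nth)
    then show "\<exists>i<length (w u). v \<in> w u ! i" using wnth x(2) wfS[OF vu] by auto
  qed
  moreover have hin: "h (Inr (u, i)) \<in> set (inner (Q u))" if "i < length (w u)" for u i
    using that len by (simp add: h_def)
  have "inj_on h ?W"
  proof (rule inj_onI)
    fix x y assume x: "x \<in> ?W" and y: "y \<in> ?W" and e: "h x = h y"
    have *: False if "Inl v \<in> ?W" "Inr (u, i) \<in> ?W" "h (Inl v) = h (Inr (u, i))" for v u i
    proof -
      have "v \<in> pV H" "u \<in> pU H" "i < length (w u)" using that(1,2) by (auto simp: word_verts_def)
      then have "h (Inr (u, i)) \<notin> f ` pV H" using inner_vertex hin by blast
      moreover have "f v \<in> f ` pV H" using \<open>v \<in> pV H\<close> by simp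
      moreover have "h (Inr (u, i)) = f v" using that(3) by (simp add: h_def)
      ultimately show False by simp
    qed
    show "x = y"
    proof (cases x; cases y)
      fix v v' assume "x = Inl v" "y = Inl v'"
      then show ?thesis using x y e inj by (auto simp: word_verts_def h_def dest: inj_onD)
    next
      fix v p assume "x = Inl v" "y = Inr p"
      then show ?thesis using *[of v "fst p" "snd p"] x y e by simp
    next
      fix v p assume "x = Inr p" "y = Inl v"
      then show ?thesis using *[of v "fst p" "snd p"] x y e by simp
    next
      fix p q assume pq: "x = Inr p" "y = Inr q"
      obtain u i where p: "p = (u, i)" by (cases p)
      obtain u' j where q: "q = (u', j)" by (cases q)
      have u: "u \<in> pU H" "i < length (w u)" "u' \<in> pU H" "j < length (w u')" using x y pq p q by (auto simp: word_verts_def)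
      have uu: "u = u'" using inner_inner[OF u(1,3) hin[OF u(2)]] hin[OF u(4)] e pq p q by simp
      have "distinct (inner (Q u))" using distinct_path[OF u(1)] by (simp add: distinct_tl distinct_butlast)
      then have "i = j" using nth_eq_iff_index_eq[of "inner (Q u)" i j] u len e pq p q uu by (simp add: h_def)
      then show ?thesis using pq p q uu by simp
    qed
  qed
  moreover have "h ` ?W = image_of H f Q"
  proof
    show "h ` ?W \<subseteq> image_of H f Q" using hin by (auto simp: word_verts_def image_of_def h_def)
    show "image_of H f Q \<subseteq> h ` ?W"
    proof
      fix x assume "x \<in> image_of H f Q"
      then consider v where "v \<in> pV H" "x = f v" | u i where "u \<in> pU H" "i < length (w u)" "x = inner (Q u) ! i"
        unfolding image_of_def len by (auto simp: in_set_conv_nth)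
      then show "x \<in> h ` ?W"
      proof cases
        case 1
        then show ?thesis by (intro image_eqI[of _ _ "Inl v"]) (auto simp: h_def word_verts_def)
      next
        case 2
        then show ?thesis by (intro image_eqI[of _ _ "Inr (u, i)"]) (auto simp: h_def word_verts_def)
      qed
    qed
  qed
  moreover have "adj (h x) (h y) \<longleftrightarrow> word_adj (pE H) w x y" if x: "x \<in> ?W" and y: "y \<in> ?W" for x y
  proof -
    have s: "adj x y \<longleftrightarrow> adj y x" for x y using sym by blast
    show ?thesis
    proof (cases x; cases y)
      fix v v' assume "x = Inl v" "y = Inl v'"
      then show ?thesis using x y adj_vertices by (auto simp: word_verts_def h_def)
    next
      fix v p assume xy: "x = Inl v" "y = Inr p"
      obtain u i where p: "p = (u, i)" by (cases p)
      then have "i < length (w u)" "v \<in> pV H" using x y xy by (auto simp: word_verts_def)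
      then show ?thesis using xy p wnth by (simp add: h_def)
    next
      fix v p assume xy: "x = Inr p" "y = Inl v"
      obtain u i where p: "p = (u, i)" by (cases p)
      then have "i < length (w u)" "v \<in> pV H" using x y xy by (auto simp: word_verts_def)
      then show ?thesis using xy p wnth s by (simp add: h_def)
    next
      fix p q assume pq: "x = Inr p" "y = Inr q"
      obtain u i where p: "p = (u, i)" by (cases p)
      obtain u' j where q: "q = (u', j)" by (cases q)
      have u: "u \<in> pU H" "i < length (w u)" "u' \<in> pU H" "j < length (w u')" using x y pq p q by (auto simp: word_verts_def)
      show ?thesis
      proof (cases "u = u'")
        case True
        have "adj (inner (Q u) ! i) (inner (Q u) ! j) \<longleftrightarrow> linked (Q u) (inner (Q u) ! i) (inner (Q u) ! j)"
          using adj_inner[OF u(1), of "inner (Q u) ! i" "inner (Q u) ! j"] adj_consec[OF u(1)] s u(2,4) True len by auto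
        then show ?thesis using ilink[OF u(1), of i j] u True pq p q len by (simp add: h_def)
      next
        case False
        then have "\<not> adj (h x) (h y)" using adj_rung[OF u(1,3) False hin[OF u(2)] hin[OF u(4)]] wf(2) pq p q by auto
        then show ?thesis using False pq p q by simp
      qed
    qed
  qed
  ultimately show ?thesis by blast
qed

section \<open>Small realizations\<close>

text \<open>The union over a one-letter factor is the letter itself, so types do not confuse single
  letters.\<close>

lemma piece_type_single: "piece_type z = piece_type [x] \<longleftrightarrow> z = [x]"
  by (auto simp: piece_type_def min_def length_Suc_conv split: if_splits)

lemma fact_types_match:
  assumes "fact_types (length ys) w' = fact_types (length ys) (concat ys)"
  obtains zs where "concat zs = w'" "list_all2 (\<lambda>y z. piece_type z = piece_type y) ys zs"
proof -
  have "map piece_type ys \<in> fact_types (length ys) (concat ys)" unfolding fact_types_def by blast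
  then have "map piece_type ys \<in> fact_types (length ys) w'" unfolding assms .
  then obtain zs where zs: "map piece_type ys = map piece_type zs" "concat zs = w'"
    unfolding fact_types_def by (elim CollectE exE conjE)
  have "length ys = length zs" using map_eq_imp_length_eq[OF zs(1)] .
  moreover have "piece_type (zs ! i) = piece_type (ys ! i)" if "i < length ys" for i
    using arg_cong[OF zs(1), of "\<lambda>l. l ! i"] that \<open>length ys = length zs\<close> by simp
  ultimately show ?thesis using that[OF zs(2)] by (simp add: list_all2_conv_all_nth)
qed

lemma concat_empty_types:
  "list_all2 (\<lambda>y z. piece_type z = piece_type y) (replicate k []) zs \<Longrightarrow> concat zs = []"
  by (auto simp: list_all2_conv_all_nth in_set_conv_nth piece_type_def min_def split: if_splits)

text \<open>The factorization into first letter, middle and last letter, padded with empty factors,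
  has a counterpart of the same type, and single letters are determined by their types. This is the
  reason for demanding three factors.\<close>

lemma fact_types_first_last:
  assumes ty: "fact_types n w' = fact_types n w" and n: "3 \<le> n" and w: "w = x # mid @ [y]"
  shows "\<exists>mid'. w' = x # mid' @ [y] \<and> \<Union>(set mid') = \<Union>(set mid)"
proof -
  let ?ys = "[x] # mid # [y] # replicate (n - 3) []"
  have "concat ?ys = w" "length ?ys = n" using n w by simp_all
  then obtain zs where zs: "concat zs = w'" "list_all2 (\<lambda>y z. piece_type z = piece_type y) ?ys zs"
    using fact_types_match[of ?ys w'] ty by metis
  from zs(2) obtain z1 z2 z3 rest where z: "zs = z1 # z2 # z3 # rest" "piece_type z1 = piece_type [x]"
    "piece_type z2 = piece_type mid" "piece_type z3 = piece_type [y]"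
    "list_all2 (\<lambda>y z. piece_type z = piece_type y) (replicate (n - 3) []) rest"
    unfolding list_all2_Cons1 by blast
  have "w' = x # z2 @ [y]"
    using zs(1) z(1) concat_empty_types[OF z(5)] z(2,4) unfolding piece_type_single by simp
  moreover have "\<Union>(set z2) = \<Union>(set mid)" using z(3) unfolding piece_type_def prod.inject by blast
  ultimately show ?thesis by blast
qed

lemma fact_types_singleton:
  assumes ty: "fact_types n w' = fact_types n [x]" and n: "1 \<le> n"
  shows "w' = [x]"
proof -
  let ?ys = "[x] # replicate (n - 1) []"
  have "concat ?ys = [x]" "length ?ys = n" using n by simp_all
  then obtain zs where zs: "concat zs = w'" "list_all2 (\<lambda>y z. piece_type z = piece_type y) ?ys zs"
    using fact_types_match[of ?ys w'] ty by metis
  from zs(2) obtain z1 rest where z: "zs = z1 # rest" "piece_type z1 = piece_type [x]"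
    "list_all2 (\<lambda>y z. piece_type z = piece_type y) (replicate (n - 1) []) rest"
    unfolding list_all2_Cons1 by blast
  then show ?thesis
    using zs(1) concat_empty_types[OF z(3)] z(2) unfolding piece_type_single by simp
qed

text \<open>Validity concerns the first letter, the last letter and the union of those in between,
  all of which survive. In a one-letter word both endpoints share the letter; that case is separate,
  and there the whole word is preserved.\<close>

lemma valid_words_same_types:
  assumes w: "valid_words H w" and n: "3 \<le> n"
    and w': "\<And>u. u \<in> pU H \<Longrightarrow> w' u \<in> lists (Pow (pV H)) \<and> fact_types n (w' u) = fact_types n (w u)"
  shows "valid_words H w'"
  unfolding valid_words_def
proof
  fix u assume u: "u \<in> pU H"
  note wu = bspec[OF w[unfolded valid_words_def] u]
  have ty: "fact_types n (w' u) = fact_types n (w u)" using w'[OF u] by simp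
  obtain a b where ab: "pPi H u = {a, b}" "a \<in> w u ! 0" "b \<in> w u ! (length (w u) - 1)"
    "\<forall>i<length (w u). \<forall>v\<in>w u ! i. (v, u) \<in> pS H \<or> i = 0 \<and> v = a \<or> Suc i = length (w u) \<and> v = b"
    and wne: "w u \<noteq> []" and wsp: "\<forall>v. (v, u) \<in> pS H \<longrightarrow> (\<exists>i<length (w u). v \<in> w u ! i)"
    using wu by (elim exE conjE)
  note ab4 = ab(4)[rule_format]
  have sp: "v \<in> \<Union>(set (w u))" if vu: "(v, u) \<in> pS H" for v
  proof -
    obtain i where "i < length (w u)" "v \<in> w u ! i" using wsp vu by blast
    then show ?thesis by (auto intro: nth_mem)
  qed
  show "w' u \<in> lists (Pow (pV H)) \<and> w' u \<noteq> [] \<and>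
     (\<exists>a b. pPi H u = {a, b} \<and> a \<in> w' u ! 0 \<and> b \<in> w' u ! (length (w' u) - 1) \<and>
       (\<forall>i<length (w' u). \<forall>v\<in>w' u ! i. (v, u) \<in> pS H \<or> i = 0 \<and> v = a \<or> Suc i = length (w' u) \<and> v = b)) \<and>
     (\<forall>v. (v, u) \<in> pS H \<longrightarrow> (\<exists>i<length (w' u). v \<in> w' u ! i))"
  proof (cases "length (w u) = 1")
    case True
    then obtain x where "w u = [x]" by (auto simp: length_Suc_conv)
    then have e: "w' u = w u" using fact_types_singleton[of n "w' u" x] ty n by simp
    show ?thesis unfolding e by (rule wu)
  next
    case False
    obtain x ys where ys: "w u = x # ys" using wne by (cases "w u") auto
    then have "ys \<noteq> []" using False by auto
    then obtain mid y where wm: "w u = x # mid @ [y]" using ys by (metis append_butlast_last_id)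
    obtain mid' where wm': "w' u = x # mid' @ [y]" "\<Union>(set mid') = \<Union>(set mid)"
      using fact_types_first_last[OF ty n wm] by blast
    have midS: "(v, u) \<in> pS H" if "v \<in> \<Union>(set mid)" for v
    proof -
      obtain i where i: "i < length mid" "v \<in> mid ! i" using \<open>v \<in> \<Union>(set mid)\<close> by (auto simp: in_set_conv_nth)
      then show ?thesis using ab4[of "Suc i" v] by (simp add: wm nth_append)
    qed
    have xS: "(v, u) \<in> pS H \<or> v = a" if "v \<in> x" for v using ab4[of 0 v] that by (simp add: wm)
    have yS: "(v, u) \<in> pS H \<or> v = b" if "v \<in> y" for v using ab4[of "Suc (length mid)" v] that by (simp add: wm nth_append)
    have "(v, u) \<in> pS H \<or> i = 0 \<and> v = a \<or> Suc i = length (w' u) \<and> v = b"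
      if i: "i < length (w' u)" and v: "v \<in> w' u ! i" for i v
    proof -
      consider "i = 0" | j where "i = Suc j" "j < length mid'" | "i = Suc (length mid')"
        using i unfolding wm' by (cases i) (auto simp: less_Suc_eq)
      then show ?thesis
      proof cases
        case 1
        then show ?thesis using v xS by (auto simp: wm')
      next
        case 2
        then have "v \<in> mid' ! j" using v by (simp add: wm' nth_append)
        then have "v \<in> \<Union>(set mid')" using 2(2) by (auto intro: nth_mem)
        then show ?thesis using midS wm'(2) by simp
      next
        case 3
        then show ?thesis using v yS by (auto simp: wm' nth_append)
      qed
    qed
    moreover have "a \<in> w' u ! 0" "b \<in> w' u ! (length (w' u) - 1)"
      using ab(2,3) by (simp_all add: wm wm' nth_append)
    moreover have "\<exists>i<length (w' u). v \<in> w' u ! i" if vu: "(v, u) \<in> pS H" for v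
    proof -
      have "v \<in> \<Union>(set (w' u))" using sp[OF vu] wm wm' by auto
      then show ?thesis by (auto simp: in_set_conv_nth)
    qed
    moreover have "w' u \<in> lists (Pow (pV H))" "w' u \<noteq> []" using w'[OF u] wm' by auto
    ultimately show ?thesis using ab(1) by (intro conjI exI[of _ a] exI[of _ b] allI impI ballI) assumption+
  qed
qed

text \<open>The graph is \<open>adj\<close> restricted to the image of \<open>H\<close>, so only
  copies inside that image are forbidden. In this form the notion can be moved to another vertex
  type by relabelling the image.\<close>

definition free_realization ::
  "('a, 'z) pathograph_scheme \<Rightarrow> ('c, 'y) pathograph_scheme set \<Rightarrow> ('b \<Rightarrow> 'b \<Rightarrow> bool) \<Rightarrow> ('a \<Rightarrow> 'b) \<Rightarrow> ('a \<Rightarrow> 'b list) \<Rightarrow> bool"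
where
  "free_realization H Fs adj f Q \<longleftrightarrow> realizes H adj f Q \<and>
     (\<forall>F\<in>Fs. \<forall>f' Q'. realizes F adj f' Q' \<longrightarrow> \<not> image_of F f' Q' \<subseteq> image_of H f Q)"

text \<open>A copy of \<open>F\<close> on the new side is pulled back along the inverse of
  \<open>h\<close> on the image.\<close>

lemma free_realization_map:
  assumes wf: "wf_pathograph H" "\<forall>F\<in>Fs. wf_pathograph F"
    and fr: "free_realization H Fs adj f Q" and inj: "inj_on h (image_of H f Q)"
    and adj: "\<And>x y. x \<in> image_of H f Q \<Longrightarrow> y \<in> image_of H f Q \<Longrightarrow> adj' (h x) (h y) \<longleftrightarrow> adj x y"
  shows "free_realization H Fs adj' (h \<circ> f) (map h \<circ> Q)"
    and "image_of H (h \<circ> f) (map h \<circ> Q) = h ` image_of H f Q"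
proof -
  have rz: "realizes H adj f Q" using fr by (simp add: free_realization_def)
  show im: "image_of H (h \<circ> f) (map h \<circ> Q) = h ` image_of H f Q"
    by (rule realizes_cong(2)[OF wf(1) rz inj adj])
  have False if F: "F \<in> Fs" and r: "realizes F adj' f' Q'" and s: "image_of F f' Q' \<subseteq> h ` image_of H f Q" for F f' Q'
  proof -
    let ?g = "inv_into (image_of H f Q) h"
    have gin: "?g x \<in> image_of H f Q" "h (?g x) = x" if "x \<in> image_of F f' Q'" for x
      using that s by (auto intro: inv_into_into f_inv_into_f)
    have wfF: "wf_pathograph F" using wf(2) F by blast
    have gi: "inj_on ?g (image_of F f' Q')" using s by (rule inj_on_inv_into)
    have ga: "adj (?g x) (?g y) \<longleftrightarrow> adj' x y" if "x \<in> image_of F f' Q'" "y \<in> image_of F f' Q'" for x y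
      using adj[OF gin(1)[OF that(1)] gin(1)[OF that(2)]] gin(2) that by simp
    have "realizes F adj (?g \<circ> f') (map ?g \<circ> Q')" by (rule realizes_cong(1)[OF wfF r gi ga])
    moreover have "image_of F (?g \<circ> f') (map ?g \<circ> Q') = ?g ` image_of F f' Q'"
      by (rule realizes_cong(2)[OF wfF r gi ga])
    then have "image_of F (?g \<circ> f') (map ?g \<circ> Q') \<subseteq> image_of H f Q" using gin(1) by auto
    ultimately show False using fr F unfolding free_realization_def by blast
  qed
  moreover have "realizes H adj' (h \<circ> f) (map h \<circ> Q)" by (rule realizes_cong(1)[OF wf(1) rz inj adj])
  ultimately show "free_realization H Fs adj' (h \<circ> f) (map h \<circ> Q)"
    unfolding free_realization_def im by blast
qed

lemma ex_graph_iff_free_realization: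
  assumes wf: "wf_pathograph H" "\<forall>F\<in>Fs. wf_pathograph F"
  shows "(\<exists>G :: 'b graph. is_realization H G \<and> is_free Fs G) \<longleftrightarrow>
    (\<exists>(adj :: 'b \<Rightarrow> 'b \<Rightarrow> bool) f Q. (\<forall>x y. adj x y \<longrightarrow> adj y x \<and> x \<noteq> y) \<and> free_realization H Fs adj f Q)"
proof
  assume "\<exists>G :: 'b graph. is_realization H G \<and> is_free Fs G"
  then obtain W :: "'b set" and D where G: "is_realization H (W, D)" "is_free Fs (W, D)" by auto
  obtain f Q where r: "\<forall>e\<in>D. two_subset W e" "realizes H (\<lambda>x y. {x, y} \<in> D) f Q" "image_of H f Q = W"
    using iffD1[OF is_realization_iff_realizes[OF wf(1)] G(1)] by (elim conjE exE)
  have "free_realization H Fs (\<lambda>x y. {x, y} \<in> D) f Q"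
    unfolding free_realization_def r(3)
  proof (intro conjI ballI allI impI notI)
    fix F f' Q' assume F: "F \<in> Fs" and *: "realizes F (\<lambda>x y. {x, y} \<in> D) f' Q'" "image_of F f' Q' \<subseteq> W"
    then have "contains (W, D) F" using contains_iff_realizes[OF bspec[OF wf(2) F] r(1)] by blast
    then show False using G(2) F unfolding is_free_def by blast
  qed (rule r(2))
  moreover have "\<forall>x y. {x, y} \<in> D \<longrightarrow> {y, x} \<in> D \<and> x \<noteq> y"
    using r(1) by (auto simp: two_subset_def insert_commute)
  ultimately show "\<exists>(adj :: 'b \<Rightarrow> 'b \<Rightarrow> bool) f Q. (\<forall>x y. adj x y \<longrightarrow> adj y x \<and> x \<noteq> y) \<and> free_realization H Fs adj f Q"
    by (intro exI conjI)
next
  assume "\<exists>(adj :: 'b \<Rightarrow> 'b \<Rightarrow> bool) f Q. (\<forall>x y. adj x y \<longrightarrow> adj y x \<and> x \<noteq> y) \<and> free_realization H Fs adj f Q"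
  then obtain adj :: "'b \<Rightarrow> 'b \<Rightarrow> bool" and f Q where
    adj: "\<And>x y. adj x y \<Longrightarrow> adj y x \<and> x \<noteq> y" and fr: "free_realization H Fs adj f Q" by blast
  let ?W = "image_of H f Q"
  define D where "D = {{x, y} | x y. x \<in> ?W \<and> y \<in> ?W \<and> adj x y}"
  have D: "{x, y} \<in> D \<longleftrightarrow> adj x y" if "x \<in> ?W" "y \<in> ?W" for x y
    using that adj by (auto simp: D_def doubleton_eq_iff)
  have D2: "\<forall>e\<in>D. two_subset ?W e"
    using adj by (auto simp: D_def two_subset_def)
  have fr': "free_realization H Fs (\<lambda>x y. {x, y} \<in> D) f Q"
    using free_realization_map(1)[OF wf fr, of id "\<lambda>x y. {x, y} \<in> D"] D by (simp add: comp_def)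
  then have rz: "realizes H (\<lambda>x y. {x, y} \<in> D) f Q" unfolding free_realization_def by blast
  have "is_realization H (?W, D)"
    by (rule iffD2[OF is_realization_iff_realizes[OF wf(1)]]) (intro conjI D2 exI[of _ f] exI[of _ Q] rz refl)
  moreover have "is_free Fs (?W, D)"
    unfolding is_free_def
  proof (intro ballI notI)
    fix F assume F: "F \<in> Fs" "contains (?W, D) F"
    then obtain f' Q' where "realizes F (\<lambda>x y. {x, y} \<in> D) f' Q'" "image_of F f' Q' \<subseteq> ?W"
      using contains_iff_realizes[OF bspec[OF wf(2) F(1)] D2] by blast
    then show False using fr' F(1) unfolding free_realization_def by blast
  qed
  ultimately show "\<exists>G :: 'b graph. is_realization H G \<and> is_free Fs G" by blast
qed

text \<open>At most \<open>c\<close> branch vertices and at most \<open>c\<close> urpaths, each with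
  a short word. The number \<open>c + 2 * c * (c + c)\<close> is the bound of
  \<open>card_special\<close> when all cardinalities are at most \<open>c\<close>; the
  \<open>+ 1\<close> next to it guarantees at least three factors even for
  \<open>c = 0\<close>.\<close>

definition size_bound :: "nat \<Rightarrow> nat" where
  "size_bound c = c + c * short_bound c (2 * (c + 2 * c * (c + c) + 1) + 1)"

text \<open>The given realization is turned into words, the words are shortened, and the result is
  renumbered. Numbering the vertices by an initial segment prepares the coding of the graph by a
  number.\<close>

theorem small_free_realization:
  fixes H :: "('a, 'z) pathograph_scheme" and Fs :: "('c, 'y) pathograph_scheme set"
  assumes wf: "wf_pathograph H" "pR H = {}" "\<forall>F\<in>Fs. wf_pathograph F"
    and c: "card (pV H) \<le> c" "card (pU H) \<le> c" "\<forall>F\<in>Fs. card (pV F) \<le> c \<and> card (pU F) \<le> c"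
    and adj: "symp adj" and fr: "free_realization H Fs adj f Q"
  shows "\<exists>M \<le> size_bound c. \<exists>(adj' :: nat \<Rightarrow> nat \<Rightarrow> bool) f' Q'. (\<forall>x y. adj' x y \<longrightarrow> adj' y x \<and> x \<noteq> y) \<and>
    free_realization H Fs adj' f' Q' \<and> image_of H f' Q' = {..<M}"
proof -
  define m where "m = c + 2 * c * (c + c) + 1"
  define n where "n = 2 * m + 1"
  have fin: "finite (pV H)" "finite (pU H)" using wf(1) unfolding wf_pathograph_def by auto
  have rz: "realizes H adj f Q" using fr unfolding free_realization_def by blast
  obtain w h where w: "valid_words H w" and h: "inj_on h (word_verts (pV H) (pU H) w)"
      "h ` word_verts (pV H) (pU H) w = image_of H f Q"
    and hadj: "\<forall>x\<in>word_verts (pV H) (pU H) w. \<forall>y\<in>word_verts (pV H) (pU H) w.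
        adj (h x) (h y) \<longleftrightarrow> word_adj (pE H) w x y"
    using valid_words_of_realizes[OF wf(1,2) rz adj] by (elim exE conjE)
  have "\<exists>v \<in> lists (Pow (pV H)). length v \<le> short_bound c n \<and> fact_types n v = fact_types n (w u)" if "u \<in> pU H" for u
    using short_word_same_types[OF fin(1) c(1), of "w u" n] w that unfolding valid_words_def by blast
  then obtain s where s: "\<And>u. u \<in> pU H \<Longrightarrow> s u \<in> lists (Pow (pV H)) \<and> fact_types n (s u) = fact_types n (w u)"
    "\<And>u. u \<in> pU H \<Longrightarrow> length (s u) \<le> short_bound c n" by metis
  have "3 \<le> n" by (simp add: n_def m_def)
  then have vs: "valid_words H s" using valid_words_same_types[OF w _ s(1)] by blast
  let ?Vs = "word_verts (pV H) (pU H) s"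
  obtain fs Qs where rs: "realizes H (word_adj (pE H) s) fs Qs" "image_of H fs Qs = ?Vs"
    using realizes_of_valid_words[OF wf(1,2) vs] by blast
  \<comment> \<open>A copy in the short realization is carried to the long words and then by
    \<open>h\<close> into the given realization, where it is forbidden.\<close>
  have frs: "free_realization H Fs (word_adj (pE H) s) fs Qs"
    unfolding free_realization_def rs(2)
  proof (intro conjI ballI allI impI notI rs(1))
    fix F f' Q' assume F: "F \<in> Fs" "realizes F (word_adj (pE H) s) f' Q'" "image_of F f' Q' \<subseteq> ?Vs"
    have wfF: "wf_pathograph F" and cF: "card (pV F) \<le> c" "card (pU F) \<le> c" using wf(3) c(3) F(1) by auto
    have "2 * card (pU F) * (card (pV H) + card (pV F)) \<le> 2 * c * (c + c)"
      using cF c(1) by (intro mult_mono add_mono) simp_all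
    then have "card (pV F) + 2 * card (pU F) * (card (pV H) + card (pV F)) \<le> m" using cF(1) unfolding m_def by simp
    then obtain f1 Q1 where 1: "realizes F (word_adj (pE H) w) f1 Q1" "image_of F f1 Q1 \<subseteq> word_verts (pV H) (pU H) w"
      using realizes_word_transfer[OF wfF F(2,3) fin(1)] s(1) unfolding n_def by blast
    have hi: "inj_on h (image_of F f1 Q1)" using h(1) 1(2) by (rule inj_on_subset)
    have ha: "adj (h x) (h y) \<longleftrightarrow> word_adj (pE H) w x y" if "x \<in> image_of F f1 Q1" "y \<in> image_of F f1 Q1" for x y
      using hadj that 1(2) by blast
    have "realizes F adj (h \<circ> f1) (map h \<circ> Q1)" by (rule realizes_cong(1)[OF wfF 1(1) hi ha])
    moreover have "image_of F (h \<circ> f1) (map h \<circ> Q1) = h ` image_of F f1 Q1"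
      by (rule realizes_cong(2)[OF wfF 1(1) hi ha])
    then have "image_of F (h \<circ> f1) (map h \<circ> Q1) \<subseteq> image_of H f Q" using 1(2) h(2) by blast
    ultimately show False using fr F(1) unfolding free_realization_def by blast
  qed
  have Vs: "?Vs = Inl ` pV H \<union> Inr ` (SIGMA u:pU H. {..<length (s u)})"
    by (auto simp: word_verts_def)
  have finVs: "finite ?Vs" unfolding Vs using fin by simp
  have "card (SIGMA u:pU H. {..<length (s u)}) = (\<Sum>u\<in>pU H. length (s u))" using fin(2) by simp
  also have "\<dots> \<le> (\<Sum>u\<in>pU H. short_bound c n)" using s(2) by (rule sum_mono)
  also have "\<dots> \<le> c * short_bound c n" using c(2) by simp
  finally have cS: "card (SIGMA u:pU H. {..<length (s u)}) \<le> c * short_bound c n" .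
  have "card ?Vs \<le> card (pV H) + card (SIGMA u:pU H. {..<length (s u)})"
    unfolding Vs by (rule order_trans[OF card_Un_le]) (intro add_mono card_image_le fin finite_SigmaI finite_lessThan)
  also have "\<dots> \<le> size_bound c" unfolding size_bound_def using c(1) cS unfolding n_def m_def by (rule add_mono)
  finally have cVs: "card ?Vs \<le> size_bound c" .
  obtain g where "bij_betw g ?Vs {0..<card ?Vs}" using ex_bij_betw_finite_nat[OF finVs] by blast
  then have g: "inj_on g ?Vs" "g ` ?Vs = {..<card ?Vs}" by (auto simp: bij_betw_def)
  define adj' where "adj' x y \<longleftrightarrow> x \<noteq> y \<and> (\<exists>x0\<in>?Vs. \<exists>y0\<in>?Vs. x = g x0 \<and> y = g y0 \<and> word_adj (pE H) s x0 y0)" for x y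
  have irr: "\<not> word_adj (pE H) s x x" for x
    using wf(1) by (cases x) (auto simp: wf_pathograph_def two_subset_def)
  have ga: "adj' (g x) (g y) \<longleftrightarrow> word_adj (pE H) s x y" if "x \<in> ?Vs" "y \<in> ?Vs" for x y
  proof -
    have *: "g x = g x0 \<longleftrightarrow> x = x0" "g y = g x0 \<longleftrightarrow> y = x0" if "x0 \<in> ?Vs" for x0
      using inj_on_eq_iff[OF g(1)] \<open>x \<in> ?Vs\<close> \<open>y \<in> ?Vs\<close> that by auto
    show ?thesis unfolding adj'_def using * that irr by auto
  qed
  have "free_realization H Fs adj' (g \<circ> fs) (map g \<circ> Qs)"
    by (rule free_realization_map(1)[OF wf(1,3) frs]) (use g ga rs(2) in auto)
  moreover have "image_of H (g \<circ> fs) (map g \<circ> Qs) = {..<card ?Vs}"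
    using free_realization_map(2)[OF wf(1,3) frs, of g adj'] g ga rs(2) by simp
  moreover have "\<forall>x y. adj' x y \<longrightarrow> adj' y x \<and> x \<noteq> y"
    unfolding adj'_def using word_adj_sym by blast
  ultimately show ?thesis using cVs by blast
qed

section \<open>Arithmetization\<close>

definition digit :: "nat \<Rightarrow> nat \<Rightarrow> nat \<Rightarrow> nat" where
  "digit b c i = (c div b ^ i) mod b"

lemma rec_fun_digit:
  assumes "rec_fun k x" "rec_fun k y" "rec_fun k z" shows "rec_fun k (\<lambda>e. digit (x e) (y e) (z e))"
  unfolding digit_def by (intro rec_intros assms)

text \<open>The bound \<open>b ^ n\<close> on the code turns the search for a function on
  \<open>{..<n}\<close> into a bounded quantifier.\<close>

lemma ex_digits:
  assumes "\<And>i. i < n \<Longrightarrow> g i < b"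
  shows "\<exists>c<b ^ n. \<forall>i<n. digit b c i = g i"
  using assms
proof (induction n)
  case (Suc n)
  obtain c where c: "c < b ^ n" "\<And>i. i < n \<Longrightarrow> digit b c i = g i" using Suc by (metis less_Suc_eq)
  have b: "b > 0" "g n < b" using Suc.prems[of n] by auto
  define c' where "c' = c + g n * b ^ n"
  have "c' < (g n + 1) * b ^ n" using c(1) by (simp add: c'_def)
  also have "\<dots> \<le> b * b ^ n" using b(2) by (intro mult_right_mono) auto
  finally have "c' < b ^ Suc n" by simp
  moreover have "digit b c' i = g i" if i: "i < Suc n" for i
  proof (cases "i = n")
    case True
    then show ?thesis using c(1) b by (simp add: digit_def c'_def)
  next
    case False
    then obtain j where j: "n = Suc j + i" using i by (metis less_SucE less_imp_Suc_add add.commute add_Suc_right)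
    have "c' = c + (g n * b ^ Suc j) * b ^ i" by (simp add: c'_def j power_add)
    then have "c' div b ^ i = c div b ^ i + g n * b ^ Suc j" using b(1) by simp
    then show ?thesis using c(2)[of i] j by (simp add: digit_def mult.left_commute)
  qed
  ultimately show ?case by blast
qed simp

text \<open>The code of a nonempty list is the successor of the pair formed by the code of its head
  and that of its tail; this inverts one such layer.\<close>

definition code_hd :: "nat \<Rightarrow> nat" where "code_hd c = fst (prod_decode (c - 1))"
definition code_tl :: "nat \<Rightarrow> nat" where "code_tl c = snd (prod_decode (c - 1))"

lemma code_hd_Suc [simp]: "code_hd (Suc (prod_encode (x, y))) = x"
  and code_tl_Suc [simp]: "code_tl (Suc (prod_encode (x, y))) = y"
  by (simp_all add: code_hd_def code_tl_def)

lemma code_hd_le: "code_hd c \<le> c"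
  and code_tl_le: "code_tl c \<le> c"
proof -
  have "fst (prod_decode x) \<le> x" "snd (prod_decode x) \<le> x" for x
    by (metis le_prod_encode_1 le_prod_encode_2 prod.collapse prod_decode_inverse)+
  then show "code_hd c \<le> c" "code_tl c \<le> c"
    unfolding code_hd_def code_tl_def by (meson diff_le_self order_trans)+
qed

lemma rec_fun_code_hd: "rec_fun k a \<Longrightarrow> rec_fun k (\<lambda>e. code_hd (a e))"
  and rec_fun_code_tl: "rec_fun k a \<Longrightarrow> rec_fun k (\<lambda>e. code_tl (a e))"
  unfolding code_hd_def code_tl_def
  by (intro rec_fun_fst_prod_decode rec_fun_snd_prod_decode rec_fun_diff rec_fun_const; assumption)+

text \<open>Gives bounds for quantifiers over coded sets: an element \<open>x\<close> contributes
  \<open>2 ^ x\<close> to the code.\<close>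

lemma set_decode_less: "x \<in> set_decode y \<Longrightarrow> x < y"
proof -
  assume "x \<in> set_decode y"
  then have "y div 2 ^ x \<noteq> 0" by (auto simp: set_decode_def intro: Nat.gr0I)
  then have "2 ^ x \<le> y" by (metis div_less not_le)
  then show "x < y" by (meson less_exp less_le_trans)
qed

text \<open>These sets read the fields of a pathograph code in the order in which
  \<open>encode_pg\<close> lists them.\<close>

definition codeV :: "nat \<Rightarrow> nat set" where "codeV h = set_decode (code_hd h)"
definition codeU :: "nat \<Rightarrow> nat set" where "codeU h = set_decode (code_hd (code_tl h))"
definition codeE :: "nat \<Rightarrow> nat set" where "codeE h = set_decode (code_hd (code_tl (code_tl h)))"
definition codeS :: "nat \<Rightarrow> nat set" where "codeS h = set_decode (code_hd (code_tl (code_tl (code_tl h))))"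
definition codeR :: "nat \<Rightarrow> nat set" where "codeR h = set_decode (code_hd (code_tl (code_tl (code_tl (code_tl h)))))"
definition codeP :: "nat \<Rightarrow> nat set" where
  "codeP h = set_decode (code_hd (code_tl (code_tl (code_tl (code_tl (code_tl h))))))"

lemmas code_defs = codeV_def codeU_def codeE_def codeS_def codeR_def codeP_def

text \<open>Edges, rungs and endpoint pairs enter the code as two-element sets, so membership
  becomes arithmetic. The formula is wrong for \<open>a = b\<close>, hence the guard against
  equality in all later uses.\<close>

lemma set_encode_pair: "a \<noteq> b \<Longrightarrow> set_encode {a, b} = 2 ^ a + 2 ^ b"
  by (simp add: set_encode_def)

lemma set_encode_image_mem:
  assumes "finite A" "\<And>X. X \<in> A \<Longrightarrow> finite X" "finite Y"
  shows "set_encode Y \<in> set_decode (set_encode (set_encode ` A)) \<longleftrightarrow> Y \<in> A"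
proof -
  have "set_encode Y \<in> set_encode ` A \<longleftrightarrow> Y \<in> A"
    using assms(2,3) set_encode_eq by blast
  then show ?thesis using assms(1) by (simp add: set_encode_inverse)
qed

context
  fixes F :: "nat pathograph" and h :: nat
  assumes wf: "wf_pathograph F"
  defines "h \<equiv> encode_pg F"
begin

lemma finite_pg: "finite (pV F)" "finite (pU F)" "finite (pE F)" "finite (pS F)" "finite (pR F)"
proof -
  show fin: "finite (pV F)" "finite (pU F)" using wf by (auto simp: wf_pathograph_def)
  have "pE F \<subseteq> Pow (pV F)" "pR F \<subseteq> Pow (pU F)" "pS F \<subseteq> pV F \<times> pU F"
    using wf by (auto simp: wf_pathograph_def two_subset_def)
  then show "finite (pE F)" "finite (pS F)" "finite (pR F)" using fin by (meson finite_Pow_iff finite_SigmaI finite_subset)+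
qed

lemma codeV_encode: "codeV h = pV F" and codeU_encode: "codeU h = pU F"
  using finite_pg by (simp_all add: code_defs h_def encode_pg_def set_encode_inverse)

lemma codeE_encode: "a \<noteq> b \<Longrightarrow> 2 ^ a + 2 ^ b \<in> codeE h \<longleftrightarrow> {a, b} \<in> pE F"
proof -
  assume "a \<noteq> b"
  moreover have "finite X" if "X \<in> pE F" for X
    using wf that by (auto simp: wf_pathograph_def two_subset_def intro: card_ge_0_finite)
  ultimately show ?thesis
    using set_encode_image_mem[OF finite_pg(3), of "{a, b}"] set_encode_pair[of a b]
    by (simp add: code_defs h_def encode_pg_def)
qed

lemma codeR_encode: "a \<noteq> b \<Longrightarrow> 2 ^ a + 2 ^ b \<in> codeR h \<longleftrightarrow> {a, b} \<in> pR F"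
proof -
  assume "a \<noteq> b"
  moreover have "finite X" if "X \<in> pR F" for X
    using wf that by (auto simp: wf_pathograph_def two_subset_def intro: card_ge_0_finite)
  ultimately show ?thesis
    using set_encode_image_mem[OF finite_pg(5), of "{a, b}"] set_encode_pair[of a b]
    by (simp add: code_defs h_def encode_pg_def)
qed

lemma codeS_encode: "prod_encode (a, t) \<in> codeS h \<longleftrightarrow> (a, t) \<in> pS F"
  using finite_pg(4) by (auto simp: code_defs h_def encode_pg_def set_encode_inverse)

lemma codeP_encode: "t \<in> pU F \<Longrightarrow> a \<noteq> b \<Longrightarrow> prod_encode (t, 2 ^ a + 2 ^ b) \<in> codeP h \<longleftrightarrow> pPi F t = {a, b}"
proof -
  assume t: "t \<in> pU F" and ab: "a \<noteq> b"
  have "finite (pPi F t)"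
    using wf t by (auto simp: wf_pathograph_def two_subset_def intro: card_ge_0_finite)
  then have "set_encode (pPi F t) = 2 ^ a + 2 ^ b \<longleftrightarrow> pPi F t = {a, b}"
    using set_encode_eq[of "pPi F t" "{a, b}"] set_encode_pair[OF ab] by simp
  then show ?thesis using finite_pg(2) t
    by (auto simp: code_defs h_def encode_pg_def set_encode_inverse image_iff)
qed

lemma pV_less_code: "a \<in> pV F \<Longrightarrow> a < h" and pU_less_code: "t \<in> pU F \<Longrightarrow> t < h"
proof -
  show "a \<in> pV F \<Longrightarrow> a < h"
    using set_decode_less[of a "code_hd h"] code_hd_le[of h] codeV_encode by (simp add: codeV_def)
  show "t \<in> pU F \<Longrightarrow> t < h"
    using set_decode_less[of t "code_hd (code_tl h)"] code_hd_le[of "code_tl h"] code_tl_le[of h] codeU_encode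
    by (simp add: codeU_def)
qed

lemma card_pV_le_code: "card (pV F) \<le> h" and card_pU_le_code: "card (pU F) \<le> h"
  using card_mono[of "{..<h}" "pV F"] card_mono[of "{..<h}" "pU F"] pV_less_code pU_less_code by (simp_all add: subset_eq)

end

lemma dec_pred_codes:
  assumes "rec_fun k a" "rec_fun k b"
  shows "dec_pred k (\<lambda>e. a e \<in> codeV (b e))" "dec_pred k (\<lambda>e. a e \<in> codeU (b e))"
    "dec_pred k (\<lambda>e. a e \<in> codeE (b e))" "dec_pred k (\<lambda>e. a e \<in> codeS (b e))"
    "dec_pred k (\<lambda>e. a e \<in> codeR (b e))" "dec_pred k (\<lambda>e. a e \<in> codeP (b e))"
  unfolding code_defs by (intro dec_pred_set_decode rec_fun_code_hd rec_fun_code_tl assms)+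

text \<open>The assumptions of \<open>realizes\<close> with bounded quantifiers only; the code
  \<open>h\<close> exceeds every vertex and urpath and serves as the common bound. A path is a
  length \<open>L t\<close> with entries \<open>q t i\<close>; its inner positions are those with
  \<open>0 < i\<close> and \<open>Suc i < L t\<close>.\<close>

definition idx_realizes ::
  "nat \<Rightarrow> (nat \<Rightarrow> nat \<Rightarrow> bool) \<Rightarrow> (nat \<Rightarrow> nat) \<Rightarrow> (nat \<Rightarrow> nat) \<Rightarrow> (nat \<Rightarrow> nat \<Rightarrow> nat) \<Rightarrow> nat \<Rightarrow> bool" where
  "idx_realizes h adj f L q m \<longleftrightarrow>
     (\<forall>a<h. a \<in> codeV h \<longrightarrow> f a < m) \<and>
     (\<forall>a<h. \<forall>b<h. a \<in> codeV h \<and> b \<in> codeV h \<and> a \<noteq> b \<longrightarrow>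
        f a \<noteq> f b \<and> (adj (f a) (f b) \<longleftrightarrow> 2 ^ a + 2 ^ b \<in> codeE h)) \<and>
     (\<forall>t<h. t \<in> codeU h \<longrightarrow> 3 \<le> L t \<and> (\<forall>i<L t. q t i < m \<and> (\<forall>j<i. q t i \<noteq> q t j)) \<and>
        (\<exists>a<h. \<exists>b<h. a \<in> codeV h \<and> b \<in> codeV h \<and> a \<noteq> b \<and> prod_encode (t, 2 ^ a + 2 ^ b) \<in> codeP h \<and>
           q t 0 = f a \<and> q t (L t - 1) = f b)) \<and>
     (\<forall>t<h. t \<in> codeU h \<longrightarrow> (\<forall>i<L t. 0 < i \<and> Suc i < L t \<longrightarrow> (\<forall>a<h. a \<in> codeV h \<longrightarrow>
        q t i \<noteq> f a \<and> (adj (f a) (q t i) \<longrightarrow>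
          prod_encode (a, t) \<in> codeS h \<or> f a = q t (i - 1) \<or> f a = q t (Suc i))))) \<and>
     (\<forall>t<h. t \<in> codeU h \<longrightarrow> (\<forall>i<L t. Suc i < L t \<longrightarrow> adj (q t i) (q t (Suc i)))) \<and>
     (\<forall>t<h. t \<in> codeU h \<longrightarrow> (\<forall>i<L t. \<forall>j<L t. 0 < i \<and> Suc i < L t \<and> 0 < j \<and> Suc j < L t \<and>
        adj (q t i) (q t j) \<longrightarrow> j = Suc i \<or> i = Suc j)) \<and>
     (\<forall>t<h. \<forall>t'<h. t \<in> codeU h \<and> t' \<in> codeU h \<and> t \<noteq> t' \<longrightarrow> (\<forall>i<L t. \<forall>j<L t'.
        0 < i \<and> Suc i < L t \<and> 0 < j \<and> Suc j < L t' \<longrightarrow>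
        q t i \<noteq> q t' j \<and> (adj (q t i) (q t' j) \<longrightarrow> 2 ^ t + 2 ^ t' \<in> codeR h))) \<and>
     (\<forall>a<h. \<forall>t<h. prod_encode (a, t) \<in> codeS h \<longrightarrow>
        (\<exists>i<L t. 0 < i \<and> Suc i < L t \<and> adj (f a) (q t i))) \<and>
     (\<forall>t<h. \<forall>t'<h. t \<in> codeU h \<and> t' \<in> codeU h \<and> t \<noteq> t' \<and> 2 ^ t + 2 ^ t' \<in> codeR h \<longrightarrow>
        (\<exists>i<L t. \<exists>j<L t'. 0 < i \<and> Suc i < L t \<and> 0 < j \<and> Suc j < L t' \<and> adj (q t i) (q t' j)))"

text \<open>The adjacency matrix on \<open>{..<m}\<close>, stored row by row as bits of
  \<open>d\<close>; thus \<open>2 ^ (m * m)\<close> bounds the matrices to be searched.\<close>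

definition code_adj :: "nat \<Rightarrow> nat \<Rightarrow> nat \<Rightarrow> nat \<Rightarrow> bool" where
  "code_adj m d x y \<longleftrightarrow> x < m \<and> y < m \<and> x * m + y \<in> set_decode d"

text \<open>The functions are read off as base-(m+1) digits; entry i of the path of t is digit t(m+1)+i of qc.\<close>
definition code_realizes :: "nat \<Rightarrow> nat \<Rightarrow> nat \<Rightarrow> nat \<Rightarrow> nat \<Rightarrow> nat \<Rightarrow> bool" where
  "code_realizes h m d fc lc qc \<longleftrightarrow>
     idx_realizes h (code_adj m d) (digit (Suc m) fc) (digit (Suc m) lc) (\<lambda>t i. digit (Suc m) qc (t * Suc m + i)) m"

lemma dec_pred_code_adj:
  assumes "rec_fun k a" "rec_fun k b" "rec_fun k c" "rec_fun k d"
  shows "dec_pred k (\<lambda>e. code_adj (a e) (b e) (c e) (d e))"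
  unfolding code_adj_def by (intro rec_intros dec_pred_set_decode assms)

lemma rec_fun_comp6:
  assumes "rec_fun (Suc (Suc (Suc (Suc (Suc (Suc 0)))))) (\<lambda>e. g (hd e) (hd (tl e)) (hd (tl (tl e)))
      (hd (tl (tl (tl e)))) (hd (tl (tl (tl (tl e))))) (hd (tl (tl (tl (tl (tl e)))))))"
    "rec_fun k a1" "rec_fun k a2" "rec_fun k a3" "rec_fun k a4" "rec_fun k a5" "rec_fun k a6"
  shows "rec_fun k (\<lambda>e. g (a1 e) (a2 e) (a3 e) (a4 e) (a5 e) (a6 e))"
  using rec_fun_comp[of "[a1, a2, a3, a4, a5, a6]" "\<lambda>e. g (hd e) (hd (tl e)) (hd (tl (tl e)))
      (hd (tl (tl (tl e)))) (hd (tl (tl (tl (tl e))))) (hd (tl (tl (tl (tl (tl e))))))" k] assms by simp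

text \<open>Decidability is proved for six bare variables and then substituted, so that the large
  formula is decomposed only once, outside the quantifiers of the search.\<close>

lemma dec_pred_code_realizes:
  assumes "rec_fun k a1" "rec_fun k a2" "rec_fun k a3" "rec_fun k a4" "rec_fun k a5" "rec_fun k a6"
  shows "dec_pred k (\<lambda>e. code_realizes (a1 e) (a2 e) (a3 e) (a4 e) (a5 e) (a6 e))"
  unfolding dec_pred_def
proof (rule rec_fun_comp6[OF _ assms, of "\<lambda>a b c d e f. of_bool (code_realizes a b c d e f)"])
  show "rec_fun (Suc (Suc (Suc (Suc (Suc (Suc 0)))))) (\<lambda>e. of_bool (code_realizes (hd e) (hd (tl e)) (hd (tl (tl e)))
      (hd (tl (tl (tl e)))) (hd (tl (tl (tl (tl e))))) (hd (tl (tl (tl (tl (tl e))))))))"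
    unfolding dec_pred_def[symmetric] code_realizes_def idx_realizes_def
    by (intro rec_intros dec_pred_codes dec_pred_code_adj rec_fun_digit rec_fun_prod_encode)
qed

lemma idx_path:
  fixes q :: "nat \<Rightarrow> 'b"
  shows "set (inner (map q [0..<l])) = {q i | i. 0 < i \<and> Suc i < l}"
    and "consec (map q [0..<l]) x y \<longleftrightarrow> (\<exists>i. Suc i < l \<and> x = q i \<and> y = q (Suc i))"
    and "distinct (map q [0..<l]) \<longleftrightarrow> (\<forall>i<l. \<forall>j<i. q i \<noteq> q j)"
    and "3 \<le> l \<Longrightarrow> hd (map q [0..<l]) = q 0" "3 \<le> l \<Longrightarrow> last (map q [0..<l]) = q (l - 1)"
proof -
  have "inner (map q [0..<l]) = map q [Suc 0..<l - 1]"
    by (cases l) (simp_all add: map_butlast[symmetric] map_tl[symmetric] tl_upt)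
  moreover have "{Suc 0..<l - 1} = {i. 0 < i \<and> Suc i < l}" by auto
  ultimately show "set (inner (map q [0..<l])) = {q i | i. 0 < i \<and> Suc i < l}" by (simp add: image_Collect)
  show "consec (map q [0..<l]) x y \<longleftrightarrow> (\<exists>i. Suc i < l \<and> x = q i \<and> y = q (Suc i))"
    by (simp add: consec_upt)
  show "distinct (map q [0..<l]) \<longleftrightarrow> (\<forall>i<l. \<forall>j<i. q i \<noteq> q j)"
  proof -
    have "(\<forall>x<l. \<forall>y<l. q x = q y \<longrightarrow> x = y) \<longleftrightarrow> (\<forall>i<l. \<forall>j<i. q i \<noteq> q j)"
      by (metis less_irrefl_nat less_trans linorder_neqE_nat)
    then show ?thesis unfolding distinct_map inj_on_def by auto
  qed
  show "3 \<le> l \<Longrightarrow> hd (map q [0..<l]) = q 0" "3 \<le> l \<Longrightarrow> last (map q [0..<l]) = q (l - 1)"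
    by (auto simp: hd_map last_map)
qed

lemma idx_linked:
  assumes dist: "\<forall>i<l. \<forall>j<i. q i \<noteq> q j" and i: "0 < i" "Suc i < l"
  shows "linked (map q [0..<l]) x (q i) \<longleftrightarrow> x = q (i - 1) \<or> x = q (Suc i)"
proof -
  have inj: "q a = q b \<longleftrightarrow> a = b" if "a < l" "b < l" for a b
    using dist that by (metis linorder_neqE_nat)
  have "consec (map q [0..<l]) x (q i) \<longleftrightarrow> x = q (i - 1)"
    unfolding idx_path(2) using inj[of i] i by (metis Suc_lessD Suc_pred' diff_Suc_1)
  moreover have "consec (map q [0..<l]) (q i) x \<longleftrightarrow> x = q (Suc i)"
    unfolding idx_path(2) using inj[of i] i by (metis Suc_lessD)
  ultimately show ?thesis by simp
qed

text \<open>The numerical form speaks of distinct vertices only; irreflexivity of \<open>adj\<close>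
  supplies the remaining case. It bounds all path entries rather than the inner ones, which agrees
  because the ends are images of vertices.\<close>

lemma idx_realizes_iff:
  fixes f :: "nat \<Rightarrow> nat" and L :: "nat \<Rightarrow> nat" and q :: "nat \<Rightarrow> nat \<Rightarrow> nat"
  assumes wf: "wf_pathograph F" and irr: "\<And>x. \<not> adj x x"
  defines "Q \<equiv> \<lambda>t. map (q t) [0..<L t]"
  shows "idx_realizes (encode_pg F) adj f L q m \<longleftrightarrow> realizes F adj f Q \<and> image_of F f Q \<subseteq> {..<m}"
proof -
  let ?h = "encode_pg F"
  note enc = codeV_encode[OF wf] codeU_encode[OF wf]
  have wfS: "a \<in> pV F \<and> t \<in> pU F" if "(a, t) \<in> pS F" for a t using wf that by (auto simp: wf_pathograph_def)
  have wfE: "{a} \<notin> pE F" for a using wf by (auto simp: wf_pathograph_def two_subset_def)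
  have inner: "set (inner (Q t)) = {q t i | i. 0 < i \<and> Suc i < L t}" for t unfolding Q_def by (rule idx_path)
  have consec: "consec (Q t) x y \<longleftrightarrow> (\<exists>i. Suc i < L t \<and> x = q t i \<and> y = q t (Suc i))" for t x y
    unfolding Q_def by (rule idx_path)
  have dist: "distinct (Q t) \<longleftrightarrow> (\<forall>i<L t. \<forall>j<i. q t i \<noteq> q t j)" for t unfolding Q_def by (rule idx_path)
  have len: "length (Q t) = L t" for t by (simp add: Q_def)
  have hdl: "hd (Q t) = q t 0" "last (Q t) = q t (L t - 1)" if "3 \<le> L t" for t
    unfolding Q_def using that by (rule idx_path)+
  show ?thesis
  proof
    assume "idx_realizes ?h adj f L q m"
    then show "realizes F adj f Q \<and> image_of F f Q \<subseteq> {..<m}"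
      unfolding idx_realizes_def enc
    proof (elim conjE, goal_cases)
      case 1
      note A = 1
      have a1: "f a < m" if "a \<in> pV F" for a using A(1) that pV_less_code[OF wf] by blast
      have a2: "f a \<noteq> f b" "adj (f a) (f b) \<longleftrightarrow> {a, b} \<in> pE F" if "a \<in> pV F" "b \<in> pV F" "a \<noteq> b" for a b
        using A(2) that pV_less_code[OF wf] codeE_encode[OF wf that(3)] by blast+
      have a3: "3 \<le> L t" "\<And>i. i < L t \<Longrightarrow> q t i < m" "\<forall>i<L t. \<forall>j<i. q t i \<noteq> q t j"
        if "t \<in> pU F" for t using A(3) that pU_less_code[OF wf] by blast+
      have a3': "\<exists>a b. pPi F t = {a, b} \<and> q t 0 = f a \<and> q t (L t - 1) = f b" if t: "t \<in> pU F" for t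
      proof -
        obtain a b where "a \<noteq> b" "prod_encode (t, 2 ^ a + 2 ^ b) \<in> codeP ?h" "q t 0 = f a" "q t (L t - 1) = f b"
          using A(3) t pU_less_code[OF wf t] by blast
        then show ?thesis using codeP_encode[OF wf t] by blast
      qed
      have a4: "q t i \<noteq> f a" "adj (f a) (q t i) \<Longrightarrow> (a, t) \<in> pS F \<or> f a = q t (i - 1) \<or> f a = q t (Suc i)"
        if "t \<in> pU F" "0 < i" "Suc i < L t" "a \<in> pV F" for t i a
        using A(4) that pU_less_code[OF wf that(1)] pV_less_code[OF wf that(4)] codeS_encode[OF wf] Suc_lessD by blast+
      have a5: "adj (q t i) (q t (Suc i))" if "t \<in> pU F" "Suc i < L t" for t i
        using A(5) that pU_less_code[OF wf that(1)] Suc_lessD by blast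
      have a6: "j = Suc i \<or> i = Suc j" if "t \<in> pU F" "0 < i" "Suc i < L t" "0 < j" "Suc j < L t" "adj (q t i) (q t j)" for t i j
        using A(6) that pU_less_code[OF wf that(1)] Suc_lessD by blast
      have a7: "q t i \<noteq> q t' j" "adj (q t i) (q t' j) \<Longrightarrow> {t, t'} \<in> pR F"
        if "t \<in> pU F" "t' \<in> pU F" "t \<noteq> t'" "0 < i" "Suc i < L t" "0 < j" "Suc j < L t'" for t t' i j
        using A(7) that pU_less_code[OF wf that(1)] pU_less_code[OF wf that(2)] Suc_lessD codeR_encode[OF wf that(3)] by blast+
      have a8: "\<exists>i. 0 < i \<and> Suc i < L t \<and> adj (f a) (q t i)" if "(a, t) \<in> pS F" for a t
        using A(8) that codeS_encode[OF wf] wfS[OF that] pU_less_code[OF wf] pV_less_code[OF wf] by blast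
      have a9: "\<exists>i j. 0 < i \<and> Suc i < L t \<and> 0 < j \<and> Suc j < L t' \<and> adj (q t i) (q t' j)"
        if "t \<in> pU F" "t' \<in> pU F" "t \<noteq> t'" "{t, t'} \<in> pR F" for t t'
        using A(9) that pU_less_code[OF wf that(1)] pU_less_code[OF wf that(2)] codeR_encode[OF wf that(3)] by blast
      have "realizes F adj f Q"
      proof
        show "inj_on f (pV F)" using a2(1) by (auto simp: inj_on_def)
      next
        fix t assume t: "t \<in> pU F"
        show "3 \<le> length (Q t)" "distinct (Q t)" using a3[OF t] len dist by auto
        show "{hd (Q t), last (Q t)} = f ` pPi F t" using a3'[OF t] hdl[OF a3(1)[OF t]] by auto
      next
        fix t x assume t: "t \<in> pU F" "x \<in> set (inner (Q t))"
        then show "x \<notin> f ` pV F" using a4(1)[OF t(1)] by (auto simp: inner)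
      next
        fix t t' x assume t: "t \<in> pU F" "t' \<in> pU F" "x \<in> set (inner (Q t))" "x \<in> set (inner (Q t'))"
        then show "t = t'" using a7(1)[OF t(1,2)] unfolding inner by blast
      next
        fix a b assume "a \<in> pV F" "b \<in> pV F"
        then show "adj (f a) (f b) \<longleftrightarrow> {a, b} \<in> pE F" using a2(2) irr wfE by (cases "a = b") auto
      next
        fix t x y assume "t \<in> pU F" "consec (Q t) x y"
        then show "adj x y" using a5 consec by auto
      next
        fix t x y assume t: "t \<in> pU F" "x \<in> set (inner (Q t))" "y \<in> set (inner (Q t))" "adj x y"
        then obtain i j where "0 < i" "Suc i < L t" "x = q t i" "0 < j" "Suc j < L t" "y = q t j"
          unfolding inner by blast
        then show "linked (Q t) x y" using a6[OF t(1), of i j] t(4) unfolding consec by (metis Suc_lessD)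
      next
        fix a t x assume t: "a \<in> pV F" "t \<in> pU F" "x \<in> set (inner (Q t))" "adj (f a) x"
        then obtain i where i: "0 < i" "Suc i < L t" "x = q t i" unfolding inner by blast
        then show "(a, t) \<in> pS F \<or> linked (Q t) (f a) x"
          using a4(2)[OF t(2) i(1,2) t(1)] t(4) idx_linked[OF a3(3)[OF t(2)] i(1,2)] unfolding Q_def by metis
      next
        fix t t' x y
        assume t: "t \<in> pU F" "t' \<in> pU F" "t \<noteq> t'" "x \<in> set (inner (Q t))" "y \<in> set (inner (Q t'))" "adj x y"
        then show "{t, t'} \<in> pR F" using a7(2)[OF t(1-3)] unfolding inner by blast
      next
        fix a t assume "(a, t) \<in> pS F"
        then show "\<exists>x\<in>set (inner (Q t)). adj (f a) x" using a8 unfolding inner by blast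
      next
        fix t t' assume t: "t \<in> pU F" "t' \<in> pU F" "{t, t'} \<in> pR F" "t \<noteq> t'"
        show "\<exists>x\<in>set (inner (Q t)). \<exists>y\<in>set (inner (Q t')). adj x y"
          using a9[OF t(1,2,4,3)] unfolding inner by blast
      qed
      moreover have "image_of F f Q \<subseteq> {..<m}" using a1 a3(2) by (auto simp: image_of_def inner)
      ultimately show ?case by blast
    qed
  next
    assume rz: "realizes F adj f Q \<and> image_of F f Q \<subseteq> {..<m}"
    then interpret realizes F adj f Q by blast
    have im: "\<And>a. a \<in> pV F \<Longrightarrow> f a < m" "\<And>t x. t \<in> pU F \<Longrightarrow> x \<in> set (inner (Q t)) \<Longrightarrow> x < m"
      using rz by (auto simp: image_of_def)
    have L: "3 \<le> L t" if "t \<in> pU F" for t using length_path[OF that] len by simp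
    have D: "\<forall>i<L t. \<forall>j<i. q t i \<noteq> q t j" if "t \<in> pU F" for t using distinct_path[OF that] dist by simp
    have ab: "\<exists>a\<in>pV F. \<exists>b\<in>pV F. a \<noteq> b \<and> pPi F t = {a, b} \<and> q t 0 = f a \<and> q t (L t - 1) = f b" if t: "t \<in> pU F" for t
    proof -
      have two: "two_subset (pV F) (pPi F t)" using wf t by (auto simp: wf_pathograph_def)
      have e: "{q t 0, q t (L t - 1)} = f ` pPi F t" using ends[OF t] hdl[OF L[OF t]] by simp
      then obtain a b where ab: "a \<in> pPi F t" "b \<in> pPi F t" "q t 0 = f a" "q t (L t - 1) = f b"
        by (metis imageE insertCI)
      have "q t 0 \<noteq> q t (L t - 1)" using D[OF t] L[OF t] by (metis diff_less less_le_trans zero_less_diff zero_less_numeral numeral_3_eq_3 not_less_eq_eq One_nat_def Suc_le_eq zero_less_Suc diff_is_0_eq)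
      then have "a \<noteq> b" using ab by auto
      moreover have "pPi F t = {a, b}"
        using two ab(1,2) \<open>a \<noteq> b\<close> unfolding two_subset_def card_2_iff by auto
      ultimately show ?thesis using ab two by (auto simp: two_subset_def)
    qed
    have Qm: "q t i < m" if t: "t \<in> pU F" and i: "i < L t" for t i
    proof -
      obtain a b where "a \<in> pV F" "b \<in> pV F" "q t 0 = f a" "q t (L t - 1) = f b" using ab[OF t] by blast
      moreover have "i = 0 \<or> i = L t - 1 \<or> q t i \<in> set (inner (Q t))" using i unfolding inner by force
      ultimately show ?thesis using im(1) im(2)[OF t] by metis
    qed
    have inI: "q t i \<in> set (inner (Q t))" if "0 < i" "Suc i < L t" for t i using that unfolding inner by blast
    show "idx_realizes ?h adj f L q m"
      unfolding idx_realizes_def enc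
    proof (intro conjI allI impI; (elim conjE)?)
      fix t i a assume t: "t < ?h" "t \<in> pU F" "i < L t" "0 < i" "Suc i < L t" "a < ?h" "a \<in> pV F"
      show "q t i \<noteq> f a" using inner_vertex[OF t(2) inI[OF t(4,5)]] t(7) by blast
      assume "adj (f a) (q t i)"
      then have "(a, t) \<in> pS F \<or> linked (Q t) (f a) (q t i)" using adj_spoke[OF t(7,2) inI[OF t(4,5)]] by blast
      then show "prod_encode (a, t) \<in> codeS ?h \<or> f a = q t (i - 1) \<or> f a = q t (Suc i)"
        using idx_linked[OF D[OF t(2)] t(4,5), of "f a"] codeS_encode[OF wf] unfolding Q_def by blast
    next
      fix t i j assume t: "t < ?h" "t \<in> pU F" "i < L t" "j < L t" "0 < i" "Suc i < L t" "0 < j" "Suc j < L t" "adj (q t i) (q t j)"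
      have "linked (Q t) (q t i) (q t j)" using adj_inner[OF t(2) inI[OF t(5,6)] inI[OF t(7,8)] t(9)] .
      then have "q t i = q t (j - 1) \<or> q t i = q t (Suc j)" using idx_linked[OF D[OF t(2)] t(7,8)] unfolding Q_def by blast
      then have "i = j - 1 \<or> i = Suc j" using D[OF t(2)] t(3-8) by (metis linorder_neqE_nat less_imp_diff_less)
      then show "j = Suc i \<or> i = Suc j" using t(7) by auto
    next
      fix t t' i j assume t: "t < ?h" "t' < ?h" "t \<in> pU F" "t' \<in> pU F" "t \<noteq> t'" "0 < i" "Suc i < L t" "0 < j" "Suc j < L t'"
      show "q t i \<noteq> q t' j" using inner_inner[OF t(3,4) inI[OF t(6,7)]] inI[OF t(8,9)] t(5) by metis
      assume "adj (q t i) (q t' j)"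
      then show "2 ^ t + 2 ^ t' \<in> codeR ?h"
        using adj_rung[OF t(3-5) inI[OF t(6,7)] inI[OF t(8,9)]] codeR_encode[OF wf t(5)] by blast
    next
      fix a t assume "prod_encode (a, t) \<in> codeS ?h"
      then obtain x where "x \<in> set (inner (Q t))" "adj (f a) x" using spoke codeS_encode[OF wf] by blast
      then show "\<exists>i<L t. 0 < i \<and> Suc i < L t \<and> adj (f a) (q t i)" unfolding inner using Suc_lessD by blast
    next
      fix t t' assume t: "t \<in> pU F" "t' \<in> pU F" "t \<noteq> t'" "2 ^ t + 2 ^ t' \<in> codeR ?h"
      then obtain x y where "x \<in> set (inner (Q t))" "y \<in> set (inner (Q t'))" "adj x y"
        using rung[OF t(1,2) _ t(3)] codeR_encode[OF wf t(3)] by blast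
      then obtain i j where "0 < i" "Suc i < L t" "0 < j" "Suc j < L t'" "adj (q t i) (q t' j)"
        unfolding inner by blast
      then show "\<exists>i<L t. \<exists>j<L t'. 0 < i \<and> Suc i < L t \<and> 0 < j \<and> Suc j < L t' \<and> adj (q t i) (q t' j)"
        by (meson Suc_lessD)
    next
      fix t assume t: "t \<in> pU F"
      obtain a b where ab: "a \<in> pV F" "b \<in> pV F" "a \<noteq> b" "pPi F t = {a, b}" "q t 0 = f a" "q t (L t - 1) = f b"
        using ab[OF t] by blast
      show "\<exists>a<?h. \<exists>b<?h. a \<in> pV F \<and> b \<in> pV F \<and> a \<noteq> b \<and> prod_encode (t, 2 ^ a + 2 ^ b) \<in> codeP ?h \<and>
           q t 0 = f a \<and> q t (L t - 1) = f b"
        using ab codeP_encode[OF wf t ab(3)] pV_less_code[OF wf] by blast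
    next
      fix a b assume ab: "a \<in> pV F" "b \<in> pV F" "a \<noteq> b"
      show "f a \<noteq> f b" using inj_onD[OF inj] ab by blast
      show "adj (f a) (f b) \<longleftrightarrow> 2 ^ a + 2 ^ b \<in> codeE ?h"
        using adj_vertices[OF ab(1,2)] codeE_encode[OF wf ab(3)] by simp
    next
      fix t i assume "t \<in> pU F" "Suc i < L t"
      then show "adj (q t i) (q t (Suc i))" using adj_consec consec by blast
    qed (use im(1) L Qm D in blast)+
  qed
qed

text \<open>Decoded functions agree with the intended ones only on the vertices and urpaths of
  \<open>F\<close>, and a realization depends on nothing else.\<close>

lemma realizes_ext:
  assumes wf: "wf_pathograph F" and rz: "realizes F adj f Q"
    and f: "\<And>a. a \<in> pV F \<Longrightarrow> f' a = f a" and Q: "\<And>t. t \<in> pU F \<Longrightarrow> Q' t = Q t"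
  shows "realizes F adj f' Q'" "image_of F f' Q' = image_of F f Q"
proof -
  interpret realizes F adj f Q by (rule rz)
  have wfS: "a \<in> pV F" "t \<in> pU F" if "(a, t) \<in> pS F" for a t using wf that by (auto simp: wf_pathograph_def)
  have wfP: "pPi F t \<subseteq> pV F" if "t \<in> pU F" for t using wf that by (auto simp: wf_pathograph_def two_subset_def)
  have fV: "f' ` pV F = f ` pV F" using f by (rule image_cong[OF refl])
  have fP: "f' ` pPi F t = f ` pPi F t" if "t \<in> pU F" for t
    by (rule image_cong[OF refl]) (use f wfP[OF that] in blast)
  show "image_of F f' Q' = image_of F f Q" unfolding image_of_def fV using Q by simp
  show "realizes F adj f' Q'"
  proof
    show "inj_on f' (pV F)" using inj f by (simp cong: inj_on_cong)
    show "(a, t) \<in> pS F \<Longrightarrow> \<exists>x\<in>set (inner (Q' t)). adj (f' a) x" for a t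
      using spoke[of a t] wfS[of a t] f Q by simp
    show "t \<in> pU F \<Longrightarrow> t' \<in> pU F \<Longrightarrow> {t, t'} \<in> pR F \<Longrightarrow> t \<noteq> t' \<Longrightarrow>
      \<exists>x\<in>set (inner (Q' t)). \<exists>y\<in>set (inner (Q' t')). adj x y" for t t'
      using rung[of t t'] Q by simp
    show "t \<in> pU F \<Longrightarrow> t' \<in> pU F \<Longrightarrow> t \<noteq> t' \<Longrightarrow> x \<in> set (inner (Q' t)) \<Longrightarrow> y \<in> set (inner (Q' t')) \<Longrightarrow>
      adj x y \<Longrightarrow> {t, t'} \<in> pR F" for t t' x y
      using adj_rung[of t t' x y] Q by simp
    show "t \<in> pU F \<Longrightarrow> t' \<in> pU F \<Longrightarrow> x \<in> set (inner (Q' t)) \<Longrightarrow> x \<in> set (inner (Q' t')) \<Longrightarrow> t = t'" for t t' x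
      using inner_inner[of t t' x] Q by simp
  qed (simp_all add: f Q fV fP length_path distinct_path ends inner_vertex adj_vertices adj_consec adj_inner adj_spoke)
qed

lemma realizes_path_in_image:
  assumes wf: "wf_pathograph F" and rz: "realizes F adj f Q" and t: "t \<in> pU F" and x: "x \<in> set (Q t)"
  shows "x \<in> image_of F f Q"
proof -
  interpret realizes F adj f Q by (rule rz)
  have "pPi F t \<subseteq> pV F" using wf t by (auto simp: wf_pathograph_def two_subset_def)
  then show ?thesis using x set_ends_inner[OF length_path[OF t]] ends[OF t] t by (auto simp: image_of_def)
qed

text \<open>Values lie below \<open>m\<close>, and a path without repetitions in
  \<open>{..<m}\<close> has length at most \<open>m\<close>, so base \<open>Suc m\<close> fits both.
  Each path has a row of \<open>Suc m\<close> digits, which explains the exponent of the third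
  bound.\<close>

lemma ex_codes:
  assumes wf: "wf_pathograph F" and rz: "realizes F adj f Q" and im: "image_of F f Q \<subseteq> {..<m}"
  shows "\<exists>fc<Suc m ^ encode_pg F. \<exists>lc<Suc m ^ encode_pg F. \<exists>qc<Suc m ^ (encode_pg F * Suc m).
    (\<forall>a\<in>pV F. digit (Suc m) fc a = f a) \<and>
    (\<forall>t\<in>pU F. map (\<lambda>i. digit (Suc m) qc (t * Suc m + i)) [0..<digit (Suc m) lc t] = Q t)"
proof -
  interpret realizes F adj f Q by (rule rz)
  let ?h = "encode_pg F"
  have Qm: "set (Q t) \<subseteq> {..<m}" if "t \<in> pU F" for t using realizes_path_in_image[OF wf rz that] im by blast
  have Lm: "length (Q t) \<le> m" if "t \<in> pU F" for t
    using card_mono[OF _ Qm[OF that]] distinct_card[OF distinct_path[OF that]] by simp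
  have "\<exists>c<Suc m ^ ?h. \<forall>i<?h. digit (Suc m) c i = (if i \<in> pV F then f i else 0)"
    by (rule ex_digits) (use im in \<open>auto simp: image_of_def less_Suc_eq\<close>)
  then obtain fc where fc: "fc < Suc m ^ ?h" "\<And>i. i < ?h \<Longrightarrow> digit (Suc m) fc i = (if i \<in> pV F then f i else 0)" by blast
  have "\<exists>c<Suc m ^ ?h. \<forall>i<?h. digit (Suc m) c i = (if i \<in> pU F then length (Q i) else 0)"
    by (rule ex_digits) (use Lm in \<open>auto simp: less_Suc_eq_le\<close>)
  then obtain lc where lc: "lc < Suc m ^ ?h" "\<And>i. i < ?h \<Longrightarrow> digit (Suc m) lc i = (if i \<in> pU F then length (Q i) else 0)" by blast
  define g where "g j = (if j div Suc m \<in> pU F \<and> j mod Suc m < length (Q (j div Suc m)) then Q (j div Suc m) ! (j mod Suc m) else 0)" for j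
  have "g j < Suc m" for j
    using Qm[of "j div Suc m"] nth_mem[of "j mod Suc m" "Q (j div Suc m)"] by (fastforce simp: g_def)
  then have "\<exists>c<Suc m ^ (?h * Suc m). \<forall>i<?h * Suc m. digit (Suc m) c i = g i" by (intro ex_digits)
  then obtain qc where qc: "qc < Suc m ^ (?h * Suc m)" "\<And>i. i < ?h * Suc m \<Longrightarrow> digit (Suc m) qc i = g i" by blast
  have "map (\<lambda>i. digit (Suc m) qc (t * Suc m + i)) [0..<digit (Suc m) lc t] = Q t" if t: "t \<in> pU F" for t
  proof -
    have th: "t < ?h" using pU_less_code[OF wf t] .
    have l: "digit (Suc m) lc t = length (Q t)" using lc(2)[OF th] t by simp
    have "digit (Suc m) qc (t * Suc m + i) = Q t ! i" if i: "i < length (Q t)" for i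
    proof -
      have im: "i < Suc m" using i Lm[OF t] by simp
      have "t * Suc m + i < Suc t * Suc m" using im by simp
      also have "\<dots> \<le> ?h * Suc m" using th by (intro mult_right_mono) auto
      finally have "digit (Suc m) qc (t * Suc m + i) = g (t * Suc m + i)" by (rule qc(2))
      moreover have "(t * Suc m + i) div Suc m = t" "(t * Suc m + i) mod Suc m = i"
        using im by (simp_all del: mult_Suc_right add: div_mult_self3)
      ultimately show ?thesis using t i by (simp add: g_def)
    qed
    then show ?thesis unfolding l by (intro nth_equalityI) auto
  qed
  moreover have "digit (Suc m) fc a = f a" if "a \<in> pV F" for a using fc(2)[OF pV_less_code[OF wf that]] that by simp
  ultimately show ?thesis using fc(1) lc(1) qc(1) by blast
qed

text \<open>The search runs over graphs with \<open>m\<close> vertices and matrix \<open>d\<close>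
  that are realizations of \<open>H\<close>, and rejects those containing a forbidden pathograph.
  The clause after \<open>code_realizes\<close> demands that the realization covers all
  \<open>m\<close> vertices. The input \<open>x\<close> itself can serve as argument of
  \<open>size_bound\<close> because it bounds every cardinality involved.\<close>

definition decision :: "nat \<Rightarrow> bool" where
  "decision x \<longleftrightarrow> (\<exists>m<Suc (size_bound x). \<exists>d<2 ^ (m * m).
     (\<forall>y<m. \<forall>z<m. code_adj m d y z \<longrightarrow> code_adj m d z y \<and> y \<noteq> z) \<and>
     (\<exists>fc<Suc m ^ fst (prod_decode x). \<exists>lc<Suc m ^ fst (prod_decode x). \<exists>qc<Suc m ^ (fst (prod_decode x) * Suc m).
        code_realizes (fst (prod_decode x)) m d fc lc qc \<and>
        (\<forall>y<m. (\<exists>a<fst (prod_decode x). a \<in> codeV (fst (prod_decode x)) \<and> digit (Suc m) fc a = y) \<or>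
           (\<exists>t<fst (prod_decode x). t \<in> codeU (fst (prod_decode x)) \<and>
              (\<exists>i<digit (Suc m) lc t. digit (Suc m) qc (t * Suc m + i) = y)))) \<and>
     (\<forall>k<snd (prod_decode x). k \<in> set_decode (snd (prod_decode x)) \<longrightarrow>
        \<not> (\<exists>fc<Suc m ^ k. \<exists>lc<Suc m ^ k. \<exists>qc<Suc m ^ (k * Suc m). code_realizes k m d fc lc qc)))"

lemma dec_pred_decision: "dec_pred (Suc 0) (\<lambda>e. decision (hd e))"
  unfolding decision_def size_bound_def short_bound_def
  by (intro rec_intros dec_pred_code_realizes dec_pred_code_adj dec_pred_codes dec_pred_set_decode rec_fun_digit
      rec_fun_fst_prod_decode rec_fun_snd_prod_decode)

lemma set_encode_less:
  assumes "A \<subseteq> {..<n}" shows "set_encode A < 2 ^ n"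
proof -
  have "set_encode A \<le> (\<Sum>i<n. 2 ^ i)" unfolding set_encode_def by (rule sum_mono2) (use assms in auto)
  also have "\<dots> < (2::nat) ^ n" by (induction n) auto
  finally show ?thesis .
qed

text \<open>By \<open>ex_codes\<close> the bounds on the codes lose no copy, and by
  \<open>small_free_realization\<close> the bound on \<open>m\<close> loses no positive
  instance.\<close>

lemma decision_correct:
  fixes H :: "nat pathograph" and Fs :: "nat pathograph set"
  assumes wf: "wf_pathograph H" "pR H = {}" and fin: "finite Fs" and wfF: "\<forall>F\<in>Fs. wf_pathograph F"
  shows "decision (encode_input H Fs) \<longleftrightarrow> (\<exists>G :: nat graph. is_realization H G \<and> is_free Fs G)"
proof -
  let ?x = "encode_input H Fs" and ?h = "encode_pg H" and ?fs = "set_encode (encode_pg ` Fs)"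
  have x: "fst (prod_decode ?x) = ?h" "snd (prod_decode ?x) = ?fs" by (simp_all add: encode_input_def)
  have dfs: "set_decode ?fs = encode_pg ` Fs" using fin by (simp add: set_encode_inverse)
  have hx: "?h \<le> ?x" "?fs \<le> ?x" by (simp_all add: encode_input_def le_prod_encode_1 le_prod_encode_2)
  have kfs: "encode_pg F < ?fs" if "F \<in> Fs" for F using set_decode_less[of "encode_pg F" ?fs] dfs that by blast
  have code: "code_realizes (encode_pg F) m d fc lc qc \<longleftrightarrow>
      realizes F (code_adj m d) (digit (Suc m) fc) (\<lambda>t. map (\<lambda>i. digit (Suc m) qc (t * Suc m + i)) [0..<digit (Suc m) lc t]) \<and>
      image_of F (digit (Suc m) fc) (\<lambda>t. map (\<lambda>i. digit (Suc m) qc (t * Suc m + i)) [0..<digit (Suc m) lc t]) \<subseteq> {..<m}"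
    if "wf_pathograph F" "\<And>y. \<not> code_adj m d y y" for F m d fc lc qc
    unfolding code_realizes_def by (rule idx_realizes_iff[OF that])
  show ?thesis
  proof
    assume "decision ?x"
    then obtain m d fc lc qc where
      sym: "\<forall>y<m. \<forall>z<m. code_adj m d y z \<longrightarrow> code_adj m d z y \<and> y \<noteq> z"
      and H: "code_realizes ?h m d fc lc qc"
      and cov: "\<forall>y<m. (\<exists>a<?h. a \<in> codeV ?h \<and> digit (Suc m) fc a = y) \<or>
           (\<exists>t<?h. t \<in> codeU ?h \<and> (\<exists>i<digit (Suc m) lc t. digit (Suc m) qc (t * Suc m + i) = y))"
      and Fr: "\<forall>k<?fs. k \<in> set_decode ?fs \<longrightarrow>
        \<not> (\<exists>fc<Suc m ^ k. \<exists>lc<Suc m ^ k. \<exists>qc<Suc m ^ (k * Suc m). code_realizes k m d fc lc qc)"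
      unfolding decision_def x by (elim exE conjE)
    \<comment> \<open>Outside \<open>{..<m}\<close> the relation \<open>code_adj\<close> is false,
      so the bounded clause is already the full one.\<close>
    have sym': "code_adj m d y z \<Longrightarrow> code_adj m d z y \<and> y \<noteq> z" for y z
      using sym by (auto simp: code_adj_def)
    then have irr: "\<not> code_adj m d y y" for y by blast
    let ?f = "digit (Suc m) fc" and ?Q = "\<lambda>t. map (\<lambda>i. digit (Suc m) qc (t * Suc m + i)) [0..<digit (Suc m) lc t]"
    have rH: "realizes H (code_adj m d) ?f ?Q" and iH: "image_of H ?f ?Q \<subseteq> {..<m}"
      using H unfolding code[OF wf(1) irr] by blast+
    \<comment> \<open>By the covering clause the realization of \<open>H\<close> is the whole graph,
      so excluding copies in \<open>{..<m}\<close> is the same as excluding them in the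
      realization.\<close>
    have "{..<m} \<subseteq> image_of H ?f ?Q"
    proof
      fix y assume "y \<in> {..<m}"
      then have "(\<exists>a<?h. a \<in> codeV ?h \<and> ?f a = y) \<or>
           (\<exists>t<?h. t \<in> codeU ?h \<and> (\<exists>i<digit (Suc m) lc t. digit (Suc m) qc (t * Suc m + i) = y))"
        using cov by blast
      then consider a where "a \<in> pV H" "y = ?f a" | t where "t \<in> pU H" "y \<in> set (?Q t)"
        unfolding codeV_encode[OF wf(1)] codeU_encode[OF wf(1)] by fastforce
      then show "y \<in> image_of H ?f ?Q"
      proof cases
        case 1
        then show ?thesis by (simp add: image_of_def)
      next
        case 2
        then show ?thesis by (rule realizes_path_in_image[OF wf(1) rH])
      qed
    qed
    then have eqH: "image_of H ?f ?Q = {..<m}" using iH by blast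
    have "free_realization H Fs (code_adj m d) ?f ?Q"
      unfolding free_realization_def eqH
    proof (intro conjI ballI allI impI notI rH)
      fix F f' Q' assume F: "F \<in> Fs" and r: "realizes F (code_adj m d) f' Q'" and i: "image_of F f' Q' \<subseteq> {..<m}"
      have w: "wf_pathograph F" using wfF F by blast
      obtain fc lc qc where c: "fc<Suc m ^ encode_pg F" "lc<Suc m ^ encode_pg F" "qc<Suc m ^ (encode_pg F * Suc m)"
        and e: "\<And>a. a \<in> pV F \<Longrightarrow> digit (Suc m) fc a = f' a"
          "\<And>t. t \<in> pU F \<Longrightarrow> map (\<lambda>i. digit (Suc m) qc (t * Suc m + i)) [0..<digit (Suc m) lc t] = Q' t"
        using ex_codes[OF w r i] by blast
      have "code_realizes (encode_pg F) m d fc lc qc"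
        unfolding code[OF w irr] using realizes_ext[OF w r e] i by simp
      moreover have "encode_pg F < ?fs" "encode_pg F \<in> set_decode ?fs" using kfs[OF F] dfs F by auto
      ultimately show False using Fr c by blast
    qed
    then show "\<exists>G :: nat graph. is_realization H G \<and> is_free Fs G"
      unfolding ex_graph_iff_free_realization[OF wf(1) wfF] using sym' by blast
  next
    assume "\<exists>G :: nat graph. is_realization H G \<and> is_free Fs G"
    then obtain adj0 :: "nat \<Rightarrow> nat \<Rightarrow> bool" and f0 Q0 where adj0: "\<forall>y z. adj0 y z \<longrightarrow> adj0 z y \<and> y \<noteq> z"
      and fr0: "free_realization H Fs adj0 f0 Q0"
      unfolding ex_graph_iff_free_realization[OF wf(1) wfF] by (elim exE conjE)
    have cH: "card (pV H) \<le> ?x" "card (pU H) \<le> ?x"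
      using card_pV_le_code[OF wf(1)] card_pU_le_code[OF wf(1)] hx(1) by auto
    have cF: "\<forall>F\<in>Fs. card (pV F) \<le> ?x \<and> card (pU F) \<le> ?x"
    proof
      fix F assume F: "F \<in> Fs"
      have w: "wf_pathograph F" using wfF F by blast
      show "card (pV F) \<le> ?x \<and> card (pU F) \<le> ?x"
        using card_pV_le_code[OF w] card_pU_le_code[OF w] kfs[OF F] hx(2) by linarith
    qed
    have "symp adj0" using adj0 by (auto intro: sympI)
    from small_free_realization[OF wf wfF cH cF this fr0] obtain m and adj :: "nat \<Rightarrow> nat \<Rightarrow> bool" and f Q where
      m: "m \<le> size_bound ?x" and adj: "\<forall>y z. adj y z \<longrightarrow> adj z y \<and> y \<noteq> z"
      and fr: "free_realization H Fs adj f Q" and im: "image_of H f Q = {..<m}" by (elim exE conjE)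
    define A where "A = {y * m + z | y z. y < m \<and> z < m \<and> adj y z}"
    define d where "d = set_encode A"
    have A: "A \<subseteq> {..<m * m}"
    proof
      fix a assume "a \<in> A"
      then obtain y z where a: "a = y * m + z" "y < m" "z < m" by (auto simp: A_def)
      have "a < Suc y * m" using a by simp
      also have "\<dots> \<le> m * m" using a(2) by (intro mult_right_mono) auto
      finally show "a \<in> {..<m * m}" by simp
    qed
    then have d: "d < 2 ^ (m * m)" unfolding d_def by (rule set_encode_less)
    have "set_decode d = A" unfolding d_def using A by (intro set_encode_inverse) (rule finite_subset, auto)
    have cadj: "code_adj m d y z \<longleftrightarrow> adj y z" if "y < m" "z < m" for y z
    proof -
      \<comment> \<open>Division by \<open>m\<close> recovers the row, so different matrix entries
        use different bits.\<close>
      have "y' = y \<and> z' = z" if "y * m + z = y' * m + z'" "z' < m" for y' z'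
      proof -
        have "(y * m + z) div m = y" "(y' * m + z') div m = y'" using \<open>z < m\<close> that(2) by simp_all
        then show ?thesis using that(1) by auto
      qed
      then show ?thesis unfolding code_adj_def \<open>set_decode d = A\<close> A_def using that by blast
    qed
    have irr: "\<not> code_adj m d y y" for y using cadj[of y y] adj by (auto simp: code_adj_def)
    \<comment> \<open>The map is \<open>id\<close>: the two relations agree on the image
      \<open>{..<m}\<close>.\<close>
    have fr': "free_realization H Fs (code_adj m d) f Q"
      using free_realization_map(1)[OF wf(1) wfF fr, of id "code_adj m d"] cadj im by (simp add: comp_def)
    then have rH: "realizes H (code_adj m d) f Q" unfolding free_realization_def by blast
    obtain fc lc qc where c: "fc<Suc m ^ ?h" "lc<Suc m ^ ?h" "qc<Suc m ^ (?h * Suc m)"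
      and e: "\<And>a. a \<in> pV H \<Longrightarrow> digit (Suc m) fc a = f a"
        "\<And>t. t \<in> pU H \<Longrightarrow> map (\<lambda>i. digit (Suc m) qc (t * Suc m + i)) [0..<digit (Suc m) lc t] = Q t"
      using ex_codes[OF wf(1) rH, of m] im by blast
    have H: "code_realizes ?h m d fc lc qc"
      unfolding code[OF wf(1) irr] using realizes_ext[OF wf(1) rH e] im by simp
    have cov: "(\<exists>a<?h. a \<in> codeV ?h \<and> digit (Suc m) fc a = y) \<or>
           (\<exists>t<?h. t \<in> codeU ?h \<and> (\<exists>i<digit (Suc m) lc t. digit (Suc m) qc (t * Suc m + i) = y))" if "y < m" for y
    proof -
      have "y \<in> image_of H f Q" using that im by simp
      then consider a where "a \<in> pV H" "y = f a" | t where "t \<in> pU H" "y \<in> set (inner (Q t))"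
        unfolding image_of_def by blast
      then show ?thesis
      proof cases
        case 1
        then show ?thesis unfolding codeV_encode[OF wf(1)] using pV_less_code[OF wf(1)] e(1) by blast
      next
        case 2
        then have "y \<in> set (Q t)"
          using in_set_butlastD[of y "Q t"] by (cases "butlast (Q t)") auto
        then have "y \<in> set (map (\<lambda>i. digit (Suc m) qc (t * Suc m + i)) [0..<digit (Suc m) lc t])" unfolding e(2)[OF 2(1)] .
        then have "\<exists>i<digit (Suc m) lc t. digit (Suc m) qc (t * Suc m + i) = y" by auto
        then show ?thesis unfolding codeU_encode[OF wf(1)] using pU_less_code[OF wf(1)] 2(1) by blast
      qed
    qed
    have Fr: "\<not> code_realizes k m d fc lc qc" if k: "k \<in> set_decode ?fs" for k fc lc qc
    proof
      assume cr: "code_realizes k m d fc lc qc"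
      obtain F where F: "F \<in> Fs" "k = encode_pg F" using k unfolding dfs by blast
      have w: "wf_pathograph F" using wfF F(1) by blast
      note r = cr[unfolded F(2) code[OF w irr]]
      show False
        using fr'[unfolded free_realization_def im, THEN conjunct2, rule_format, OF F(1) conjunct1[OF r]] conjunct2[OF r]
        by (rule notE)
    qed
    have 1: "\<forall>y<m. \<forall>z<m. code_adj m d y z \<longrightarrow> code_adj m d z y \<and> y \<noteq> z"
      using cadj adj by auto
    have 2: "\<forall>k<?fs. k \<in> set_decode ?fs \<longrightarrow>
        \<not> (\<exists>fc<Suc m ^ k. \<exists>lc<Suc m ^ k. \<exists>qc<Suc m ^ (k * Suc m). code_realizes k m d fc lc qc)"
      using Fr by blast
    show "decision ?x"
      unfolding decision_def x
      by (rule exI[of _ m], intro conjI, use m in simp, rule exI[of _ d], intro conjI, rule d, rule 1,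
          rule exI[of _ fc], intro conjI, rule c, rule exI[of _ lc], intro conjI, rule c,
          rule exI[of _ qc], intro conjI, rule c, rule H, use cov in blast, rule 2)
  qed
qed

theorem theorem3:
  shows "\<exists>p. \<forall>(H :: nat pathograph) (Fs :: nat pathograph set).
           wf_pathograph H \<and> pR H = {} \<and> finite Fs \<and> (\<forall>F\<in>Fs. wf_pathograph F) \<longrightarrow>
           eval p [encode_input H Fs]
             (if \<exists>G :: nat graph. is_realization H G \<and> is_free Fs G then 1 else 0)"
proof -
  obtain p where p: "\<And>e. length e = Suc 0 \<Longrightarrow> eval p e (of_bool (decision (hd e)))"
    using dec_pred_decision unfolding dec_pred_def rec_fun_def by blast
  have "eval p [encode_input H Fs] (if \<exists>G :: nat graph. is_realization H G \<and> is_free Fs G then 1 else 0)"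
    if "wf_pathograph H \<and> pR H = {} \<and> finite Fs \<and> (\<forall>F\<in>Fs. wf_pathograph F)"
    for H :: "nat pathograph" and Fs :: "nat pathograph set"
  proof -
    have "decision (encode_input H Fs) \<longleftrightarrow> (\<exists>G :: nat graph. is_realization H G \<and> is_free Fs G)"
      using that by (intro decision_correct) auto
    then show ?thesis using p[of "[encode_input H Fs]"] by (simp add: of_bool_def)
  qed
  then show ?thesis by blast
qed

end
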